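(* Let $p,q\ge 1$ be integers, let $A_1,\dots,A_p>0$, $B_1,\dots,B_q>0$, $a_1,\dots,a_p\ge 0$, $b_1,\dots,b_q\ge 0$. Put $$\rho=\prod_{i=1}^{p}A_i^{A_i}\prod_{j=1}^{q}B_j^{-B_j},\qquad \mu=\sum_{j=1}^{q}b_j-\sum_{i=1}^{p}a_i+\frac{p-q}{2},\qquad W(x)=\frac{\prod_{i=1}^{p}\Gamma(A_ix+a_i)}{\prod_{j=1}^{q}\Gamma(B_jx+b_j)}\quad(x>0).$$ Suppose that $\mu>0$ and that $W$ is logarithmically completely monotonic on $(0,\infty)$. Then for all $x>0$ $$W(x)=\int_{\log(1/\rho)}^{\infty}e^{-tx}H(e^{-t})\,dt,$$ where $H$ is the Fox $H$-function $H^{p,0}_{q,p}$ with parameters $(\mathbf B,\mathbf b)$, $(\mathbf A,\mathbf a)$ defined in the context, and $H(e^{-t})\ge 0$ for all $t>\log(1/\rho)$. In particular, the conclusion is true if $\mu>0$, $\sum_{j=1}^{q}B_j=\sum_{i=1}^{p}A_i$, $\rho\le 1$, and at least one of the following conditions holds: (a) $\max_{1\le i\le p}(a_i/A_i)\le \min_{1\le j\le q}(b_j-1)/B_j$; (b) $p=q$, $A_i\ge B_i$ for $i=1,\dots,p-1$, $\max_{1\le k\le p-1}b_k/B_k\le (b_p-1)/B_p$ and $a_i/A_i\le (b_i-1)/B_i$ for $i=1,\dots,p$; (c) $p=q$, $0\le a_1/A_1\le\cdots\le a_p/A_p$, $0\le b_1/B_1\le\cdots\le b_p/B_p$, $0<1/A_1\le\cdots\le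 1/A_p$, $0<1/B_1\le\cdots\le 1/B_p$, and $\sum_{i=1}^{k}a_i/A_i\le\sum_{i=1}^{k}b_i/B_i$, $\sum_{i=1}^{k}1/A_i\le\sum_{i=1}^{k}1/B_i$ for each $k=1,\dots,p$.
   Context: A nonnegative function $f$ on $(0,\infty)$ is completely monotonic if it has derivatives of all orders and $(-1)^nf^{(n)}(x)\ge 0$ for all $n\ge 1$, $x>0$. A positive function $f$ on $(0,\infty)$ is logarithmically completely monotonic if $-(\log f)'$ is completely monotonic on $(0,\infty)$. Fox's $H$-function: with $\gamma=-\min_{1\le k\le p}(a_k/A_k)$ and any $c>\gamma$, for $z>0$, $$H(z)=H^{p,0}_{q,p}\left(z\left|\begin{array}{l}(\mathbf B,\mathbf b)\\(\mathbf A,\mathbf a)\end{array}\right.\right)=\lim_{R\to\infty}\frac{1}{2\pi i}\int_{c-iR}^{c+iR}\frac{\prod_{k=1}^{p}\Gamma(A_ks+a_k)}{\prod_{j=1}^{q}\Gamma(B_js+b_j)}z^{-s}\,ds,$$ which exists for all $z>0$ except possibly $z=\rho$ when $\mu>0$ and $\sum_{i}A_i=\sum_{j}B_j$. In (b), when $p=1$ the condition with a maximum over the empty set is vacuous. *)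

theory Defs
  imports "HOL-Complex_Analysis.Complex_Analysis"
begin

definition completely_monotonic :: "(real \<Rightarrow> real) \<Rightarrow> bool" where
  "completely_monotonic f \<longleftrightarrow>
     (\<forall>x>0. f x \<ge> 0) \<and>
     (\<forall>n. \<forall>x>0. (deriv ^^ n) f differentiable (at x)) \<and>
     (\<forall>n\<ge>1. \<forall>x>0. (- 1) ^ n * (deriv ^^ n) f x \<ge> 0)"

definition log_completely_monotonic :: "(real \<Rightarrow> real) \<Rightarrow> bool" where
  "log_completely_monotonic f \<longleftrightarrow>
     (\<forall>x>0. f x > 0) \<and>
     (\<forall>x>0. (\<lambda>y. ln (f y)) differentiable (at x)) \<and>
     completely_monotonic (\<lambda>x. - deriv (\<lambda>y. ln (f y)) x)"

text \<open>
  Parameter vectors $A_1,\ldots,A_p$ etc. are functions on \<open>nat\<close>, of which only the values on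
  \<open>{1..p}\<close> (for \<open>A\<close>, \<open>a\<close>) and \<open>{1..q}\<close> (for \<open>B\<close>, \<open>b\<close>) are used.

  \<open>gamma_ratio\<close> is used both at type \<open>real\<close> and at type \<open>complex\<close>. Where a denominator factor has
  a pole, the library conventions \<open>Gamma z = 0\<close> and \<open>w / 0 = 0\<close> give the correct value $0$ of
  the reciprocal Gamma function.
\<close>

definition gamma_ratio ::
  "nat \<Rightarrow> nat \<Rightarrow> (nat \<Rightarrow> real) \<Rightarrow> (nat \<Rightarrow> real) \<Rightarrow> (nat \<Rightarrow> real) \<Rightarrow> (nat \<Rightarrow> real) \<Rightarrow> 'a \<Rightarrow> 'a::Gamma" where
  "gamma_ratio p q A a B b s =
     (\<Prod>i=1..p. Gamma (of_real (A i) * s + of_real (a i))) /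
     (\<Prod>j=1..q. Gamma (of_real (B j) * s + of_real (b j)))"

definition gamma_ratio_rho :: "nat \<Rightarrow> nat \<Rightarrow> (nat \<Rightarrow> real) \<Rightarrow> (nat \<Rightarrow> real) \<Rightarrow> real" where
  "gamma_ratio_rho p q A B = (\<Prod>i=1..p. A i powr A i) * (\<Prod>j=1..q. B j powr (- B j))"

definition gamma_ratio_mu :: "nat \<Rightarrow> nat \<Rightarrow> (nat \<Rightarrow> real) \<Rightarrow> (nat \<Rightarrow> real) \<Rightarrow> real" where
  "gamma_ratio_mu p q a b = (\<Sum>j=1..q. b j) - (\<Sum>i=1..p. a i) + (real p - real q) / 2"

definition fox_H_abscissa :: "nat \<Rightarrow> (nat \<Rightarrow> real) \<Rightarrow> (nat \<Rightarrow> real) \<Rightarrow> real" where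
  "fox_H_abscissa p A a = - (MIN k\<in>{1..p}. a k / A k)"

definition fox_H_truncated ::
  "nat \<Rightarrow> nat \<Rightarrow> (nat \<Rightarrow> real) \<Rightarrow> (nat \<Rightarrow> real) \<Rightarrow> (nat \<Rightarrow> real) \<Rightarrow> (nat \<Rightarrow> real) \<Rightarrow>
   real \<Rightarrow> real \<Rightarrow> real \<Rightarrow> complex" where
  "fox_H_truncated p q A a B b c z R =
     1 / (2 * of_real pi * \<i>) *
     contour_integral (linepath (Complex c (- R)) (Complex c R))
       (\<lambda>s. gamma_ratio p q A a B b s * of_real z powr (- s))"

text \<open>
  Fox's function $H^{p,0}_{q,p}$ with upper parameters $(B,b)$ and lower parameters $(A,a)$. The
  abscissa \<open>c\<close> of the line of integration stays explicit; it is meant to be any real number greater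
  than \<open>fox_H_abscissa p A a\<close>.
\<close>

definition fox_H ::
  "nat \<Rightarrow> nat \<Rightarrow> (nat \<Rightarrow> real) \<Rightarrow> (nat \<Rightarrow> real) \<Rightarrow> (nat \<Rightarrow> real) \<Rightarrow> (nat \<Rightarrow> real) \<Rightarrow>
   real \<Rightarrow> real \<Rightarrow> complex" where
  "fox_H p q A a B b c z = Lim at_top (fox_H_truncated p q A a B b c z)"

text \<open>
  The representation of the Gamma ratio as the Laplace transform of a nonnegative H-function.
  As \<open>Lim\<close> is total, convergence of the limit defining \<open>H\<close> is stated separately.
  Because \<open>H\<close> is nonnegative, the gauge integral here is an absolutely convergent Lebesgue
  integral; its value does not depend on \<open>H\<close> at the excluded end point $z = \rho$.
\<close>

definition fox_H_laplace_representation ::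
  "nat \<Rightarrow> nat \<Rightarrow> (nat \<Rightarrow> real) \<Rightarrow> (nat \<Rightarrow> real) \<Rightarrow> (nat \<Rightarrow> real) \<Rightarrow> (nat \<Rightarrow> real) \<Rightarrow> bool" where
  "fox_H_laplace_representation p q A a B b \<longleftrightarrow>
     (\<forall>c > fox_H_abscissa p A a.
        (\<forall>t > ln (1 / gamma_ratio_rho p q A B).
           (fox_H_truncated p q A a B b c (exp (- t)) \<longlongrightarrow> fox_H p q A a B b c (exp (- t))) at_top) \<and>
        (\<forall>x>0. ((\<lambda>t. of_real (exp (- t * x)) * fox_H p q A a B b c (exp (- t)))
                 has_integral of_real (gamma_ratio p q A a B b x))
                 {ln (1 / gamma_ratio_rho p q A B)<..}) \<and>
        (\<forall>t > ln (1 / gamma_ratio_rho p q A B).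
           fox_H p q A a B b c (exp (- t)) \<in> \<real>\<^sub>\<ge>\<^sub>0))"

end

theory Submission
  imports Defs "HOL-Probability.Sinc_Integral"
begin

text \<open>
  Write \<open>G = -(ln W)'\<close>. The partial fraction series of the Polygamma functions show that, when
  \<open>\<Sum>B = \<Sum>A\<close>, the function \<open>G + ln \<rho>\<close> is the Laplace transform of the density
  \<open>P(u) = \<Sum>\<^sub>i exp(-a\<^sub>i u/A\<^sub>i) / (1 - exp(-u/A\<^sub>i)) - \<Sum>\<^sub>j exp(-b\<^sub>j u/B\<^sub>j) / (1 - exp(-u/B\<^sub>j))\<close>
  (lemma \<open>g0_eq\<close>). The simple poles of the summands at 0 cancel, so \<open>P\<close> is analytic near \<open>[0, \<infinity>)\<close>, and
  \<open>P(0) = \<mu>\<close>. Subtracting \<open>\<mu> exp(-u)\<close> from \<open>P\<close> and integrating \<open>G\<close> gives (\<open>W_factorization\<close>)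
  a factorization \<open>W(x) = C \<rho>^x (x+1)^(-\<mu>) exp(R(x))\<close>, where \<open>R\<close> is the Laplace transform of the bounded,
  locally Lipschitz function \<open>Q(u) = (P(u) - \<mu> exp(-u))/u\<close>. Every factor is a Laplace transform:
  the power belongs to a Gamma density, \<open>exp(R)\<close> to a convolution exponential, and \<open>\<rho>^x\<close> is a
  shift by \<open>ln(1/\<rho>)\<close>. Hence \<open>W\<close> is the Laplace transform of an explicit function \<open>f\<close> that
  vanishes up to \<open>ln(1/\<rho>)\<close> and is Lipschitz at every later point (\<open>W_laplace\<close>).

  It remains to identify \<open>f(t)\<close> with \<open>H(exp(-t))\<close> and to see that \<open>f \<ge> 0\<close>. If \<open>G\<close> is completely
  monotonic, so is \<open>W\<close>, by the Leibniz rule applied to \<open>W' = -G W\<close>; in terms of \<open>f\<close>, all the moments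
  of \<open>t^n exp(-xt)\<close> against \<open>f\<close> are nonnegative. As \<open>(t exp(-t/s))^n\<close> concentrates at \<open>t = s\<close>, this
  forces \<open>f(s) \<ge> 0\<close> (\<open>nonneg_of_laplace_moments_nonneg\<close>). By Landau's theorem (\<open>landau_laplace\<close>)
  the Laplace integral of a nonnegative function converges absolutely on the largest right half-plane to which
  its transform continues analytically; for \<open>W\<close> this contains every line \<open>Re s = c\<close> with
  \<open>c > \<gamma>\<close>. On such a line Fubini's theorem turns the truncated inversion integral into a Dirichlet
  integral of \<open>f\<close>, which tends to \<open>f(t)\<close> because \<open>f\<close> is Lipschitz at \<open>t\<close> (\<open>bromwich_inversion\<close>).

  Logarithmic complete monotonicity of \<open>W\<close> entails \<open>\<Sum>B = \<Sum>A\<close> and \<open>\<rho> \<le> 1\<close>: the function \<open>G\<close> is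
  nonnegative and decreasing, whereas \<open>G(x) - (\<Sum>B - \<Sum>A) ln x\<close> tends to \<open>-ln \<rho>\<close>. Conversely, given these two
  relations, \<open>P \<ge> 0\<close> makes \<open>G\<close> completely monotonic. Each of (a), (b), (c) yields \<open>P \<ge> 0\<close>:
  the first two by comparing the summands of \<open>P\<close> with exponentials divided by \<open>u\<close>, the third by
  expanding them into geometric series and applying a majorization inequality to each power.
\<close>

section \<open>Laplace transforms on the half-line\<close>

lemma abs_exp_minus_linear_le: "\<bar>exp y - 1 - y\<bar> \<le> y\<^sup>2 / 2 * exp \<bar>y\<bar>" for y :: real
proof -
  obtain t where t: "\<bar>t\<bar> \<le> \<bar>y\<bar>" and e: "exp y = (\<Sum>m<2. y ^ m / fact m) + exp t / fact 2 * y ^ 2"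
    using Maclaurin_exp_le[of y 2] by blast
  have "exp y - 1 - y = y\<^sup>2 / 2 * exp t"
    using e by (simp add: numeral_2_eq_2)
  moreover have "exp t \<le> exp \<bar>y\<bar>" using t by simp
  ultimately show ?thesis
    by (simp only: abs_mult) (auto intro!: mult_left_mono)
qed

lemma power_div_fact_le_exp: "y ^ n / fact n \<le> exp y" if "y \<ge> 0" for y :: real
proof -
  have "(\<Sum>k\<in>{n}. y ^ k /\<^sub>R fact k) \<le> (\<Sum>k. y ^ k /\<^sub>R fact k)"
    using that by (intro sum_le_suminf summable_exp_generic) auto
  thus ?thesis by (simp add: exp_def field_simps)
qed

text \<open>
  The monomial is absorbed by a part of the exponential: \<open>v^n exp(-xv)\<close> is at most a constant times
  \<open>exp(-xv/2)\<close>.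
\<close>
lemma laplace_moment_integrable:
  fixes f :: "real \<Rightarrow> real"
  assumes supp: "\<And>v. v < 0 \<Longrightarrow> f v = 0"
    and int: "\<And>x. x > 0 \<Longrightarrow> integrable lborel (\<lambda>v. exp (- (x * v)) * f v)"
    and x: "x > 0"
  shows "integrable lborel (\<lambda>v. v ^ n * exp (- (x * v)) * f v)"
proof -
  have [measurable]: "f \<in> borel_measurable borel"
  proof -
    have "(\<lambda>v. exp v * (exp (- (1 * v)) * f v)) \<in> borel_measurable borel"
      using borel_measurable_integrable[OF int[of 1]] by measurable
    thus ?thesis by (simp add: mult.assoc[symmetric] exp_add[symmetric])
  qed
  define y where "y = x / 2"
  have y: "y > 0" using x by (simp add: y_def)
  have ineq: "v ^ n * exp (- (x * v)) \<le> fact n / y ^ n * exp (- (y * v))" if "v \<ge> 0" for v :: real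
  proof -
    have "(y * v) ^ n / fact n \<le> exp (y * v)"
      using y that by (intro power_div_fact_le_exp) simp
    hence "v ^ n \<le> fact n / y ^ n * exp (y * v)"
      using y by (simp add: field_simps power_mult_distrib)
    hence "v ^ n * exp (- (x * v)) \<le> fact n / y ^ n * exp (y * v) * exp (- (x * v))"
      by (rule mult_right_mono) simp
    also have "\<dots> = fact n / y ^ n * exp (- (y * v))"
      by (simp add: mult.assoc exp_add[symmetric]) (simp add: y_def)
    finally show ?thesis .
  qed
  show ?thesis
  proof (rule Bochner_Integration.integrable_bound)
    show "integrable lborel (\<lambda>v. fact n / y ^ n * (exp (- (y * v)) * f v))"
      using int[OF y] by simp
    show "AE v in lborel. norm (v ^ n * exp (- (x * v)) * f v) \<le> norm (fact n / y ^ n * (exp (- (y * v)) * f v))"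
    proof (intro AE_I2)
      fix v :: real
      show "norm (v ^ n * exp (- (x * v)) * f v) \<le> norm (fact n / y ^ n * (exp (- (y * v)) * f v))"
      proof (cases "v < 0")
        case False
        have "\<bar>v ^ n * exp (- (x * v))\<bar> * \<bar>f v\<bar> \<le> \<bar>fact n / y ^ n * exp (- (y * v))\<bar> * \<bar>f v\<bar>"
          using ineq[of v] False y by (intro mult_right_mono) auto
        thus ?thesis by (simp add: abs_mult mult.assoc)
      qed (simp add: supp)
    qed
  qed measurable
qed

text \<open>
  The second-order bound on the exponential above makes the error of the difference quotient \<open>O(d)\<close>,
  with a constant that is itself a convergent Laplace integral. The sign is the reason for
  working below with families \<open>w\<^sub>0, w\<^sub>1, \<dots>\<close> such that \<open>w\<^sub>n' = -w\<^sub>n\<^sub>+\<^sub>1\<close>: they encode \<open>(-1)^n\<close> times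
  the \<open>n\<close>-th derivative of \<open>w\<^sub>0\<close>.
\<close>
lemma laplace_moment_has_derivative:
  fixes f :: "real \<Rightarrow> real"
  assumes supp: "\<And>v. v < 0 \<Longrightarrow> f v = 0"
    and int: "\<And>x. x > 0 \<Longrightarrow> integrable lborel (\<lambda>v. exp (- (x * v)) * f v)"
    and x: "x > 0"
  shows "((\<lambda>x. \<integral>v. v ^ n * exp (- (x * v)) * f v \<partial>lborel) has_real_derivative
           - (\<integral>v. v ^ Suc n * exp (- (x * v)) * f v \<partial>lborel)) (at x)"
proof -
  define m where "m = (\<lambda>n x. \<integral>v. v ^ n * exp (- (x * v)) * f v \<partial>lborel)"
  define K where "K = (\<integral>v. v ^ (n+2) * exp (- (x/2 * v)) * \<bar>f v\<bar> \<partial>lborel)"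
  have mi: "integrable lborel (\<lambda>v. v ^ n * exp (- (x * v)) * f v)" if "x > 0" for n x
    using laplace_moment_integrable[of f, OF supp int that] .
  have mi': "integrable lborel (\<lambda>v. v ^ (n+2) * exp (- (x/2 * v)) * \<bar>f v\<bar>)"
  proof (rule laplace_moment_integrable)
    fix x :: real assume "x > 0"
    from integrable_abs[OF int[OF this]] show "integrable lborel (\<lambda>v. exp (- (x * v)) * \<bar>f v\<bar>)"
      by (simp add: abs_mult)
  qed (use x supp in auto)
  have est: "\<bar>m n (x + d) - m n x + d * m (Suc n) x\<bar> \<le> d\<^sup>2 / 2 * K" if d: "\<bar>d\<bar> < x / 2" for d
  proof -
    have pos: "x + d > 0" using d x by linarith
    have eq: "m n (x + d) - m n x + d * m (Suc n) x =
        (\<integral>v. v ^ n * exp (- ((x + d) * v)) * f v - v ^ n * exp (- (x * v)) * f v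
              + d * (v ^ Suc n * exp (- (x * v)) * f v) \<partial>lborel)"
      unfolding m_def using mi[OF pos, of n] mi[OF x, of n] mi[OF x, of "Suc n"]
      by (simp del: power_Suc mult_Suc)
    show ?thesis
      unfolding eq K_def integral_mult_right_zero[symmetric]
    proof (rule integral_abs_bound_integral)
      fix v :: real
      show "\<bar>v ^ n * exp (- ((x + d) * v)) * f v - v ^ n * exp (- (x * v)) * f v
              + d * (v ^ Suc n * exp (- (x * v)) * f v)\<bar>
          \<le> d\<^sup>2 / 2 * (v ^ (n+2) * exp (- (x/2 * v)) * \<bar>f v\<bar>)"
      proof (cases "v < 0")
        case False
        have "v ^ n * exp (- ((x + d) * v)) * f v - v ^ n * exp (- (x * v)) * f v
              + d * (v ^ Suc n * exp (- (x * v)) * f v) =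
              v ^ n * exp (- (x * v)) * f v * (exp (- (d * v)) - 1 - (- (d * v)))"
        proof -
          have e: "exp (- ((x + d) * v)) = exp (- (x * v)) * exp (- (d * v))"
            by (simp add: exp_add[symmetric] distrib_right)
          show ?thesis unfolding e by (simp add: algebra_simps)
        qed
        also have "\<bar>\<dots>\<bar> \<le> (v ^ n * exp (- (x * v)) * \<bar>f v\<bar>) * ((d * v)\<^sup>2 / 2 * exp \<bar>d * v\<bar>)"
        proof -
          have "\<bar>exp (- (d * v)) - 1 - (- (d * v))\<bar> \<le> (d * v)\<^sup>2 / 2 * exp \<bar>d * v\<bar>"
            using abs_exp_minus_linear_le[of "- (d * v)"] by (simp only: power2_minus abs_minus_cancel)
          moreover have "\<bar>v ^ n * exp (- (x * v)) * f v\<bar> = v ^ n * exp (- (x * v)) * \<bar>f v\<bar>"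
            using False by (simp add: abs_mult)
          ultimately show ?thesis
            unfolding abs_mult[of "v ^ n * exp (- (x * v)) * f v"] using False
            by (metis mult_left_mono abs_ge_zero)
        qed
        also have "\<dots> \<le> (v ^ n * exp (- (x * v)) * \<bar>f v\<bar>) * ((d * v)\<^sup>2 / 2 * exp (x / 2 * v))"
        proof -
          have "\<bar>d * v\<bar> \<le> x / 2 * v"
            unfolding abs_mult using d False by (intro mult_mono) auto
          thus ?thesis using False by (intro mult_left_mono) auto
        qed
        also have "\<dots> = d\<^sup>2 / 2 * (v ^ (n+2) * (exp (- (x * v)) * exp (x / 2 * v)) * \<bar>f v\<bar>)"
          by (simp add: power_mult_distrib power_add power2_eq_square)
        also have "exp (- (x * v)) * exp (x / 2 * v) = exp (- (x/2 * v))"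
          by (simp add: exp_add[symmetric])
        finally show ?thesis .
      qed (simp add: supp)
    next
      show "integrable lborel (\<lambda>v. v ^ n * exp (- ((x + d) * v)) * f v - v ^ n * exp (- (x * v)) * f v
              + d * (v ^ Suc n * exp (- (x * v)) * f v))"
        by (intro Bochner_Integration.integrable_add Bochner_Integration.integrable_diff
              integrable_mult_right mi pos x)
      show "integrable lborel (\<lambda>v. d\<^sup>2 / 2 * (v ^ (n+2) * exp (- (x/2 * v)) * \<bar>f v\<bar>))"
        by (intro integrable_mult_right mi')
    qed
  qed
  have "((\<lambda>d. (m n (x + d) - m n x) / d) \<longlongrightarrow> - m (Suc n) x) (at 0)"
  proof (rule LIM_zero_cancel, rule Lim_null_comparison)
    show "\<forall>\<^sub>F d in at 0. norm ((m n (x + d) - m n x) / d - - m (Suc n) x) \<le> \<bar>d\<bar> / 2 * K"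
      unfolding eventually_at
    proof (intro exI[of _ "x/2"] conjI ballI impI)
      fix d :: real assume d: "d \<noteq> 0 \<and> dist d 0 < x / 2"
      have "\<bar>(m n (x + d) - m n x) / d + m (Suc n) x\<bar> * \<bar>d\<bar> = \<bar>m n (x + d) - m n x + d * m (Suc n) x\<bar>"
      proof -
        have "((m n (x + d) - m n x) / d + m (Suc n) x) * d = m n (x + d) - m n x + d * m (Suc n) x"
          using d by (simp add: distrib_right)
        thus ?thesis unfolding abs_mult[symmetric] by (rule arg_cong)
      qed
      also have "\<dots> \<le> d\<^sup>2 / 2 * K" using est d by auto
      also have "\<dots> = (\<bar>d\<bar> / 2 * K) * \<bar>d\<bar>" by (simp add: power2_eq_square)
      finally show "norm ((m n (x + d) - m n x) / d - - m (Suc n) x) \<le> \<bar>d\<bar> / 2 * K"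
        using d by (simp add: mult.commute)
    qed (use x in auto)
    show "((\<lambda>d. \<bar>d\<bar> / 2 * K) \<longlongrightarrow> 0) (at 0)"
      by (auto intro!: tendsto_eq_intros)
  qed
  thus ?thesis unfolding DERIV_def m_def by simp
qed

section \<open>Positivity from alternating derivatives\<close>

text \<open>
  Here \<open>w\<^sub>0' = -w\<^sub>0 g\<^sub>0\<close>, so the Leibniz rule writes \<open>w\<^sub>n\<^sub>+\<^sub>1\<close> as a combination of products \<open>w\<^sub>k g\<^sub>n\<^sub>-\<^sub>k\<close>
  with positive coefficients. This is the passage from logarithmic complete monotonicity to complete
  monotonicity.
\<close>
lemma alternating_derivatives_nonneg:
  fixes w g :: "nat \<Rightarrow> real \<Rightarrow> real"
  assumes w: "\<And>n x. x > 0 \<Longrightarrow> (w n has_real_derivative - w (Suc n) x) (at x)"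
    and g: "\<And>n x. x > 0 \<Longrightarrow> (g n has_real_derivative - g (Suc n) x) (at x)"
    and w1: "\<And>x. x > 0 \<Longrightarrow> w 1 x = w 0 x * g 0 x"
    and w0: "\<And>x. x > 0 \<Longrightarrow> w 0 x \<ge> 0"
    and gn: "\<And>n x. x > 0 \<Longrightarrow> g n x \<ge> 0"
    and x: "x > 0"
  shows "w n x \<ge> 0"
proof -
  have leibniz: "w (Suc n) x = (\<Sum>k\<le>n. of_nat (n choose k) * w k x * g (n - k) x)" if "x > 0" for n x
    using that
  proof (induction n arbitrary: x)
    case (Suc n)
    let ?S = "\<lambda>x. \<Sum>k\<le>n. of_nat (n choose k) * w k x * g (n - k) x"
    have "(?S has_real_derivative
            (\<Sum>k\<le>n. of_nat (n choose k) * (- w (Suc k) x * g (n - k) x - w k x * g (Suc (n - k)) x))) (at x)"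
      by (auto intro!: derivative_eq_intros w g Suc.prems sum.cong simp: algebra_simps)
    moreover have "(?S has_real_derivative - w (Suc (Suc n)) x) (at x)"
    proof (rule has_field_derivative_transform_within_open[OF w[OF Suc.prems, of "Suc n"], of "{0<..}"])
      show "\<And>y. y \<in> {0<..} \<Longrightarrow> w (Suc n) y = ?S y" using Suc.IH by auto
    qed (use Suc.prems in auto)
    ultimately have "w (Suc (Suc n)) x =
        - (\<Sum>k\<le>n. of_nat (n choose k) * (- w (Suc k) x * g (n - k) x - w k x * g (Suc (n - k)) x))"
      using DERIV_unique by fastforce
    also have "\<dots> = (\<Sum>k\<le>n. of_nat (n choose k) * (w (Suc k) x * g (n - k) x))
                   + (\<Sum>k\<le>n. of_nat (n choose k) * (w k x * g (Suc n - k) x))"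
      unfolding sum_negf[symmetric] sum.distrib[symmetric]
      by (intro sum.cong refl) (auto simp: algebra_simps Suc_diff_le)
    also have "(\<Sum>k\<le>n. of_nat (n choose k) * (w k x * g (Suc n - k) x)) =
               (\<Sum>k\<le>Suc n. of_nat (n choose k) * (w k x * g (Suc n - k) x))"
      by simp
    also have "\<dots> = w 0 x * g (Suc n) x + (\<Sum>k\<le>n. of_nat (n choose Suc k) * (w (Suc k) x * g (n - k) x))"
      by (subst sum.atMost_Suc_shift) simp
    also have "(\<Sum>k\<le>Suc n. of_nat (Suc n choose k) * w k x * g (Suc n - k) x) =
       w 0 x * g (Suc n) x + (\<Sum>k\<le>n. of_nat (Suc n choose Suc k) * w (Suc k) x * g (n - k) x)"
      by (subst sum.atMost_Suc_shift) simp
    ultimately show ?case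
      by (simp add: sum.distrib[symmetric] algebra_simps)
  qed (use w1 in simp)
  show ?thesis using x
  proof (induction n rule: less_induct)
    case (less n)
    show ?case
    proof (cases n)
      case (Suc m)
      have "w (Suc m) x \<ge> 0"
        unfolding leibniz[OF x] using less Suc gn[OF x] by (intro sum_nonneg mult_nonneg_nonneg) auto
      thus ?thesis by (simp add: Suc)
    qed (use w0 less in simp)
  qed
qed

text \<open>
  The profile \<open>y exp(1 - y)\<close> has a strict maximum 1 at \<open>y = 1\<close>; its powers will serve as an
  approximate identity.
\<close>
lemma mult_exp_one_minus:
  fixes y c :: real
  shows mult_exp_one_minus_mono: "y \<le> c \<Longrightarrow> c \<le> 1 \<Longrightarrow> y * exp (1 - y) \<le> c * exp (1 - c)"
    and mult_exp_one_minus_antimono: "1 \<le> c \<Longrightarrow> c \<le> y \<Longrightarrow> y * exp (1 - y) \<le> c * exp (1 - c)"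
    and mult_exp_one_minus_less_1: "y \<ge> 0 \<Longrightarrow> y \<noteq> 1 \<Longrightarrow> y * exp (1 - y) < 1"
proof -
  have D: "((\<lambda>y. y * exp (1 - y)) has_real_derivative (1 - z) * exp (1 - z)) (at z)" for z :: real
    by (auto intro!: derivative_eq_intros simp: algebra_simps)
  show "y * exp (1 - y) \<le> c * exp (1 - c)" if "y \<le> c" "c \<le> 1"
    using that D by (intro DERIV_nonneg_imp_nondecreasing[of y c "\<lambda>y. y * exp (1 - y)"]) (fastforce intro!: mult_nonneg_nonneg)+
  show "y * exp (1 - y) \<le> c * exp (1 - c)" if "1 \<le> c" "c \<le> y"
    using that D by (intro DERIV_nonpos_imp_nonincreasing[of c y "\<lambda>y. y * exp (1 - y)"]) (fastforce intro!: mult_nonpos_nonneg)+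
  show "y * exp (1 - y) < 1" if "y \<ge> 0" "y \<noteq> 1"
  proof -
    have "y < (1 + (y - 1) / 2)\<^sup>2"
    proof -
      have "(1 + (y - 1) / 2)\<^sup>2 - y = ((y - 1) / 2)\<^sup>2" by (simp add: power2_eq_square field_simps)
      moreover have "((y - 1) / 2)\<^sup>2 > 0" using that by simp
      ultimately show ?thesis by linarith
    qed
    also have "\<dots> \<le> (exp ((y - 1) / 2))\<^sup>2"
      using that exp_ge_add_one_self[of "(y - 1) / 2"] by (intro power_mono) (auto simp: field_simps)
    also have "\<dots> = exp (y - 1)" by (simp add: power2_eq_square exp_add[symmetric])
    finally have "y * exp (1 - y) < exp (y - 1) * exp (1 - y)" by simp
    also have "\<dots> = 1" by (simp add: exp_add[symmetric])
    finally show ?thesis .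
  qed
qed

text \<open>
  Suppose \<open>f < -e\<close> near \<open>t\<close>, and take \<open>x = 1 + n/t\<close>. Up to a positive factor the moment is the integral of
  \<open>w^n exp(-v) f(v)\<close>, where \<open>w(v) = (v/t) exp(1 - v/t)\<close> exceeds some \<open>r'\<close> close to \<open>t\<close> and stays
  below some \<open>r < r'\<close> away from \<open>t\<close>. The negative part is thus of order \<open>r'^n\<close>, which beats
  everything else as \<open>n\<close> grows.
\<close>
lemma nonneg_of_laplace_moments_nonneg:
  fixes f :: "real \<Rightarrow> real"
  assumes supp: "\<And>v. v < 0 \<Longrightarrow> f v = 0"
    and int: "\<And>x. x > 0 \<Longrightarrow> integrable lborel (\<lambda>v. exp (- (x * v)) * f v)"
    and mom: "\<And>n x. x > 0 \<Longrightarrow> (\<integral>v. v ^ n * exp (- (x * v)) * f v \<partial>lborel) \<ge> 0"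
    and t: "t > 0" and cont: "isCont f t"
  shows "f t \<ge> 0"
proof (rule ccontr)
  assume neg: "\<not> f t \<ge> 0"
  define e where "e = - f t / 2"
  have e: "e > 0" using neg by (simp add: e_def)
  have "\<forall>\<^sub>F v in nhds t. f v < - e"
    using cont neg order_tendstoD(2)[of f "f t" "nhds t" "- e"]
    by (auto simp: e_def continuous_at tendsto_at_iff_tendsto_nhds)
  then obtain d0 where d0: "d0 > 0" "\<And>v. dist v t < d0 \<Longrightarrow> f v < - e"
    by (auto simp: eventually_nhds_metric)
  define d where "d = min d0 t"
  have d: "d > 0" "d \<le> t" using d0 t by (auto simp: d_def)
  have fd: "f v < - e" if "\<bar>v - t\<bar> < d" for v
    using that d0(2)[of v] by (auto simp: d_def dist_real_def)
  define w where "w = (\<lambda>v. v / t * exp (1 - v / t))"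
  define r where "r = max (w (t - d)) (w (t + d))"
  have r1: "r < 1"
    unfolding r_def w_def
    using mult_exp_one_minus_less_1[of "(t - d) / t"] mult_exp_one_minus_less_1[of "(t + d) / t"] d t
    by simp
  have r0: "r \<ge> 0" unfolding r_def w_def using d t by (auto intro!: mult_nonneg_nonneg simp: le_max_iff_disj)
  have wr: "w v \<le> r" if "v \<ge> 0" "\<bar>v - t\<bar> \<ge> d" for v
  proof (cases "v \<le> t")
    case True
    have "w v \<le> w (t - d)" unfolding w_def
      using that True d t by (intro mult_exp_one_minus_mono) (auto simp: divide_simps)
    thus ?thesis by (simp add: r_def)
  next
    case False
    have "w v \<le> w (t + d)" unfolding w_def
      using that False d t by (intro mult_exp_one_minus_antimono) (auto simp: divide_simps)
    thus ?thesis by (simp add: r_def)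
  qed
  define r' where "r' = (1 + r) / 2"
  have r': "r < r'" "r' < 1" "r' > 0" using r1 r0 by (auto simp: r'_def)
  have "isCont w t" unfolding w_def using t by (intro continuous_intros) auto
  moreover have "w t = 1" using t by (simp add: w_def)
  ultimately have "(w \<longlongrightarrow> 1) (nhds t)"
    using tendsto_at_iff_tendsto_nhds[of w t] by (simp add: continuous_at)
  hence "\<forall>\<^sub>F v in nhds t. w v > r'"
    by (rule order_tendstoD) (rule r')
  then obtain d1 where d1: "d1 > 0" "\<And>v. dist v t < d1 \<Longrightarrow> w v > r'"
    by (auto simp: eventually_nhds_metric)
  define d' where "d' = min d1 d"
  have d': "d' > 0" "d' \<le> d" using d1 d by (auto simp: d'_def)
  have wd: "w v > r'" if "\<bar>v - t\<bar> < d'" for v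
    using that d1(2)[of v] by (auto simp: d'_def dist_real_def)
  define I where "I = (\<integral>v. exp (- v) * \<bar>f v\<bar> \<partial>lborel)"
  have int1: "integrable lborel (\<lambda>v. exp (- v) * f v)" using int[of 1] by simp
  have int1': "integrable lborel (\<lambda>v. exp (- v) * \<bar>f v\<bar>)"
    using integrable_abs[OF int1] by (simp add: abs_mult)
  \<comment> \<open>On the interval of radius \<open>d'\<close> around \<open>t\<close> the factor \<open>exp (- v)\<close> is at least \<open>exp (- 2 t)\<close>.\<close>
  have key: "e * exp (- (2 * t)) * (2 * d') \<le> (r / r') ^ n * I" for n
  proof -
    define x where "x = 1 + n / t"
    have x: "x > 0" using t by (simp add: x_def add_pos_nonneg)
    have eq: "v ^ n * exp (- (x * v)) * f v = (t / exp 1) ^ n * (w v ^ n * exp (- v) * f v)" for v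
    proof -
      have "w v ^ n = (v / t) ^ n * exp (n - n * v / t)"
        unfolding w_def power_mult_distrib exp_of_nat_mult[symmetric] by (simp add: algebra_simps)
      moreover have "exp (- (x * v)) = exp (n - n * v / t) * exp (- v) / exp 1 ^ n"
        unfolding x_def exp_of_nat_mult[symmetric] exp_add[symmetric] exp_diff[symmetric]
        by (simp add: algebra_simps)
      ultimately show ?thesis using t by (simp add: power_divide)
    qed
    have wint: "integrable lborel (\<lambda>v. w v ^ n * exp (- v) * f v)"
    proof -
      have "integrable lborel (\<lambda>v. (t / exp 1) ^ n * (w v ^ n * exp (- v) * f v))"
        using laplace_moment_integrable[of f x n, OF supp int x] unfolding eq .
      thus ?thesis using t by simp
    qed
    have "0 \<le> (t / exp 1) ^ n * (\<integral>v. w v ^ n * exp (- v) * f v \<partial>lborel)"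
      using mom[OF x, of n] unfolding eq by simp
    hence "0 \<le> (\<integral>v. w v ^ n * exp (- v) * f v \<partial>lborel)"
      using t mult_pos_neg[of "(t / exp 1) ^ n"] by (metis not_le zero_less_divide_iff exp_gt_zero zero_less_power)
    also have "\<dots> \<le> (\<integral>v. r ^ n * (exp (- v) * \<bar>f v\<bar>) - e * r' ^ n * exp (- (2 * t)) * indicator {t - d' <..< t + d'} v \<partial>lborel)"
    proof (rule integral_mono)
      show "integrable lborel (\<lambda>v. r ^ n * (exp (- v) * \<bar>f v\<bar>) - e * r' ^ n * exp (- (2 * t)) * indicator {t - d' <..< t + d'} v)"
        using int1' d' by (intro Bochner_Integration.integrable_diff integrable_mult_right
           integrable_real_indicator) auto
    next
      fix v :: real
      consider "v < 0" | "v \<ge> 0" "\<bar>v - t\<bar> \<ge> d" | "v \<ge> 0" "d' \<le> \<bar>v - t\<bar>" "\<bar>v - t\<bar> < d" | "v \<ge> 0" "\<bar>v - t\<bar> < d'"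
        using d' by fastforce
      thus "w v ^ n * exp (- v) * f v \<le> r ^ n * (exp (- v) * \<bar>f v\<bar>) - e * r' ^ n * exp (- (2 * t)) * indicator {t - d' <..< t + d'} v"
      proof cases
        case 1
        thus ?thesis using d' d by (simp add: supp indicator_def)
      next
        case 2
        have "w v ^ n * exp (- v) * f v \<le> w v ^ n * exp (- v) * \<bar>f v\<bar>"
          using 2 t by (intro mult_left_mono) (auto simp: w_def)
        also have "\<dots> \<le> r ^ n * exp (- v) * \<bar>f v\<bar>"
          using wr[of v] 2 t by (intro mult_right_mono power_mono) (auto simp: w_def)
        finally show ?thesis using 2 d' by (auto simp: indicator_def)
      next
        case 3
        have "w v ^ n * exp (- v) * f v \<le> 0"
          using fd[of v] 3 t e by (intro mult_nonneg_nonpos) (auto simp: w_def)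
        also have "0 \<le> r ^ n * (exp (- v) * \<bar>f v\<bar>)" using r0 by simp
        finally show ?thesis using 3 d' by (auto simp: indicator_def)
      next
        case 4
        have fe: "- f v \<ge> e" using fd[of v] 4 d' by simp
        have "r' ^ n * exp (- (2 * t)) * e \<le> w v ^ n * exp (- v) * (- f v)"
          using wd[of v] 4 r' fe d d' e by (intro mult_mono power_mono mult_nonneg_nonneg zero_le_power) auto
        moreover have "0 \<le> r ^ n * (exp (- v) * \<bar>f v\<bar>)" using r0 by simp
        moreover have "indicator {t - d' <..< t + d'} v = (1::real)" using 4 by (auto simp: indicator_def abs_if split: if_splits)
        ultimately show ?thesis by (simp add: mult_ac)
      qed
    qed (rule wint)
    also have "\<dots> = r ^ n * I - e * r' ^ n * exp (- (2 * t)) * (2 * d')"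
      unfolding I_def using int1' d' by (subst Bochner_Integration.integral_diff) auto
    finally have "e * exp (- (2 * t)) * (2 * d') * r' ^ n \<le> r ^ n * I"
      by (simp add: mult_ac)
    thus ?thesis using r' by (simp add: power_divide field_simps)
  qed
  have "(\<lambda>n. (r / r') ^ n * I) \<longlonglongrightarrow> 0 * I"
    using r0 r' by (intro tendsto_mult LIMSEQ_power_zero tendsto_const) auto
  hence "e * exp (- (2 * t)) * (2 * d') \<le> 0"
    using key by (intro LIMSEQ_le_const[of _ 0]) auto
  thus False using e d' by (simp add: mult_le_0_iff)
qed

section \<open>Landau's theorem on the abscissa of convergence\<close>

lemma higher_deriv_of_real_chain:
  fixes w :: "nat \<Rightarrow> real \<Rightarrow> real" and F :: "complex \<Rightarrow> complex"
  assumes w: "\<And>n x. x > 0 \<Longrightarrow> (w n has_real_derivative - w (Suc n) x) (at x)"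
    and hol: "F holomorphic_on S" and S: "open S" "\<And>x. x > 0 \<Longrightarrow> of_real x \<in> S"
    and F: "\<And>x. x > 0 \<Longrightarrow> F (of_real x) = of_real (w 0 x)"
    and x: "x > 0"
  shows "(deriv ^^ n) F (of_real x) = of_real ((-1) ^ n * w n x)"
  using x
proof (induction n arbitrary: x)
  case (Suc n)
  have D: "((deriv ^^ n) F has_field_derivative (deriv ^^ Suc n) F (of_real x)) (at (of_real x))"
    using has_field_derivative_higher_deriv[OF hol S(1) S(2)[OF Suc.prems], of n] by simp
  have "((\<lambda>x. (deriv ^^ n) F (of_real x)) has_vector_derivative (deriv ^^ Suc n) F (of_real x)) (at x)"
    using has_vector_derivative_real_field[OF D] by simp
  moreover have "((\<lambda>x. (deriv ^^ n) F (of_real x)) has_vector_derivative of_real ((-1) ^ Suc n * w (Suc n) x)) (at x)"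
  proof (rule has_vector_derivative_transform_within_open[of "\<lambda>x. of_real ((-1) ^ n * w n x)" _ _ "{0<..}"])
    have "((\<lambda>x. (-1) ^ n * w n x) has_real_derivative (-1) ^ n * - w (Suc n) x) (at x)"
      by (intro DERIV_cmult w Suc.prems)
    thus "((\<lambda>x. complex_of_real ((-1) ^ n * w n x)) has_vector_derivative of_real ((-1) ^ Suc n * w (Suc n) x)) (at x)"
      by (intro has_vector_derivative_of_real) (simp add: has_real_derivative_iff_has_vector_derivative)
  qed (use Suc in auto)
  ultimately show ?case using vector_derivative_unique_at by blast
qed (simp add: F)

text \<open>
  Given \<open>s\<close>, a disc around a sufficiently large real \<open>x\<^sub>0\<close> contains \<open>s\<close> and lies in the half-plane where \<open>F\<close> is
  holomorphic, so the Taylor series of \<open>F\<close> at \<open>x\<^sub>0\<close> converges at \<open>s\<close>. Its coefficients are the moments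
  \<open>\<integral> v^n exp(-x\<^sub>0 v) f(v) dv\<close> up to the sign \<open>(-1)^n\<close>. At the real point \<open>x\<^sub>0 - r\<close>, with
  \<open>r = |s - x\<^sub>0|\<close>, all terms are nonnegative since \<open>f \<ge> 0\<close>, so the series converges absolutely, and summation and
  integration may be interchanged; summing under the integral turns \<open>exp(-x\<^sub>0 v)\<close> into \<open>exp(-sv)\<close>.
\<close>
lemma landau_laplace:
  fixes f :: "real \<Rightarrow> real" and F :: "complex \<Rightarrow> complex"
  assumes nonneg: "\<And>v. f v \<ge> 0" and supp: "\<And>v. v < 0 \<Longrightarrow> f v = 0"
    and int: "\<And>x. x > 0 \<Longrightarrow> integrable lborel (\<lambda>v. exp (- (x * v)) * f v)"
    and hol: "F holomorphic_on {s. Re s > \<gamma>}" and \<gamma>: "\<gamma> \<le> 0"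
    and F: "\<And>x. x > 0 \<Longrightarrow> F (of_real x) = of_real (\<integral>v. exp (- (x * v)) * f v \<partial>lborel)"
    and s: "Re s > \<gamma>"
  shows "integrable lborel (\<lambda>v. exp (- (s * of_real v)) * of_real (f v))"
    and "F s = (\<integral>v. exp (- (s * of_real v)) * of_real (f v) \<partial>lborel)"
proof -
  define m where "m = (\<lambda>n x. \<integral>v. v ^ n * exp (- (x * v)) * f v \<partial>lborel)"
  \<comment> \<open>\<open>|s - x\<^sub>0| < x\<^sub>0 - \<gamma>\<close> is equivalent to \<open>(Im s)\<^sup>2 < (Re s - \<gamma>) (2 x\<^sub>0 - \<gamma> - Re s)\<close>.\<close>
  define x0 where "x0 = \<bar>\<gamma>\<bar> + \<bar>Re s\<bar> + 1 + (Im s)\<^sup>2 / (Re s - \<gamma>)"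
  have x0: "x0 > 0" using s by (simp add: x0_def add_nonneg_pos add_pos_nonneg)
  define r where "r = norm (s - of_real x0)"
  have r: "r < x0 - \<gamma>"
  proof -
    have "r\<^sup>2 = (Re s - x0)\<^sup>2 + (Im s)\<^sup>2" by (simp add: r_def cmod_power2)
    also have "\<dots> < (x0 - \<gamma>)\<^sup>2"
    proof -
      have "(Im s)\<^sup>2 = (Re s - \<gamma>) * ((Im s)\<^sup>2 / (Re s - \<gamma>))" using s by simp
      also have "\<dots> < (Re s - \<gamma>) * (2 * x0 - \<gamma> - Re s)"
      proof (intro mult_strict_left_mono)
        define Q where "Q = (Im s)\<^sup>2 / (Re s - \<gamma>)"
        have "Q \<ge> 0" using s by (simp add: Q_def)
        thus "(Im s)\<^sup>2 / (Re s - \<gamma>) < 2 * x0 - \<gamma> - Re s" unfolding x0_def Q_def[symmetric]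
          by (auto simp: abs_if)
      qed (use s in simp)
      finally show ?thesis by (simp add: power2_eq_square algebra_simps)
    qed
    finally show ?thesis using x0 \<gamma> by (simp add: power_less_imp_less_base)
  qed
  have sub: "ball (of_real x0) (x0 - \<gamma>) \<subseteq> {s. Re s > \<gamma>}"
  proof
    fix z assume "z \<in> ball (complex_of_real x0) (x0 - \<gamma>)"
    hence "norm (of_real x0 - z) < x0 - \<gamma>" by (simp add: dist_norm)
    moreover have "x0 - Re z \<le> norm (of_real x0 - z)" using complex_Re_le_cmod[of "of_real x0 - z"] by simp
    ultimately show "z \<in> {s. Re s > \<gamma>}" by simp
  qed
  note hol' = holomorphic_on_subset[OF hol sub]
  have mint: "integrable lborel (\<lambda>v. v ^ n * exp (- (x * v)) * f v)" if "x > 0" for n x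
    using laplace_moment_integrable[of f, OF supp int that] .
  have hd: "(deriv ^^ n) F (of_real x0) = of_real ((-1) ^ n * m n x0)" for n
  proof (rule higher_deriv_of_real_chain[OF _ hol])
    show "(m n has_real_derivative - m (Suc n) x) (at x)" if "x > 0" for n x
      using laplace_moment_has_derivative[of f, OF supp int that] unfolding m_def .
    show "open {s. \<gamma> < Re s}" by (rule open_halfspace_Re_gt)
  qed (use F \<gamma> x0 in \<open>auto simp: m_def\<close>)
  have sums: "(\<lambda>n. of_real (m n x0 / fact n) * (of_real x0 - z) ^ n) sums F z"
    if "z \<in> ball (of_real x0) (x0 - \<gamma>)" for z
  proof -
    have "(\<lambda>n. (deriv ^^ n) F (of_real x0) / fact n * (z - of_real x0) ^ n) sums F z"
      by (rule holomorphic_power_series[OF hol' that])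
    also have "(\<lambda>n. (deriv ^^ n) F (of_real x0) / fact n * (z - of_real x0) ^ n)
        = (\<lambda>n. of_real (m n x0 / fact n) * (of_real x0 - z) ^ n)"
    proof
      fix n
      have "(of_real x0 - z) ^ n = (-1) ^ n * (z - of_real x0) ^ n"
        by (simp add: power_mult_distrib[symmetric])
      thus "(deriv ^^ n) F (of_real x0) / fact n * (z - of_real x0) ^ n
         = of_real (m n x0 / fact n) * (of_real x0 - z) ^ n"
        by (simp add: hd)
    qed
    finally show ?thesis .
  qed
  have summ: "summable (\<lambda>n. m n x0 / fact n * r ^ n)"
  proof -
    have "(\<lambda>n. complex_of_real (m n x0 / fact n * r ^ n)) sums F (of_real (x0 - r))"
    proof -
      have "of_real (x0 - r) \<in> ball (complex_of_real x0) (x0 - \<gamma>)"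
        using r by (simp add: dist_norm) (simp add: r_def)
      from sums[OF this] show ?thesis by simp
    qed
    hence "summable (\<lambda>n. complex_of_real (m n x0 / fact n * r ^ n))" by (rule sums_summable)
    thus ?thesis by (subst (asm) summable_complex_of_real)
  qed
  define g where "g = (\<lambda>n v. complex_of_real (v ^ n * exp (- (x0 * v)) * f v) * ((of_real x0 - s) ^ n / fact n))"
  have gint: "integrable lborel (g n)" for n
    unfolding g_def by (intro integrable_mult_left integrable_of_real mint x0)
  have gnorm: "(\<integral>v. norm (g n v) \<partial>lborel) = m n x0 / fact n * r ^ n" for n
  proof -
    have "norm (g n v) = (v ^ n * exp (- (x0 * v)) * f v) * (r ^ n / fact n)" for v
    proof (cases "v < 0")
      case False
      thus ?thesis using nonneg[of v]
        by (simp add: g_def norm_mult norm_divide norm_power r_def norm_minus_commute abs_mult)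
    qed (simp add: g_def supp)
    thus ?thesis by (simp add: m_def)
  qed
  have gsums: "(\<lambda>n. g n v) sums (exp (- (s * of_real v)) * of_real (f v))" for v
  proof -
    have "(\<lambda>n. ((of_real x0 - s) * of_real v) ^ n /\<^sub>R fact n) sums exp ((of_real x0 - s) * of_real v)"
      by (rule exp_converges)
    hence "(\<lambda>n. ((of_real x0 - s) * of_real v) ^ n /\<^sub>R fact n * of_real (exp (- (x0 * v)) * f v))
        sums (exp ((of_real x0 - s) * of_real v) * of_real (exp (- (x0 * v)) * f v))"
      by (rule sums_mult2)
    moreover have "((of_real x0 - s) * of_real v) ^ n /\<^sub>R fact n * of_real (exp (- (x0 * v)) * f v) = g n v" for n
      by (simp add: g_def power_mult_distrib scaleR_conv_of_real divide_inverse mult_ac)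
    moreover have "exp ((of_real x0 - s) * of_real v) * of_real (exp (- (x0 * v)) * f v)
        = exp (- (s * of_real v)) * of_real (f v)"
    proof -
      have "exp ((of_real x0 - s) * of_real v) * of_real (exp (- (x0 * v))) = exp (- (s * of_real v))"
        by (simp add: exp_of_real[symmetric] exp_add[symmetric] algebra_simps)
      thus ?thesis by (simp add: mult.assoc[symmetric])
    qed
    ultimately show ?thesis by (simp only:)
  qed
  have gs: "(\<lambda>v. \<Sum>n. g n v) = (\<lambda>v. exp (- (s * of_real v)) * of_real (f v))"
    using gsums by (auto simp: sums_iff)
  have gabs: "AE v in lborel. summable (\<lambda>n. norm (g n v))"
  proof (intro AE_I2)
    fix v :: real
    have "summable (\<lambda>n. norm (((of_real x0 - s) * of_real v) ^ n /\<^sub>R fact n) * norm (complex_of_real (exp (- (x0 * v)) * f v)))"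
      by (intro summable_mult2 summable_norm_exp)
    moreover have "norm (g n v) = norm (((of_real x0 - s) * of_real v) ^ n /\<^sub>R fact n) * norm (complex_of_real (exp (- (x0 * v)) * f v))" for n
      by (simp add: g_def power_mult_distrib norm_mult norm_power norm_divide norm_inverse divide_inverse mult_ac abs_mult)
    ultimately show "summable (\<lambda>n. norm (g n v))" by simp
  qed
  have gsummable: "summable (\<lambda>n. \<integral>v. norm (g n v) \<partial>lborel)" unfolding gnorm by (rule summ)
  show "integrable lborel (\<lambda>v. exp (- (s * of_real v)) * of_real (f v))"
    using integrable_suminf[OF gint gabs gsummable] unfolding gs .
  have "(\<lambda>n. \<integral>v. g n v \<partial>lborel) sums (\<integral>v. exp (- (s * of_real v)) * of_real (f v) \<partial>lborel)"
    using sums_integral[OF gint gabs gsummable] unfolding gs .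
  moreover have "(\<integral>v. g n v \<partial>lborel) = of_real (m n x0 / fact n) * (of_real x0 - s) ^ n" for n
    unfolding g_def m_def by (subst integral_mult_left_zero, subst integral_of_real) (use mint x0 in auto)
  ultimately show "F s = (\<integral>v. exp (- (s * of_real v)) * of_real (f v) \<partial>lborel)"
    using sums[of s] r sums_unique2 by (fastforce simp: r_def dist_norm norm_minus_commute)
qed

section \<open>The Riemann-Lebesgue lemma\<close>

lemma integrable_mult_sin:
  fixes f :: "real \<Rightarrow> real"
  assumes "integrable lborel f"
  shows "integrable lborel (\<lambda>w. f w * sin (R * w))"
proof (rule Bochner_Integration.integrable_bound[OF assms])
  show "(\<lambda>w. f w * sin (R * w)) \<in> borel_measurable lborel"
    using borel_measurable_integrable[OF assms] by measurable
  show "AE w in lborel. norm (f w * sin (R * w)) \<le> norm (f w)"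
    by (intro AE_I2) (simp add: abs_mult mult_left_le)
qed

text \<open>
  The functions satisfying the Riemann-Lebesgue lemma are closed under dominated limits, since these are limits in
  \<open>L\<^sup>1\<close> and the sine is bounded. This reduces the lemma to indicator functions.
\<close>
lemma riemann_lebesgue_limit:
  fixes f w :: "real \<Rightarrow> real" and s :: "nat \<Rightarrow> real \<Rightarrow> real"
  assumes f: "integrable lborel f" and s: "\<And>n. integrable lborel (s n)" and w: "integrable lborel w"
    and rl: "\<And>n. ((\<lambda>R. \<integral>x. s n x * sin (R * x) \<partial>lborel) \<longlongrightarrow> 0) at_top"
    and lim: "\<And>x. (\<lambda>n. s n x) \<longlonglongrightarrow> f x" and bd: "\<And>n x. \<bar>s n x\<bar> \<le> w x"
  shows "((\<lambda>R. \<integral>x. f x * sin (R * x) \<partial>lborel) \<longlongrightarrow> 0) at_top"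
proof (rule tendstoI)
  fix e :: real assume e: "e > 0"
  have "(\<lambda>n. \<integral>x. \<bar>f x - s n x\<bar> \<partial>lborel) \<longlonglongrightarrow> (\<integral>x. 0 \<partial>(lborel :: real measure))"
  proof (rule integral_dominated_convergence[where w = "\<lambda>x. \<bar>f x\<bar> + w x"])
    show "AE x in lborel. (\<lambda>n. \<bar>f x - s n x\<bar>) \<longlonglongrightarrow> 0"
    proof (intro AE_I2)
      fix x show "(\<lambda>n. \<bar>f x - s n x\<bar>) \<longlonglongrightarrow> 0"
        using tendsto_rabs[OF tendsto_diff[OF tendsto_const[of "f x"] lim[of x]]] by simp
    qed
    show "AE x in lborel. norm \<bar>f x - s n x\<bar> \<le> \<bar>f x\<bar> + w x" for n
    proof (intro AE_I2)
      fix x show "norm \<bar>f x - s n x\<bar> \<le> \<bar>f x\<bar> + w x" using bd[of n x] by simp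
    qed
  qed (use f s w borel_measurable_integrable in \<open>auto intro!: borel_measurable_abs borel_measurable_diff\<close>)
  hence "\<forall>\<^sub>F n in sequentially. (\<integral>x. \<bar>f x - s n x\<bar> \<partial>lborel) < e / 2"
    using order_tendstoD(2)[of _ 0 sequentially "e / 2"] e by simp
  then obtain n where n: "(\<integral>x. \<bar>f x - s n x\<bar> \<partial>lborel) < e / 2"
    by (auto simp: eventually_sequentially)
  have "\<forall>\<^sub>F R in at_top. \<bar>\<integral>x. s n x * sin (R * x) \<partial>lborel\<bar> < e / 2"
    using tendstoD[OF rl[of n], of "e / 2"] e by (simp add: dist_real_def)
  thus "\<forall>\<^sub>F R in at_top. dist (\<integral>x. f x * sin (R * x) \<partial>lborel) 0 < e"
  proof eventually_elim
    case (elim R)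
    have "(\<integral>x. f x * sin (R * x) \<partial>lborel) - (\<integral>x. s n x * sin (R * x) \<partial>lborel)
        = (\<integral>x. (f x - s n x) * sin (R * x) \<partial>lborel)"
      using integrable_mult_sin[OF f] integrable_mult_sin[OF s]
      by (simp add: left_diff_distrib)
    moreover have "\<bar>\<integral>x. (f x - s n x) * sin (R * x) \<partial>lborel\<bar> \<le> (\<integral>x. \<bar>f x - s n x\<bar> \<partial>lborel)"
      using f s integrable_mult_sin[of "\<lambda>x. f x - s n x"]
      by (intro integral_abs_bound_integral) (auto simp: abs_mult mult_left_le)
    ultimately show ?case using n elim by (simp add: dist_real_def)
  qed
qed

lemma riemann_lebesgue_interval:
  "((\<lambda>R. \<integral>x. indicator {a..b} x * sin (R * x) \<partial>lborel) \<longlongrightarrow> 0) at_top" for a b :: real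
proof (cases "a \<le> b")
  case True
  show ?thesis
  proof (rule Lim_null_comparison)
    show "\<forall>\<^sub>F R in at_top. norm (\<integral>x. indicator {a..b} x * sin (R * x) \<partial>lborel) \<le> 2 / R"
      using eventually_gt_at_top[of 0]
    proof eventually_elim
      case (elim R)
      have "(\<integral>x. indicator {a..b} x *\<^sub>R sin (R * x) \<partial>lborel) = - cos (R * b) / R - (- cos (R * a) / R)"
        using elim True
        by (intro integral_FTC_Icc)
           (auto intro!: derivative_eq_intros continuous_intros
                 simp: has_real_derivative_iff_has_vector_derivative[symmetric])
      also have "\<bar>\<dots>\<bar> \<le> 2 / R"
      proof -
        have "\<bar>cos (R * a) - cos (R * b)\<bar> \<le> 2"
          using cos_le_one[of "R * b"] cos_le_one[of "R * a"]
            cos_ge_minus_one[of "R * b"] cos_ge_minus_one[of "R * a"] by linarith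
        thus ?thesis using elim by (simp add: diff_divide_distrib[symmetric] abs_divide divide_right_mono)
      qed
      finally show ?case by simp
    qed
    show "((\<lambda>R. 2 / R :: real) \<longlongrightarrow> 0) at_top" by real_asymp
  qed
qed simp

text \<open>
  Dynkin's \<open>\<pi>\<close>-\<open>\<lambda>\<close> theorem extends the claim from the half-lines to all Borel sets; cutting
  off at \<open>N\<close> keeps every set integrable, the whole line included.
\<close>
lemma riemann_lebesgue_bounded_set:
  fixes A :: "real set" and N :: real
  assumes "A \<in> sets borel"
  shows "((\<lambda>R. \<integral>x. indicator (A \<inter> {-N..N}) x * sin (R * x) \<partial>lborel) \<longlongrightarrow> 0) at_top"
proof -
  let ?G = "range (\<lambda>a. {..a::real})"
  have ii: "integrable lborel (indicator (B \<inter> {-N..N}) :: real \<Rightarrow> real)" if "B \<in> sets borel" for B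
    using that le_less_trans[OF emeasure_mono[of "B \<inter> {-N..N}" "{-N..N}" lborel] emeasure_compact_finite]
    by (intro integrable_real_indicator) auto
  have S: "sets borel = sigma_sets UNIV ?G"
    by (subst borel_eq_atMost) simp
  have "Int_stable ?G" by (auto simp: Int_stable_def)
  moreover have "?G \<subseteq> Pow UNIV" by simp
  moreover have "A \<in> sigma_sets UNIV ?G" using assms S by simp
  ultimately show ?thesis
  proof (induction A rule: sigma_sets_induct_disjoint[consumes 3, case_names basic empty compl union])
    case (basic A)
    then obtain a where "A = {..a}" by auto
    hence "A \<inter> {-N..N} = {-N..min a N}" by auto
    thus ?case using riemann_lebesgue_interval by simp
  next
    case (compl A)
    have "indicator ((UNIV - A) \<inter> {-N..N}) x = indicator {-N..N} x - (indicator (A \<inter> {-N..N}) x :: real)" for x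
      by (auto simp: indicator_def)
    moreover have "((\<lambda>R. (\<integral>x. indicator {-N..N} x * sin (R * x) \<partial>lborel)
        - (\<integral>x. indicator (A \<inter> {-N..N}) x * sin (R * x) \<partial>lborel)) \<longlongrightarrow> 0) at_top"
      using tendsto_diff[OF riemann_lebesgue_interval compl(2)] by simp
    moreover have "integrable lborel (\<lambda>x. indicator {-N..N} x * sin (R * x))" for R
      using integrable_mult_sin[OF ii[of UNIV]] by simp
    moreover have "integrable lborel (\<lambda>x. indicator (A \<inter> {-N..N}) x * sin (R * x))" for R
      using integrable_mult_sin[OF ii[of A]] compl(1) S by simp
    ultimately show ?case
      by (simp add: left_diff_distrib)
  next
    case (union A)
    have AS: "A i \<in> sets borel" for i using union(2) S by auto
    define s where "s = (\<lambda>n x. \<Sum>i<n. indicator (A i \<inter> {-N..N}) x :: real)"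
    have s_eq: "s n x = indicator ((\<Union>i<n. A i) \<inter> {-N..N}) x" for n x
    proof -
      have "indicator (\<Union>i\<in>{..<n}. A i \<inter> {-N..N}) x = (\<Sum>i<n. indicator (A i \<inter> {-N..N}) x :: real)"
        using union(1) by (intro indicator_UN_disjoint) (auto simp: disjoint_family_on_def)
      thus ?thesis by (simp add: s_def)
    qed
    show ?case
    proof (rule riemann_lebesgue_limit[where s = s and w = "indicator {-N..N}"])
      show "integrable lborel (s n)" for n unfolding s_def by (intro Bochner_Integration.integrable_sum ii AS)
      show "((\<lambda>R. \<integral>x. s n x * sin (R * x) \<partial>lborel) \<longlongrightarrow> 0) at_top" for n
      proof -
        have "((\<lambda>R. \<Sum>i<n. \<integral>x. indicator (A i \<inter> {-N..N}) x * sin (R * x) \<partial>lborel) \<longlongrightarrow> (\<Sum>i<n. 0)) at_top"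
          by (intro tendsto_sum union)
        moreover have "(\<Sum>i<n. \<integral>x. indicator (A i \<inter> {-N..N}) x * sin (R * x) \<partial>lborel) = (\<integral>x. s n x * sin (R * x) \<partial>lborel)" for R
          unfolding s_def sum_distrib_right
          by (intro Bochner_Integration.integral_sum[symmetric] integrable_mult_sin ii AS)
        ultimately show ?thesis by simp
      qed
      show "(\<lambda>n. s n x) \<longlonglongrightarrow> indicator (\<Union> (range A) \<inter> {-N..N}) x" for x
      proof -
        have "(\<lambda>n. indicator (\<Union>i<n. A i) x * indicator {-N..N} x :: real) \<longlonglongrightarrow> indicator (\<Union> (range A)) x * indicator {-N..N} x"
          by (intro tendsto_mult LIMSEQ_indicator_UN tendsto_const)
        thus ?thesis by (simp add: s_eq indicator_inter_arith)
      qed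
      show "\<bar>s n x\<bar> \<le> indicator {-N..N} x" for n x by (auto simp: s_eq indicator_def)
      show "integrable lborel (indicator (\<Union> (range A) \<inter> {- N..N}) :: real \<Rightarrow> real)"
        using AS by (intro ii) auto
      show "integrable lborel (indicator {- N..N} :: real \<Rightarrow> real)"
        using ii[of UNIV] by simp
    qed
  qed simp
qed

lemma riemann_lebesgue_sin:
  fixes f :: "real \<Rightarrow> real"
  assumes "integrable lborel f"
  shows "((\<lambda>R. \<integral>x. f x * sin (R * x) \<partial>lborel) \<longlongrightarrow> 0) at_top"
  using assms
proof (induction rule: integrable_induct)
  case (base A c)
  have A: "A \<in> sets borel" using base by simp
  have iA: "integrable lborel (indicator A :: real \<Rightarrow> real)" using base by (intro integrable_real_indicator)
  have "((\<lambda>R. \<integral>x. indicator A x * sin (R * x) \<partial>lborel) \<longlongrightarrow> 0) at_top"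
  proof (rule riemann_lebesgue_limit[where s = "\<lambda>n. indicator (A \<inter> {-real n..real n})" and w = "indicator A"])
    show "integrable lborel (indicator (A \<inter> {-real n..real n}) :: real \<Rightarrow> real)" for n
      using base le_less_trans[OF emeasure_mono[of "A \<inter> {-real n..real n}" A lborel]]
      by (intro integrable_real_indicator) auto
    show "(\<lambda>n. indicator (A \<inter> {- real n..real n}) x :: real) \<longlonglongrightarrow> indicator A x" for x
    proof (rule tendsto_eventually)
      obtain n0 where "\<bar>x\<bar> \<le> real n0" using real_arch_simple by blast
      thus "\<forall>\<^sub>F n in sequentially. indicator (A \<inter> {- real n..real n}) x = (indicator A x :: real)"
        unfolding eventually_sequentially by (intro exI[of _ n0]) (auto simp: indicator_def)
    qed
    show "\<bar>indicator (A \<inter> {- real n..real n}) x :: real\<bar> \<le> indicator A x" for n x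
      by (auto simp: indicator_def)
  qed (use iA riemann_lebesgue_bounded_set[OF A] in simp_all)
  hence "((\<lambda>R. (\<integral>x. indicator A x * sin (R * x) \<partial>lborel) * c) \<longlongrightarrow> 0 * c) at_top"
    by (intro tendsto_mult tendsto_const)
  thus ?case by (simp flip: integral_mult_left_zero add: mult_ac)
next
  case (add f g)
  from tendsto_add[OF add(3,4)] show ?case
    using integrable_mult_sin[OF add(1)] integrable_mult_sin[OF add(2)] by (simp add: distrib_right)
next
  case (lim f s)
  show ?case
    by (rule riemann_lebesgue_limit[where s = s and w = "\<lambda>x. 2 * \<bar>f x\<bar>"]) (use lim in auto)
qed

section \<open>Inversion of the Laplace transform\<close>

lemma sine_integral_symmetric:
  fixes R d :: real
  assumes "R > 0" "d > 0"
  shows "integrable lborel (\<lambda>w. indicator {-d<..<d} w * (sin (R * w) / w))"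
    and "(\<integral>w. indicator {-d<..<d} w * (sin (R * w) / w) \<partial>lborel) = 2 * Si (d * R)"
proof -
  let ?s = "\<lambda>w. sin (R * w) / w"
  have ii: "integrable lborel (\<lambda>w. indicator A w * ?s w)" if A: "A \<in> sets borel" "A \<subseteq> {-d<..<d}" for A
  proof (rule Bochner_Integration.integrable_bound[where f = "\<lambda>w. indicator {-d<..<d} w * R"])
    show "integrable lborel (\<lambda>w. indicator {-d<..<d} w * R)"
      using assms by (intro integrable_mult_left integrable_real_indicator) auto
    show "AE w in lborel. norm (indicator A w * ?s w) \<le> norm (indicator {-d<..<d} w * R)"
    proof (intro AE_I2)
      fix w :: real
      have "\<bar>sin (R * w)\<bar> \<le> \<bar>R * w\<bar>" by (rule abs_sin_x_le_abs_x)
      hence "\<bar>?s w\<bar> \<le> R" using assms by (cases "w = 0") (auto simp: divide_simps abs_mult)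
      thus "norm (indicator A w * ?s w) \<le> norm (indicator {-d<..<d} w * R)"
        using A assms by (auto simp: indicator_def)
    qed
    show "(\<lambda>w. indicator A w * ?s w) \<in> borel_measurable lborel" using A by measurable
  qed
  show "integrable lborel (\<lambda>w. indicator {-d<..<d} w * ?s w)" by (rule ii) auto
  have pos: "(\<integral>w. indicator {0<..<d} w * ?s w \<partial>lborel) = Si (d * R)"
  proof -
    have "(LBINT t=0..d. sin (t * R) / t) = sgn R * Si (d * \<bar>R\<bar>)"
      using assms by (intro LBINT_I0c_sin_scale_divide) simp
    thus ?thesis using assms
      by (simp add: interval_lebesgue_integral_def set_lebesgue_integral_def zero_ereal_def mult.commute)
  qed
  have neg: "(\<integral>w. indicator {-d<..<0} w * ?s w \<partial>lborel) = Si (d * R)"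
  proof -
    have "(\<integral>w. indicator {-d<..<0} w * ?s w \<partial>lborel)
        = (\<integral>w. indicator {-d<..<0} (0 + (-1) * w) * ?s (0 + (-1) * w) \<partial>lborel)"
      by (subst lborel_integral_real_affine[where c = "-1" and t = 0]) simp_all
    also have "\<dots> = (\<integral>w. indicator {0<..<d} w * ?s w \<partial>lborel)"
      by (intro Bochner_Integration.integral_cong) (auto simp: indicator_def)
    finally show ?thesis using pos by simp
  qed
  have "(\<integral>w. indicator {-d<..<d} w * ?s w \<partial>lborel)
      = (\<integral>w. indicator {-d<..<0} w * ?s w + indicator {0<..<d} w * ?s w \<partial>lborel)"
    using assms by (intro Bochner_Integration.integral_cong) (auto simp: indicator_def)
  also have "\<dots> = 2 * Si (d * R)"
  proof -
    have i: "integrable lborel (\<lambda>w. indicator {-d<..<0} w * ?s w)" "integrable lborel (\<lambda>w. indicator {0<..<d} w * ?s w)"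
      using assms by (auto intro!: ii simp del: times_divide_eq_right)
    show ?thesis using Bochner_Integration.integral_add[OF i] pos neg by linarith
  qed
  finally show "(\<integral>w. indicator {-d<..<d} w * ?s w \<partial>lborel) = 2 * Si (d * R)" .
qed

text \<open>
  After centring at \<open>t\<close>, subtract \<open>g(t)\<close> on \<open>(-d, d)\<close>. The Lipschitz condition makes the remaining quotient
  \<open>\<phi>\<close> bounded near 0, hence integrable, and the Riemann-Lebesgue lemma disposes of it; the
  subtracted part is \<open>g(t)\<close> times a sine integral, which tends to \<open>\<pi>\<close>.
\<close>
lemma dirichlet_kernel_tendsto:
  fixes g :: "real \<Rightarrow> real"
  assumes g: "integrable lborel g" and d: "d > 0"
    and lip: "\<And>v. \<bar>v - t\<bar> < d \<Longrightarrow> \<bar>g v - g t\<bar> \<le> K * \<bar>v - t\<bar>"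
  shows "((\<lambda>R. \<integral>v. g v * (sin (R * (t - v)) / (t - v)) \<partial>lborel) \<longlongrightarrow> pi * g t) at_top"
proof -
  define \<phi> where "\<phi> = (\<lambda>w. (g (t + w) - g t * indicator {-d<..<d} w) / w)"
  have gt: "integrable lborel (\<lambda>w. g (t + w))"
    using lborel_integrable_real_affine[OF g, of 1 t] by simp
  have [measurable]: "g \<in> borel_measurable borel"
    using borel_measurable_integrable[OF g] by simp
  have K: "K \<ge> 0"
  proof -
    have "0 \<le> K * \<bar>t + d / 2 - t\<bar>"
      using d by (intro order_trans[OF abs_ge_zero lip]) auto
    thus ?thesis using d by (simp add: zero_le_mult_iff)
  qed
  have \<phi>: "integrable lborel \<phi>"
  proof (rule Bochner_Integration.integrable_bound[where f = "\<lambda>w. indicator {-d<..<d} w * K + \<bar>g (t + w)\<bar> / d"])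
    show "integrable lborel (\<lambda>w. indicator {-d<..<d} w * K + \<bar>g (t + w)\<bar> / d)"
    proof (rule Bochner_Integration.integrable_add)
      show "integrable lborel (\<lambda>w. indicator {-d<..<d} w * K)"
        using d by (intro integrable_mult_left integrable_real_indicator) auto
      show "integrable lborel (\<lambda>w. \<bar>g (t + w)\<bar> / d)"
        using gt by simp
    qed
    show "AE w in lborel. norm (\<phi> w) \<le> norm (indicator {-d<..<d} w * K + \<bar>g (t + w)\<bar> / d)"
    proof (intro AE_I2)
      fix w :: real
      have "\<bar>\<phi> w\<bar> \<le> indicator {-d<..<d} w * K + \<bar>g (t + w)\<bar> / d"
      proof (cases "\<bar>w\<bar> < d")
        case True
        have "\<bar>g (t + w) - g t\<bar> / \<bar>w\<bar> \<le> K"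
          using lip[of "t + w"] True K by (cases "w = 0") (auto simp: divide_simps)
        moreover have "\<phi> w = (g (t + w) - g t) / w" "indicator {-d<..<d} w = (1::real)"
          using True by (auto simp: \<phi>_def indicator_def)
        moreover have "\<bar>g (t + w)\<bar> / d \<ge> 0" using d by simp
        ultimately show ?thesis by simp
      next
        case False
        have "\<bar>g (t + w)\<bar> / \<bar>w\<bar> \<le> \<bar>g (t + w)\<bar> / d"
          using False d by (intro divide_left_mono mult_pos_pos) auto
        moreover have "\<phi> w = g (t + w) / w" "indicator {-d<..<d} w = (0::real)"
          using False by (auto simp: \<phi>_def indicator_def)
        ultimately show ?thesis by simp
      qed
      thus "norm (\<phi> w) \<le> norm (indicator {-d<..<d} w * K + \<bar>g (t + w)\<bar> / d)" by simp
    qed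
  qed (simp add: \<phi>_def)
  have eq: "(\<integral>v. g v * (sin (R * (t - v)) / (t - v)) \<partial>lborel)
      = (\<integral>w. \<phi> w * sin (R * w) \<partial>lborel) + g t * (2 * Si (d * R))" if R: "R > 0" for R
  proof -
    have "(\<integral>v. g v * (sin (R * (t - v)) / (t - v)) \<partial>lborel)
        = (\<integral>w. g (t + w) * (sin (R * w) / w) \<partial>lborel)"
      by (subst lborel_integral_real_affine[where c = 1 and t = t]) simp_all
    also have "\<dots> = (\<integral>w. \<phi> w * sin (R * w) + g t * (indicator {-d<..<d} w * (sin (R * w) / w)) \<partial>lborel)"
      by (intro Bochner_Integration.integral_cong refl) (simp add: \<phi>_def diff_divide_distrib left_diff_distrib)
    also have "\<dots> = (\<integral>w. \<phi> w * sin (R * w) \<partial>lborel) + g t * (2 * Si (d * R))"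
      using Bochner_Integration.integral_add[OF integrable_mult_sin[OF \<phi>]
          integrable_mult_right[OF sine_integral_symmetric(1)[OF R d]]]
      by (simp only: integral_mult_right_zero sine_integral_symmetric(2)[OF R d])
    finally show ?thesis .
  qed
  have "((\<lambda>R. (\<integral>w. \<phi> w * sin (R * w) \<partial>lborel) + g t * (2 * Si (d * R))) \<longlongrightarrow> 0 + g t * (2 * (pi / 2))) at_top"
  proof (intro tendsto_intros riemann_lebesgue_sin[OF \<phi>])
    have "filterlim (\<lambda>R. d * R) at_top at_top"
      by (rule filterlim_tendsto_pos_mult_at_top[OF tendsto_const d filterlim_ident])
    thus "((\<lambda>R. Si (d * R)) \<longlongrightarrow> pi / 2) at_top"
      using Si_at_top filterlim_compose by blast
  qed
  hence "((\<lambda>R. (\<integral>w. \<phi> w * sin (R * w) \<partial>lborel) + g t * (2 * Si (d * R))) \<longlongrightarrow> pi * g t) at_top"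
    by (simp add: mult.commute)
  thus ?thesis
    by (rule Lim_transform_eventually) (use eventually_gt_at_top[of 0] in eventually_elim, simp only: eq)
qed

lemma integral_exp_vertical:
  fixes c u R :: real
  assumes "u \<noteq> 0" "R > 0"
  shows "((\<lambda>y. exp (Complex c y * of_real u)) has_integral of_real (2 * exp (c * u) * (sin (R * u) / u))) {-R..R}"
proof -
  let ?G = "\<lambda>y. exp (Complex c y * of_real u) / (\<i> * of_real u)"
  have "((\<lambda>y. exp (Complex c y * of_real u)) has_integral ?G R - ?G (-R)) {-R..R}"
  proof (rule fundamental_theorem_of_calculus)
    fix y :: real assume "y \<in> {-R..R}"
    have "((\<lambda>y. exp ((of_real c + \<i> * of_real y) * of_real u) / (\<i> * of_real u)) has_vector_derivative
            exp ((of_real c + \<i> * of_real y) * of_real u)) (at y within {-R..R})"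
      using assms by (intro has_vector_derivative_real_field) (auto intro!: derivative_eq_intros)
    thus "(?G has_vector_derivative exp (Complex c y * of_real u)) (at y within {-R..R})"
      by (simp add: Complex_eq)
  qed (use assms in simp)
  also have "?G R - ?G (-R) = of_real (2 * exp (c * u) * (sin (R * u) / u))"
  proof -
    have e: "exp (Complex c y * of_real u) = of_real (exp (c * u)) * (of_real (cos (y * u)) + \<i> * of_real (sin (y * u)))" for y
    proof -
      have "Complex c y * of_real u = Complex (c * u) (y * u)" by (simp add: complex_eq_iff)
      thus ?thesis by (simp add: complex_eq_iff Re_exp Im_exp)
    qed
    have "exp (Complex c R * of_real u) - exp (Complex c (-R) * of_real u)
        = of_real (2 * exp (c * u) * sin (R * u)) * \<i>"
      unfolding e by (simp add: algebra_simps)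
    hence "?G R - ?G (-R) = of_real (2 * exp (c * u) * sin (R * u)) * \<i> / (\<i> * of_real u)"
      by (simp only: diff_divide_distrib[symmetric])
    thus ?thesis by simp
  qed
  finally show ?thesis .
qed

text \<open>
  By Fubini's theorem the integral over the segment may be taken first. It is elementary and equals
  \<open>2 exp(c(t - v)) sin(R(t - v))/(t - v)\<close>, so the truncated inversion integral is the Dirichlet integral of
  \<open>g(v) = exp(c(t - v)) f(v)\<close>, and \<open>g(t) = f(t)\<close>.
\<close>
lemma bromwich_inversion:
  fixes f :: "real \<Rightarrow> real" and F :: "complex \<Rightarrow> complex"
  assumes int: "integrable lborel (\<lambda>v. exp (- (c * v)) * f v)"
    and F: "\<And>y. F (Complex c y) = (\<integral>v. exp (- (Complex c y * of_real v)) * of_real (f v) \<partial>lborel)"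
    and d: "d > 0" and lip: "\<And>v. \<bar>v - t\<bar> < d \<Longrightarrow> \<bar>f v - f t\<bar> \<le> K * \<bar>v - t\<bar>"
  shows "((\<lambda>R. 1 / (2 * of_real pi * \<i>) * contour_integral (linepath (Complex c (-R)) (Complex c R))
             (\<lambda>s. F s * exp (s * of_real t))) \<longlongrightarrow> of_real (f t)) at_top"
proof -
  define g where "g = (\<lambda>v. exp (c * (t - v)) * f v)"
  have g: "integrable lborel g"
  proof -
    have "g = (\<lambda>v. exp (c * t) * (exp (- (c * v)) * f v))"
      by (auto simp: g_def right_diff_distrib exp_diff exp_minus divide_inverse)
    thus ?thesis using int by simp
  qed
  have [measurable]: "f \<in> borel_measurable borel"
  proof -
    have "(\<lambda>v. exp (c * v) * (exp (- (c * v)) * f v)) \<in> borel_measurable borel"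
      using borel_measurable_integrable[OF int] by measurable
    thus ?thesis by (simp add: mult.assoc[symmetric] exp_add[symmetric])
  qed
  have eq: "1 / (2 * of_real pi * \<i>) * contour_integral (linepath (Complex c (-R)) (Complex c R))
             (\<lambda>s. F s * exp (s * of_real t))
        = of_real ((\<integral>v. g v * (sin (R * (t - v)) / (t - v)) \<partial>lborel) / pi)" if R: "R > 0" for R
  proof -
    define k where "k = (\<lambda>y v. indicator {-R..R} y *\<^sub>R (exp (Complex c y * of_real (t - v)) * of_real (f v)) :: complex)"
    have kn: "norm (k y v) = indicator {-R..R} y * \<bar>g v\<bar>" for y v
      by (simp add: k_def g_def norm_mult abs_mult)
    have kint1: "integrable lborel (k y)" for y
    proof (rule Bochner_Integration.integrable_bound[OF g])
      show "k y \<in> borel_measurable lborel" unfolding k_def by measurable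
    qed (auto simp: kn indicator_def)
    have kint: "integrable (lborel \<Otimes>\<^sub>M lborel) (\<lambda>(y, v). k y v)"
    proof (rule lborel_pair.Fubini_integrable)
      have "(\<lambda>z. indicator {-R..R} (fst z) *\<^sub>R (exp ((of_real c + \<i> * of_real (fst z)) * of_real (t - snd z)) * of_real (f (snd z))) :: complex)
          \<in> borel_measurable (lborel \<Otimes>\<^sub>M lborel)"
        by measurable
      thus "(\<lambda>(y, v). k y v) \<in> borel_measurable (lborel \<Otimes>\<^sub>M lborel)"
        by (simp add: k_def case_prod_beta' Complex_eq)
      show "integrable lborel (\<lambda>y. \<integral>v. norm (case (y, v) of (y, v) \<Rightarrow> k y v) \<partial>lborel)"
        using R by (auto simp: kn intro!: integrable_mult_left integrable_real_indicator)
    qed (simp add: kint1)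
    have inner: "(\<integral>v. k y v \<partial>lborel) = indicator {-R..R} y *\<^sub>R (F (Complex c y) * exp (Complex c y * of_real t))" for y
    proof -
      have "k y v = indicator {-R..R} y *\<^sub>R ((exp (- (Complex c y * of_real v)) * of_real (f v)) * exp (Complex c y * of_real t))" for v
      proof -
        have "exp (Complex c y * of_real (t - v)) = exp (- (Complex c y * of_real v)) * exp (Complex c y * of_real t)"
          by (simp add: exp_add[symmetric] right_diff_distrib)
        thus ?thesis by (simp add: k_def mult_ac)
      qed
      thus ?thesis by (simp add: F)
    qed
    have inner2: "(\<integral>y. k y v \<partial>lborel) = of_real (2 * (g v * (sin (R * (t - v)) / (t - v))))" if "v \<noteq> t" for v
    proof -
      have "set_integrable lborel {-R..R} (\<lambda>y. exp (Complex c y * of_real (t - v)) * of_real (f v))"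
        unfolding Complex_eq by (intro borel_integrable_atLeastAtMost' continuous_intros)
      from set_borel_integral_eq_integral(2)[OF this]
      have "(\<integral>y. k y v \<partial>lborel) = integral {-R..R} (\<lambda>y. exp (Complex c y * of_real (t - v)) * of_real (f v))"
        by (simp only: k_def set_lebesgue_integral_def)
      also have "\<dots> = of_real (2 * exp (c * (t - v)) * (sin (R * (t - v)) / (t - v))) * of_real (f v)"
        using that R by (intro integral_unique has_integral_mult_left integral_exp_vertical) auto
      finally show ?thesis by (simp add: g_def mult_ac)
    qed
    define I where "I = (\<integral>y. (\<integral>v. k y v \<partial>lborel) \<partial>lborel)"
    have I_int: "integrable lborel (\<lambda>y. \<integral>v. k y v \<partial>lborel)"
      using lborel_pair.integrable_fst'[OF kint] by simp
    have "I = (\<integral>v. (\<integral>y. k y v \<partial>lborel) \<partial>lborel)"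
      unfolding I_def using lborel_pair.Fubini_integral[OF kint] by simp
    also have "\<dots> = (\<integral>v. of_real (2 * (g v * (sin (R * (t - v)) / (t - v)))) \<partial>lborel)"
      by (rule integral_discrete_difference[of "{t}"]) (auto simp: inner2)
    also have "\<dots> = of_real (2 * (\<integral>v. g v * (sin (R * (t - v)) / (t - v)) \<partial>lborel))"
      by (simp only: integral_complex_of_real integral_mult_right_zero)
    finally have I_eq: "I = of_real (2 * (\<integral>v. g v * (sin (R * (t - v)) / (t - v)) \<partial>lborel))" .
    have "((\<lambda>y. F (Complex c y) * exp (Complex c y * of_real t)) has_integral I) {-R..R}"
    proof -
      have "set_integrable lborel {-R..R} (\<lambda>y. F (Complex c y) * exp (Complex c y * of_real t))"
        using I_int by (simp add: set_integrable_def inner)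
      from set_borel_integral_eq_integral[OF this] show ?thesis
        by (simp add: has_integral_iff I_def inner set_lebesgue_integral_def)
    qed
    hence "((\<lambda>s. F s * exp (s * of_real t)) has_contour_integral (\<i> * I)) (linepath (Complex c (-R)) (Complex c R))"
      using R by (subst has_contour_integral_linepath_same_Re_iff[where c = c and a = "-R" and b = R]) auto
    hence "contour_integral (linepath (Complex c (-R)) (Complex c R)) (\<lambda>s. F s * exp (s * of_real t)) = \<i> * I"
      by (rule contour_integral_unique)
    thus ?thesis by (simp add: I_eq field_simps)
  qed
  \<comment> \<open>The exponential factor preserves the Lipschitz condition at \<open>t\<close>, after shrinking to radius at most 1.\<close>
  define d' where "d' = min d 1"
  define K' where "K' = exp \<bar>c\<bar> * K + \<bar>c\<bar> * exp \<bar>c\<bar> * \<bar>f t\<bar>"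
  have d': "d' > 0" using d by (simp add: d'_def)
  have lip': "\<bar>g v - g t\<bar> \<le> K' * \<bar>v - t\<bar>" if v: "\<bar>v - t\<bar> < d'" for v
  proof -
    have cv: "\<bar>c * (t - v)\<bar> \<le> \<bar>c\<bar>"
      using v by (simp add: d'_def abs_mult abs_minus_commute mult_left_le)
    have e: "exp (c * (t - v)) \<le> exp \<bar>c\<bar>" using cv by simp
    obtain z where z: "\<bar>z\<bar> \<le> \<bar>c * (t - v)\<bar>" "exp (c * (t - v)) = (\<Sum>m<1. (c * (t - v)) ^ m / fact m) + exp z / fact 1 * (c * (t - v)) ^ 1"
      using Maclaurin_exp_le[of "c * (t - v)" 1] by blast
    have "exp (c * (t - v)) - 1 = exp z * (c * (t - v))" using z(2) by simp
    hence "\<bar>exp (c * (t - v)) - 1\<bar> = exp z * (\<bar>c\<bar> * \<bar>v - t\<bar>)"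
      by (simp add: abs_mult abs_minus_commute)
    also have "\<dots> \<le> exp \<bar>c\<bar> * (\<bar>c\<bar> * \<bar>v - t\<bar>)"
      using z(1) cv by (intro mult_right_mono) auto
    finally have e1: "\<bar>exp (c * (t - v)) - 1\<bar> \<le> exp \<bar>c\<bar> * (\<bar>c\<bar> * \<bar>v - t\<bar>)" .
    have "g v - g t = exp (c * (t - v)) * (f v - f t) + (exp (c * (t - v)) - 1) * f t"
      by (simp add: g_def algebra_simps)
    hence "\<bar>g v - g t\<bar> \<le> exp (c * (t - v)) * \<bar>f v - f t\<bar> + \<bar>exp (c * (t - v)) - 1\<bar> * \<bar>f t\<bar>"
      by (metis abs_triangle_ineq abs_mult abs_exp_cancel)
    also have "\<dots> \<le> exp \<bar>c\<bar> * (K * \<bar>v - t\<bar>) + exp \<bar>c\<bar> * (\<bar>c\<bar> * \<bar>v - t\<bar>) * \<bar>f t\<bar>"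
      using v by (intro add_mono mult_mono e e1 lip order_refl) (auto simp: d'_def)
    also have "\<dots> = K' * \<bar>v - t\<bar>" by (simp add: K'_def algebra_simps)
    finally show ?thesis .
  qed
  have "((\<lambda>R. complex_of_real ((\<integral>v. g v * (sin (R * (t - v)) / (t - v)) \<partial>lborel) / pi)) \<longlongrightarrow> of_real (pi * g t / pi)) at_top"
    by (intro tendsto_of_real tendsto_divide dirichlet_kernel_tendsto[OF g d' lip'] tendsto_const) auto
  hence "((\<lambda>R. complex_of_real ((\<integral>v. g v * (sin (R * (t - v)) / (t - v)) \<partial>lborel) / pi)) \<longlongrightarrow> of_real (f t)) at_top"
    by (simp add: g_def)
  thus ?thesis
    by (rule Lim_transform_eventually) (use eventually_gt_at_top[of 0] in eventually_elim, simp only: eq)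
qed

section \<open>Convolution exponentials\<close>

definition convolution :: "(real \<Rightarrow> real) \<Rightarrow> (real \<Rightarrow> real) \<Rightarrow> real \<Rightarrow> real" where
  "convolution f g x = (\<integral>u. f (x - u) * g u \<partial>lborel)"

text \<open>
  All three claims are Fubini's theorem for \<open>f(x - u) g(u)\<close>, together with the translation invariance of Lebesgue measure.
\<close>
lemma convolution_L1:
  assumes f: "integrable lborel f" and g: "integrable lborel g"
  shows "integrable lborel (convolution f g)"
    and "(\<integral>x. convolution f g x \<partial>lborel) = (\<integral>x. f x \<partial>lborel) * (\<integral>x. g x \<partial>lborel)"
    and "(\<integral>x. \<bar>convolution f g x\<bar> \<partial>lborel) \<le> (\<integral>x. \<bar>f x\<bar> \<partial>lborel) * (\<integral>x. \<bar>g x\<bar> \<partial>lborel)"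
proof -
  have *: "integrable lborel (\<lambda>x. \<integral>u. f (x - u) * g u \<partial>lborel)
        \<and> (\<integral>x. (\<integral>u. f (x - u) * g u \<partial>lborel) \<partial>lborel) = (\<integral>x. f x \<partial>lborel) * (\<integral>x. g x \<partial>lborel)
        \<and> (AE x in lborel. integrable lborel (\<lambda>u. f (x - u) * g u))"
    if f: "integrable lborel f" and g: "integrable lborel g" for f g :: "real \<Rightarrow> real"
  proof -
    have [measurable]: "f \<in> borel_measurable borel" "g \<in> borel_measurable borel"
      using borel_measurable_integrable[OF f] borel_measurable_integrable[OF g] by simp_all
    have shift: "integrable lborel (\<lambda>x. f (x - u))" "(\<integral>x. f (x - u) \<partial>lborel) = (\<integral>x. f x \<partial>lborel)"
      if "integrable lborel f" for u and f :: "real \<Rightarrow> real"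
      using lborel_integrable_real_affine[OF that, of 1 "-u"] lborel_integral_real_affine[of 1 f "-u"]
      by simp_all
    have int: "integrable (lborel \<Otimes>\<^sub>M lborel) (\<lambda>(u, x). f (x - u) * g u)"
    proof (rule lborel_pair.Fubini_integrable)
      show "(\<lambda>(u, x). f (x - u) * g u) \<in> borel_measurable (lborel \<Otimes>\<^sub>M lborel)" by measurable
      have "(\<integral>x. \<bar>f (x - u)\<bar> * \<bar>g u\<bar> \<partial>lborel) = (\<integral>x. \<bar>f x\<bar> \<partial>lborel) * \<bar>g u\<bar>" for u
        using shift(2)[OF integrable_abs[OF f], of u] by simp
      hence "(\<integral>x. norm (case (u, x) of (u, x) \<Rightarrow> f (x - u) * g u) \<partial>lborel) = (\<integral>x. \<bar>f x\<bar> \<partial>lborel) * \<bar>g u\<bar>" for u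
        by (simp only: prod.case real_norm_def abs_mult)
      thus "integrable lborel (\<lambda>u. \<integral>x. norm (case (u, x) of (u, x) \<Rightarrow> f (x - u) * g u) \<partial>lborel)"
        using g by (simp only:) simp
      show "AE u in lborel. integrable lborel (\<lambda>x. case (u, x) of (u, x) \<Rightarrow> f (x - u) * g u)"
        using shift(1)[OF f] by simp
    qed
    have "(\<integral>x. (\<integral>u. f (x - u) * g u \<partial>lborel) \<partial>lborel) = (\<integral>u. (\<integral>x. f (x - u) * g u \<partial>lborel) \<partial>lborel)"
      by (rule lborel_pair.Fubini_integral[OF int])
    also have "\<dots> = (\<integral>x. f x \<partial>lborel) * (\<integral>x. g x \<partial>lborel)"
      using shift(2)[OF f] by simp
    finally show ?thesis
      using lborel_pair.integrable_snd[OF int] lborel_pair.AE_integrable_snd[OF int] by simp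
  qed
  show 1: "integrable lborel (convolution f g)"
    and "(\<integral>x. convolution f g x \<partial>lborel) = (\<integral>x. f x \<partial>lborel) * (\<integral>x. g x \<partial>lborel)"
    using *[OF f g] by (auto simp: convolution_def[abs_def])
  note 2 = *[OF integrable_abs[OF f] integrable_abs[OF g]]
  have "(\<integral>x. \<bar>convolution f g x\<bar> \<partial>lborel) \<le> (\<integral>x. (\<integral>u. \<bar>f (x - u)\<bar> * \<bar>g u\<bar> \<partial>lborel) \<partial>lborel)"
  proof (rule integral_mono)
    show "\<bar>convolution f g x\<bar> \<le> (\<integral>u. \<bar>f (x - u)\<bar> * \<bar>g u\<bar> \<partial>lborel)" for x
      unfolding convolution_def using integral_abs_bound[of lborel "\<lambda>u. f (x - u) * g u"] by (simp add: abs_mult)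
  qed (use 1 2 in auto)
  thus "(\<integral>x. \<bar>convolution f g x\<bar> \<partial>lborel) \<le> (\<integral>x. \<bar>f x\<bar> \<partial>lborel) * (\<integral>x. \<bar>g x\<bar> \<partial>lborel)"
    using 2 by simp
qed

primrec convolution_iterate :: "(real \<Rightarrow> real) \<Rightarrow> (real \<Rightarrow> real) \<Rightarrow> nat \<Rightarrow> real \<Rightarrow> real" where
  "convolution_iterate Q k 0 = k"
| "convolution_iterate Q k (Suc n) = convolution Q (convolution_iterate Q k n)"

text \<open>
  The function \<open>h = k + Q*k + Q*Q*k/2! + \<dots>\<close> has the Laplace transform of \<open>k\<close> times the exponential of the transform
  of \<open>Q\<close>. The kernel \<open>k\<close> may be unbounded at 0, as the Gamma density is; a bounded \<open>Q\<close> makes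
  all further iterates bounded on compact intervals. The constant \<open>M\<close> is a parameter because the estimates
  of the iterates are explicit in it.
\<close>
locale convolution_exponential =
  fixes Q k :: "real \<Rightarrow> real" and M :: real
  assumes Q_meas [measurable]: "Q \<in> borel_measurable borel"
    and Q_supp: "\<And>x. x < 0 \<Longrightarrow> Q x = 0"
    and Q_bound: "\<And>x. \<bar>Q x\<bar> \<le> M"
    and Q_lip: "\<And>T. \<exists>L\<ge>0. \<forall>x\<in>{0..T}. \<forall>y\<in>{0..T}. \<bar>Q x - Q y\<bar> \<le> L * \<bar>x - y\<bar>"
    and k_int: "integrable lborel k"
    and k_supp: "\<And>x. x < 0 \<Longrightarrow> k x = 0"
    and k_lip: "\<And>t. t > 0 \<Longrightarrow> \<exists>d>0. \<exists>K. \<forall>v. \<bar>v - t\<bar> < d \<longrightarrow> \<bar>k v - k t\<bar> \<le> K * \<bar>v - t\<bar>"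
begin

abbreviation "c \<equiv> convolution_iterate Q k"

definition h :: "real \<Rightarrow> real" where "h x = (\<Sum>n. c n x / fact n)"

lemma M_nonneg: "M \<ge> 0" using Q_bound[of 0] by linarith

lemma c_supp: "x < 0 \<Longrightarrow> c n x = 0"
proof (induction n arbitrary: x)
  case (Suc n)
  have "Q (x - u) * c n u = 0" for u
    using Suc Q_supp[of "x - u"] by (cases "u < 0") auto
  hence "(\<lambda>u. Q (x - u) * c n u) = (\<lambda>u. 0)" by blast
  thus ?case by (simp add: convolution_def)
qed (simp add: k_supp)

lemma Q_laplace_int: "x > 0 \<Longrightarrow> integrable lborel (\<lambda>v. exp (- (x * v)) * Q v)"
proof (rule Bochner_Integration.integrable_bound[where f = "\<lambda>v. M * (exp (- (x * v)) * indicator {0..} v)"])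
  assume x: "x > 0"
  have "set_integrable lebesgue {0..} (\<lambda>v. exp (- x * v))"
    using integrable_on_exp_minus_to_infinity[OF x, of 0]
    by (intro absolutely_integrable_onI) auto
  hence "integrable lborel (\<lambda>v. indicator {0..} v * exp (- (x * v)))"
    unfolding set_integrable_def by (subst (asm) integrable_completion) auto
  thus "integrable lborel (\<lambda>v. M * (exp (- (x * v)) * indicator {0..} v))"
    by (simp add: mult.commute)
  show "AE v in lborel. norm (exp (- (x * v)) * Q v) \<le> norm (M * (exp (- (x * v)) * indicator {0..} v))"
  proof (intro AE_I2)
    fix v show "norm (exp (- (x * v)) * Q v) \<le> norm (M * (exp (- (x * v)) * indicator {0..} v))"
      using Q_bound[of v] Q_supp[of v] M_nonneg by (cases "v < 0") (auto simp: abs_mult)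
  qed
qed measurable

lemma k_laplace_int: "x > 0 \<Longrightarrow> integrable lborel (\<lambda>v. exp (- (x * v)) * k v)"
proof (rule Bochner_Integration.integrable_bound[OF k_int])
  assume x: "x > 0"
  show "(\<lambda>v. exp (- (x * v)) * k v) \<in> borel_measurable lborel"
    using borel_measurable_integrable[OF k_int] by measurable
  show "AE v in lborel. norm (exp (- (x * v)) * k v) \<le> norm (k v)"
  proof (intro AE_I2)
    fix v show "norm (exp (- (x * v)) * k v) \<le> norm (k v)"
      using x k_supp[of v] by (cases "v < 0") (auto simp: abs_mult mult_left_le_one_le)
  qed
qed

lemma c_laplace:
  assumes x: "x > 0"
  shows "integrable lborel (\<lambda>v. exp (- (x * v)) * c n v)"
    and "(\<integral>v. exp (- (x * v)) * c n v \<partial>lborel) =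
           (\<integral>v. exp (- (x * v)) * k v \<partial>lborel) * (\<integral>v. exp (- (x * v)) * Q v \<partial>lborel) ^ n"
    and "(\<integral>v. \<bar>exp (- (x * v)) * c n v\<bar> \<partial>lborel) \<le>
           (\<integral>v. \<bar>exp (- (x * v)) * k v\<bar> \<partial>lborel) * (\<integral>v. \<bar>exp (- (x * v)) * Q v\<bar> \<partial>lborel) ^ n"
proof -
  let ?e = "\<lambda>f v. exp (- (x * v)) * f v"
  have "integrable lborel (?e (c n)) \<and>
        (\<integral>v. ?e (c n) v \<partial>lborel) = (\<integral>v. ?e k v \<partial>lborel) * (\<integral>v. ?e Q v \<partial>lborel) ^ n \<and>
        (\<integral>v. \<bar>?e (c n) v\<bar> \<partial>lborel) \<le> (\<integral>v. \<bar>?e k v\<bar> \<partial>lborel) * (\<integral>v. \<bar>?e Q v\<bar> \<partial>lborel) ^ n"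
  proof (induction n)
    case (Suc n)
    have eq: "?e (c (Suc n)) = convolution (?e Q) (?e (c n))"
    proof
      fix v
      have E: "exp (- (x * (v - u))) * Q (v - u) * (exp (- (x * u)) * c n u) = exp (- (x * v)) * (Q (v - u) * c n u)" for u
      proof -
        have "exp (- (x * (v - u))) * exp (- (x * u)) = exp (- (x * v))"
          by (simp add: exp_add[symmetric] right_diff_distrib)
        thus ?thesis by (metis (no_types, lifting) mult.assoc mult.left_commute)
      qed
      show "?e (c (Suc n)) v = convolution (?e Q) (?e (c n)) v"
        by (simp only: convolution_def convolution_iterate.simps E integral_mult_right_zero)
    qed
    note eqv = fun_cong[OF eq]
    have I: "integrable lborel (?e (c n))" using Suc by blast
    note L = convolution_L1[OF Q_laplace_int[OF x] I]
    have "(\<integral>v. \<bar>?e (c (Suc n)) v\<bar> \<partial>lborel) \<le> (\<integral>v. \<bar>?e Q v\<bar> \<partial>lborel) * (\<integral>v. \<bar>?e (c n) v\<bar> \<partial>lborel)"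
      unfolding eqv by (rule L(3))
    also have "\<dots> \<le> (\<integral>v. \<bar>?e Q v\<bar> \<partial>lborel) * ((\<integral>v. \<bar>?e k v\<bar> \<partial>lborel) * (\<integral>v. \<bar>?e Q v\<bar> \<partial>lborel) ^ n)"
      using Suc by (intro mult_left_mono) auto
    finally have "(\<integral>v. \<bar>?e (c (Suc n)) v\<bar> \<partial>lborel) \<le> (\<integral>v. \<bar>?e k v\<bar> \<partial>lborel) * (\<integral>v. \<bar>?e Q v\<bar> \<partial>lborel) ^ Suc n"
      by (simp only: power_Suc mult_ac)
    moreover have "(\<integral>v. ?e (c (Suc n)) v \<partial>lborel) = (\<integral>v. ?e k v \<partial>lborel) * (\<integral>v. ?e Q v \<partial>lborel) ^ Suc n"
      unfolding eqv L(2) using Suc by (simp only: power_Suc mult_ac)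
    ultimately show ?case using L(1) unfolding eq[symmetric] by blast
  qed (simp add: k_laplace_int[OF x])
  thus "integrable lborel (?e (c n))"
    "(\<integral>v. ?e (c n) v \<partial>lborel) = (\<integral>v. ?e k v \<partial>lborel) * (\<integral>v. ?e Q v \<partial>lborel) ^ n"
    "(\<integral>v. \<bar>?e (c n) v\<bar> \<partial>lborel) \<le> (\<integral>v. \<bar>?e k v\<bar> \<partial>lborel) * (\<integral>v. \<bar>?e Q v\<bar> \<partial>lborel) ^ n"
    by blast+
qed

lemma c_meas [measurable]: "c n \<in> borel_measurable borel"
proof -
  have "(\<lambda>v. exp v * (exp (- (1 * v)) * c n v)) \<in> borel_measurable borel"
    using borel_measurable_integrable[OF c_laplace(1)[of 1 n]] by measurable
  thus ?thesis by (simp add: mult.assoc[symmetric] exp_add[symmetric])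
qed

lemma c_int_Icc: "integrable lborel (\<lambda>u. indicator {0..T} u * \<bar>c n u\<bar>)"
proof (rule Bochner_Integration.integrable_bound)
  show "integrable lborel (\<lambda>u. exp T * (exp (- (1 * u)) * c n u))"
    using c_laplace(1)[of 1 n] by simp
  show "AE u in lborel. norm (indicator {0..T} u * \<bar>c n u\<bar>) \<le> norm (exp T * (exp (- (1 * u)) * c n u))"
  proof (intro AE_I2)
    fix u
    show "norm (indicator {0..T} u * \<bar>c n u\<bar>) \<le> norm (exp T * (exp (- (1 * u)) * c n u))"
    proof (cases "u \<in> {0..T}")
      case True
      have "1 * \<bar>c n u\<bar> \<le> exp (T - u) * \<bar>c n u\<bar>" using True by (intro mult_right_mono) auto
      thus ?thesis using True by (simp add: abs_mult mult.assoc[symmetric] exp_add[symmetric])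
    qed auto
  qed
qed measurable

lemma conv_integrand_int: "integrable lborel (\<lambda>u. Q (x - u) * c n u)"
proof (rule Bochner_Integration.integrable_bound)
  show "integrable lborel (\<lambda>u. M * (indicator {0..x} u * \<bar>c n u\<bar>))"
    using c_int_Icc by simp
  show "AE u in lborel. norm (Q (x - u) * c n u) \<le> norm (M * (indicator {0..x} u * \<bar>c n u\<bar>))"
  proof (intro AE_I2)
    fix u
    show "norm (Q (x - u) * c n u) \<le> norm (M * (indicator {0..x} u * \<bar>c n u\<bar>))"
      using c_supp[of u n] Q_supp[of "x - u"] Q_bound[of "x - u"] M_nonneg
      by (cases "u < 0"; cases "u > x") (auto simp: abs_mult mult_right_mono)
  qed
qed measurable

text \<open>
  The first convolution is bounded by \<open>M\<close> times the \<open>L\<^sup>1\<close> norm of \<open>k\<close>; every further one integrates a bound of the form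
  \<open>u^n / n!\<close> over \<open>[0, x]\<close>, as in Picard iteration.
\<close>
lemma c_bound_power:
  assumes "x \<ge> 0"
  shows "\<bar>c (Suc n) x\<bar> \<le> (\<integral>u. \<bar>k u\<bar> \<partial>lborel) * M * ((M * x) ^ n / fact n)"
  using assms
proof (induction n arbitrary: x)
  case 0
  have "\<bar>c (Suc 0) x\<bar> \<le> (\<integral>u. \<bar>Q (x - u) * k u\<bar> \<partial>lborel)"
    unfolding convolution_iterate.simps convolution_def by (rule integral_abs_bound)
  also have "\<dots> \<le> (\<integral>u. M * \<bar>k u\<bar> \<partial>lborel)"
    using integrable_abs[OF conv_integrand_int[of x 0]] k_int Q_bound
    by (intro integral_mono) (auto simp: abs_mult mult_right_mono)
  finally show ?case by (simp add: mult.commute)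
next
  case (Suc n)
  define I where "I = (\<integral>u. \<bar>k u\<bar> \<partial>lborel)"
  have I: "I \<ge> 0" unfolding I_def by (intro Bochner_Integration.integral_nonneg) auto
  have "\<bar>c (Suc (Suc n)) x\<bar> \<le> (\<integral>u. \<bar>Q (x - u) * c (Suc n) u\<bar> \<partial>lborel)"
    unfolding convolution_iterate.simps(2)[of Q k "Suc n"] convolution_def by (rule integral_abs_bound)
  also have "\<dots> \<le> (\<integral>u. M * (I * M * M ^ n / fact n) * (u ^ n * indicator {0..x} u) \<partial>lborel)"
  proof (rule integral_mono)
    show "integrable lborel (\<lambda>u. M * (I * M * M ^ n / fact n) * (u ^ n * indicator {0..x} u))"
      by (intro integrable_mult_right) (use borel_integrable_atLeastAtMost[of 0 x "\<lambda>u. u ^ n"] in \<open>simp add: mult.commute\<close>)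
    fix u
    show "\<bar>Q (x - u) * c (Suc n) u\<bar> \<le> M * (I * M * M ^ n / fact n) * (u ^ n * indicator {0..x} u)"
    proof (cases "u \<in> {0..x}")
      case True
      have "\<bar>Q (x - u)\<bar> * \<bar>c (Suc n) u\<bar> \<le> M * (I * M * ((M * u) ^ n / fact n))"
        using Q_bound[of "x - u"] Suc.IH[of u] True M_nonneg unfolding I_def by (intro mult_mono) auto
      thus ?thesis using True by (simp add: abs_mult power_mult_distrib)
    next
      case False
      hence "Q (x - u) * c (Suc n) u = 0" using Q_supp[of "x - u"] c_supp[of u "Suc n"] by (cases "u < 0") auto
      moreover have "indicator {0..x} u = (0::real)" using False by simp
      ultimately show ?thesis by (simp only: abs_zero mult_zero_right)
    qed
  qed (use conv_integrand_int[of x "Suc n"] in \<open>simp only: integrable_abs\<close>)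
  also have "\<dots> = M * (I * M * M ^ n / fact n) * (x ^ Suc n / Suc n)"
    using integral_power[of 0 x n] Suc.prems by simp
  also have "\<dots> = I * M * ((M * x) ^ Suc n / fact (Suc n))"
    by (simp add: power_mult_distrib divide_simps)
  finally show ?case by (simp add: I_def)
qed

lemma c_bound_uniform: "\<exists>B\<ge>0. \<forall>n. \<forall>x\<in>{0..T}. \<bar>c (Suc n) x\<bar> \<le> B"
proof (intro exI[of _ "(\<integral>u. \<bar>k u\<bar> \<partial>lborel) * M * exp (M * T)"] conjI allI ballI)
  have I: "(\<integral>u. \<bar>k u\<bar> \<partial>lborel) \<ge> 0" by (intro Bochner_Integration.integral_nonneg) auto
  show "(\<integral>u. \<bar>k u\<bar> \<partial>lborel) * M * exp (M * T) \<ge> 0" using I M_nonneg by simp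
  fix n x assume x: "x \<in> {0..T}"
  have "(M * x) ^ n / fact n \<le> exp (M * T)"
  proof -
    have "(M * x) ^ n / fact n \<le> exp (M * x)"
      using x M_nonneg by (intro power_div_fact_le_exp) auto
    also have "\<dots> \<le> exp (M * T)" using x M_nonneg by (simp add: mult_left_mono)
    finally show ?thesis .
  qed
  hence "(\<integral>u. \<bar>k u\<bar> \<partial>lborel) * M * ((M * x) ^ n / fact n) \<le> (\<integral>u. \<bar>k u\<bar> \<partial>lborel) * M * exp (M * T)"
    using I M_nonneg by (intro mult_left_mono) auto
  thus "\<bar>c (Suc n) x\<bar> \<le> (\<integral>u. \<bar>k u\<bar> \<partial>lborel) * M * exp (M * T)"
    using c_bound_power[of x n] x by simp
qed

lemma summable_inverse_fact: "summable (\<lambda>n. 1 / fact n :: real)"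
  using summable_exp_generic[of "1::real"] by (simp add: divide_inverse)

lemma h_summable: "summable (\<lambda>n. \<bar>c n x / fact n\<bar>)"
proof (cases "x < 0")
  case False
  obtain B where B: "B \<ge> 0" "\<And>n. \<bar>c (Suc n) x\<bar> \<le> B" using c_bound_uniform[of x] False by auto
  have "summable (\<lambda>n. \<bar>c (Suc n) x / fact (Suc n)\<bar>)"
  proof (rule summable_comparison_test')
    show "summable (\<lambda>n. B * (1 / fact (Suc n)))"
      using summable_inverse_fact by (intro summable_mult) (subst summable_Suc_iff)
    show "norm \<bar>c (Suc n) x / fact (Suc n)\<bar> \<le> B * (1 / fact (Suc n))" if "n \<ge> 0" for n
      using B(2)[of n] by (simp add: divide_right_mono del: fact_Suc convolution_iterate.simps)
  qed
  thus ?thesis by (subst (asm) summable_Suc_iff)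
qed (simp add: c_supp)

lemma h_supp: "x < 0 \<Longrightarrow> h x = 0"
  by (simp add: h_def c_supp)

text \<open>
  The integrals of the summands add up to an exponential series, absolutely, so the sum may be taken under the
  integral.
\<close>
lemma h_laplace:
  assumes x: "x > 0"
  shows "integrable lborel (\<lambda>v. exp (- (x * v)) * h v)"
    and "(\<integral>v. exp (- (x * v)) * h v \<partial>lborel) =
           (\<integral>v. exp (- (x * v)) * k v \<partial>lborel) * exp (\<integral>v. exp (- (x * v)) * Q v \<partial>lborel)"
proof -
  define g where "g = (\<lambda>n v. exp (- (x * v)) * c n v / fact n)"
  have g: "integrable lborel (g n)" for n unfolding g_def using c_laplace(1)[OF x] by simp
  have gabs: "AE v in lborel. summable (\<lambda>n. norm (g n v))"
    unfolding g_def using summable_mult[OF h_summable] by (simp add: abs_mult)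
  have gsum: "summable (\<lambda>n. \<integral>v. norm (g n v) \<partial>lborel)"
  proof (rule summable_comparison_test')
    let ?q = "\<integral>v. \<bar>exp (- (x * v)) * Q v\<bar> \<partial>lborel"
    show "summable (\<lambda>n. (\<integral>v. \<bar>exp (- (x * v)) * k v\<bar> \<partial>lborel) * (?q ^ n /\<^sub>R fact n))"
      by (intro summable_mult summable_exp_generic)
    fix n
    have "(\<integral>v. norm (g n v) \<partial>lborel) = (\<integral>v. \<bar>exp (- (x * v)) * c n v\<bar> \<partial>lborel) / fact n"
      by (simp add: g_def)
    also have "\<dots> \<le> (\<integral>v. \<bar>exp (- (x * v)) * k v\<bar> \<partial>lborel) * ?q ^ n / fact n"
      using c_laplace(3)[OF x] by (intro divide_right_mono) auto
    also have "\<dots> = (\<integral>v. \<bar>exp (- (x * v)) * k v\<bar> \<partial>lborel) * (?q ^ n /\<^sub>R fact n)"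
      by (simp add: field_simps)
    finally show "norm (\<integral>v. norm (g n v) \<partial>lborel) \<le> (\<integral>v. \<bar>exp (- (x * v)) * k v\<bar> \<partial>lborel) * (?q ^ n /\<^sub>R fact n)"
      by simp
  qed
  have gs: "(\<lambda>v. \<Sum>n. g n v) = (\<lambda>v. exp (- (x * v)) * h v)"
    unfolding g_def h_def
    by (intro ext, subst suminf_mult[symmetric]) (use h_summable summable_rabs_cancel in auto)
  show "integrable lborel (\<lambda>v. exp (- (x * v)) * h v)"
    using integrable_suminf[OF g gabs gsum] unfolding gs .
  have "(\<lambda>n. \<integral>v. g n v \<partial>lborel) sums (\<integral>v. exp (- (x * v)) * h v \<partial>lborel)"
    using sums_integral[OF g gabs gsum] unfolding gs .
  moreover have "(\<integral>v. g n v \<partial>lborel) = (\<integral>v. exp (- (x * v)) * k v \<partial>lborel) * ((\<integral>v. exp (- (x * v)) * Q v \<partial>lborel) ^ n /\<^sub>R fact n)" for n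
    using c_laplace(2)[OF x, of n] by (simp add: g_def field_simps)
  moreover have "(\<lambda>n. (\<integral>v. exp (- (x * v)) * k v \<partial>lborel) * ((\<integral>v. exp (- (x * v)) * Q v \<partial>lborel) ^ n /\<^sub>R fact n))
     sums ((\<integral>v. exp (- (x * v)) * k v \<partial>lborel) * exp (\<integral>v. exp (- (x * v)) * Q v \<partial>lborel))"
    by (intro sums_mult exp_converges)
  ultimately show "(\<integral>v. exp (- (x * v)) * h v \<partial>lborel) =
           (\<integral>v. exp (- (x * v)) * k v \<partial>lborel) * exp (\<integral>v. exp (- (x * v)) * Q v \<partial>lborel)"
    using sums_unique2 by simp
qed

text \<open>
  Increments of a convolution \<open>Q*c\<^sub>n\<close> come from the increments of \<open>Q\<close>, which are controlled by its Lipschitz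
  constant, and from the jump of \<open>Q\<close> at 0, which contributes the values of \<open>c\<^sub>n\<close> near \<open>t\<close> only. Hence one
  Lipschitz constant \<open>C\<close> serves for all iterates but the first, and the factorials make the sum of the
  constants finite.
\<close>
lemma h_lipschitz:
  assumes t: "t > 0"
  shows "\<exists>d>0. \<exists>K. \<forall>v. \<bar>v - t\<bar> < d \<longrightarrow> \<bar>h v - h t\<bar> \<le> K * \<bar>v - t\<bar>"
proof -
  obtain d0 K0 where d0: "d0 > 0" and K0: "\<And>v. \<bar>v - t\<bar> < d0 \<Longrightarrow> \<bar>k v - k t\<bar> \<le> K0 * \<bar>v - t\<bar>"
    using k_lip[OF t] by blast
  define d where "d = min d0 (t / 2)"
  define T where "T = 2 * t"
  have d: "d > 0" "d \<le> d0" "d \<le> t / 2" using d0 t by (auto simp: d_def)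
  obtain L where L: "L \<ge> 0" "\<And>x y. x \<in> {0..T} \<Longrightarrow> y \<in> {0..T} \<Longrightarrow> \<bar>Q x - Q y\<bar> \<le> L * \<bar>x - y\<bar>"
    using Q_lip[of T] by blast
  obtain B0 where B0: "B0 \<ge> 0" "\<And>n x. x \<in> {0..T} \<Longrightarrow> \<bar>c (Suc n) x\<bar> \<le> B0"
    using c_bound_uniform[of T] by blast
  define B where "B = B0 + \<bar>k t\<bar> + \<bar>K0\<bar> * d"
  have B: "B \<ge> 0" using B0 d by (simp add: B_def)
  have cB: "\<bar>c n x\<bar> \<le> B" if x: "\<bar>x - t\<bar> < d" for n x
  proof (cases n)
    case 0
    have "\<bar>k x - k t\<bar> \<le> \<bar>K0\<bar> * \<bar>x - t\<bar>"
      using K0[of x] x d by (intro order_trans[OF K0] mult_right_mono) auto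
    also have "\<dots> \<le> \<bar>K0\<bar> * d" using x by (intro mult_left_mono) auto
    finally show ?thesis using 0 B0 by (simp add: B_def)
  next
    case (Suc m)
    have "\<bar>c (Suc m) x\<bar> \<le> B0" using x d t by (intro B0(2)) (auto simp: T_def abs_if split: if_splits)
    moreover have "\<bar>K0\<bar> * d \<ge> 0" using d by simp
    ultimately show ?thesis unfolding Suc B_def by linarith
  qed
  define J where "J = (\<integral>u. \<bar>k u\<bar> \<partial>lborel) + B0 * T"
  have cJ: "(\<integral>u. indicator {0..T} u * \<bar>c n u\<bar> \<partial>lborel) \<le> J" for n
  proof (cases n)
    case 0
    have "(\<integral>u. indicator {0..T} u * \<bar>c n u\<bar> \<partial>lborel) \<le> (\<integral>u. \<bar>k u\<bar> \<partial>lborel)"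
      using 0 k_int c_int_Icc[of T 0] by (intro integral_mono) (auto simp: indicator_def)
    moreover have "B0 * T \<ge> 0" using B0 t by (simp add: T_def)
    ultimately show ?thesis unfolding J_def by linarith
  next
    case (Suc m)
    have "(\<integral>u. indicator {0..T} u * \<bar>c n u\<bar> \<partial>lborel) \<le> (\<integral>u. indicator {0..T} u * B0 \<partial>lborel)"
    proof (rule integral_mono)
      show "integrable lborel (\<lambda>u. indicator {0..T} u * B0)"
        using t by (intro integrable_mult_left integrable_real_indicator) (auto simp: T_def)
      show "indicator {0..T} u * \<bar>c n u\<bar> \<le> indicator {0..T} u * B0" for u
        using B0(2)[of u m] Suc by (auto simp: indicator_def)
    qed (rule c_int_Icc)
    also have "\<dots> = B0 * T" using t by (simp add: T_def)
    moreover have "(\<integral>u. \<bar>k u\<bar> \<partial>lborel) \<ge> 0" by (intro Bochner_Integration.integral_nonneg) simp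
    ultimately show ?thesis unfolding J_def by linarith
  qed
  have J: "J \<ge> 0"
    unfolding J_def using B0 t Bochner_Integration.integral_nonneg[of lborel "\<lambda>u. \<bar>k u\<bar>"] by (simp add: T_def)
  define C where "C = L * J + M * B"
  have C: "C \<ge> 0" using L J B M_nonneg by (simp add: C_def)
  have order: "\<bar>c (Suc n) x - c (Suc n) y\<bar> \<le> C * (x - y)"
    if xy: "y \<le> x" "\<bar>x - t\<bar> < d" "\<bar>y - t\<bar> < d" for n x y
  proof -
    have y0: "0 \<le> y" "x \<le> T" using xy d t by (auto simp: T_def abs_if split: if_splits)
    let ?r = "\<lambda>u. L * (x - y) * (indicator {0..T} u * \<bar>c n u\<bar>) + M * B * indicator {y..x} u"
    have "\<bar>c (Suc n) x - c (Suc n) y\<bar> = \<bar>\<integral>u. Q (x - u) * c n u - Q (y - u) * c n u \<partial>lborel\<bar>"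
      using conv_integrand_int[of x n] conv_integrand_int[of y n] by (simp add: convolution_def)
    also have "\<dots> \<le> (\<integral>u. ?r u \<partial>lborel)"
    proof (rule integral_abs_bound_integral)
      fix u
      consider "u < 0" | "u > x" | "0 \<le> u" "u \<le> y" | "y < u" "u \<le> x" by linarith
      thus "\<bar>Q (x - u) * c n u - Q (y - u) * c n u\<bar> \<le> ?r u"
      proof cases
        case 1
        thus ?thesis using c_supp[of u n] y0 L J B M_nonneg xy by (simp add: indicator_def)
      next
        case 2
        thus ?thesis using Q_supp[of "x - u"] Q_supp[of "y - u"] xy y0 L B M_nonneg
          by (simp add: indicator_def)
      next
        case 3
        have "\<bar>Q (x - u) * c n u - Q (y - u) * c n u\<bar> = \<bar>Q (x - u) - Q (y - u)\<bar> * \<bar>c n u\<bar>"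
          by (simp add: abs_mult[symmetric] left_diff_distrib)
        also have "\<dots> \<le> L * (x - y) * \<bar>c n u\<bar>"
          using L(2)[of "x - u" "y - u"] 3 xy y0 by (intro mult_right_mono) auto
        finally have "\<bar>Q (x - u) * c n u - Q (y - u) * c n u\<bar> \<le> L * (x - y) * \<bar>c n u\<bar>" .
        moreover have "indicator {0..T} u = (1::real)" using 3 xy y0 by simp
        moreover have "0 \<le> M * B * indicator {y..x} u" using B M_nonneg by simp
        ultimately show ?thesis by simp
      next
        case 4
        have "\<bar>Q (x - u) * c n u - Q (y - u) * c n u\<bar> = \<bar>Q (x - u)\<bar> * \<bar>c n u\<bar>"
          using Q_supp[of "y - u"] 4 by (simp add: abs_mult)
        also have "\<dots> \<le> M * B"
          using Q_bound[of "x - u"] cB[of u n] 4 xy M_nonneg by (intro mult_mono) auto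
        moreover have "0 \<le> L * (x - y) * (indicator {0..T} u * \<bar>c n u\<bar>)"
          using L xy by simp
        ultimately show ?thesis using 4 by simp
      qed
    next
      show "integrable lborel ?r"
        using xy by (intro Bochner_Integration.integrable_add integrable_mult_right c_int_Icc integrable_real_indicator) auto
    qed (use conv_integrand_int[of x n] conv_integrand_int[of y n] in simp)
    also have "\<dots> = L * (x - y) * (\<integral>u. indicator {0..T} u * \<bar>c n u\<bar> \<partial>lborel) + M * B * (x - y)"
    proof -
      have iI: "integrable lborel (\<lambda>u. M * B * indicator {y..x} u)"
        using xy by (intro integrable_mult_right integrable_real_indicator) auto
      show ?thesis
        using Bochner_Integration.integral_add[OF integrable_mult_right[OF c_int_Icc, of "L * (x - y)" T n]
            iI] xy
        by (simp only: integral_mult_right_zero) simp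
    qed
    also have "\<dots> \<le> L * (x - y) * J + M * B * (x - y)"
      using cJ[of n] L xy by (intro add_right_mono mult_left_mono) auto
    also have "\<dots> = C * (x - y)" by (simp add: C_def algebra_simps)
    finally show ?thesis .
  qed
  have lip: "\<bar>c (Suc n) x - c (Suc n) t\<bar> \<le> C * \<bar>x - t\<bar>" if "\<bar>x - t\<bar> < d" for n x
    using order[of t x n] order[of x t n] that d
    by (cases "t \<le> x") (auto simp: abs_minus_commute)
  have "\<bar>h v - h t\<bar> \<le> (\<bar>K0\<bar> + C * exp 1) * \<bar>v - t\<bar>" if v: "\<bar>v - t\<bar> < d" for v
  proof -
    let ?s = "\<lambda>n. (c n v - c n t) / fact n"
    have S: "summable (\<lambda>n. c n v / fact n)" for v
      using h_summable[of v] by (rule summable_rabs_cancel)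
    have hd: "h v - h t = (\<Sum>n. ?s n)"
      unfolding h_def by (subst suminf_diff[OF S S]) (simp add: diff_divide_distrib)
    have sn: "\<bar>?s n\<bar> \<le> (if n = 0 then \<bar>K0\<bar> else 0) * \<bar>v - t\<bar> + C * \<bar>v - t\<bar> * (1 ^ n /\<^sub>R fact n)" for n
    proof (cases n)
      case 0
      have "\<bar>k v - k t\<bar> \<le> \<bar>K0\<bar> * \<bar>v - t\<bar>"
        using v d by (intro order_trans[OF K0] mult_right_mono) auto
      moreover have "C * \<bar>v - t\<bar> \<ge> 0" using C by simp
      ultimately show ?thesis using 0 by simp
    next
      case (Suc m)
      have "\<bar>c (Suc m) v - c (Suc m) t\<bar> / fact n \<le> C * \<bar>v - t\<bar> / fact n"
        using lip[OF v, of m] by (rule divide_right_mono) simp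
      thus ?thesis using Suc by (simp add: divide_inverse abs_mult)
    qed
    have sums: "(\<lambda>n. (if n = 0 then \<bar>K0\<bar> else 0) * \<bar>v - t\<bar> + C * \<bar>v - t\<bar> * (1 ^ n /\<^sub>R fact n)) sums
        (\<bar>K0\<bar> * \<bar>v - t\<bar> + C * \<bar>v - t\<bar> * exp 1)"
      by (intro sums_add sums_mult sums_mult2 exp_converges sums_single[of 0 "\<lambda>_. \<bar>K0\<bar>"])
    have "\<bar>h v - h t\<bar> \<le> (\<Sum>n. (if n = 0 then \<bar>K0\<bar> else 0) * \<bar>v - t\<bar> + C * \<bar>v - t\<bar> * (1 ^ n /\<^sub>R fact n))"
      unfolding hd
    proof (rule order_trans[OF summable_rabs suminf_le])
      show "summable (\<lambda>n. \<bar>?s n\<bar>)"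
        by (rule summable_comparison_test'[OF sums_summable[OF sums]]) (use sn in auto)
      thus "summable (\<lambda>n. \<bar>?s n\<bar>)" .
    qed (use sn sums_summable[OF sums] in auto)
    also have "\<dots> = \<bar>K0\<bar> * \<bar>v - t\<bar> + C * \<bar>v - t\<bar> * exp 1" using sums by (rule sums_unique[symmetric])
    also have "\<dots> = (\<bar>K0\<bar> + C * exp 1) * \<bar>v - t\<bar>" by (simp add: algebra_simps)
    finally show ?thesis .
  qed
  thus ?thesis using d by blast
qed

end

section \<open>The logarithmic derivative of a Gamma ratio\<close>

lemma laplace_power:
  fixes y :: real
  assumes y: "y > 0"
  shows "integrable lborel (\<lambda>u. u ^ n * exp (- (y * u)) * indicator {0<..} u)"
    and "(\<integral>u. u ^ n * exp (- (y * u)) * indicator {0<..} u \<partial>lborel) = fact n / y ^ Suc n"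
proof -
  let ?f = "\<lambda>x::real. x ^ n * exp (- x) * indicator {0<..} x"
  have f: "integrable lborel ?f" "(\<integral>x. ?f x \<partial>lborel) = fact n"
    using has_bochner_integral_I0i_power_exp_m[of n] by (auto simp: has_bochner_integral_iff)
  have eq: "u ^ n * exp (- (y * u)) * indicator {0<..} u = ?f (0 + y * u) / y ^ n" for u
    using y by (simp add: power_mult_distrib indicator_def zero_less_mult_iff)
  show "integrable lborel (\<lambda>u. u ^ n * exp (- (y * u)) * indicator {0<..} u)"
    unfolding eq using y by (intro integrable_divide_zero lborel_integrable_real_affine f) auto
  define J where "J = (\<integral>u. ?f (0 + y * u) \<partial>lborel)"
  have "fact n = \<bar>y\<bar> *\<^sub>R J"
    using y unfolding f(2)[symmetric] J_def by (intro lborel_integral_real_affine) auto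
  moreover have "(\<integral>u. u ^ n * exp (- (y * u)) * indicator {0<..} u \<partial>lborel) = J / y ^ n"
    unfolding eq J_def by (rule integral_divide_zero)
  ultimately show "(\<integral>u. u ^ n * exp (- (y * u)) * indicator {0<..} u \<partial>lborel) = fact n / y ^ Suc n"
    using y by (simp add: field_simps)
qed

text \<open>
  The density whose Laplace transform has the derivatives of the summand \<open>-A Digamma(Ax + a)\<close> of \<open>-(ln W)'\<close>. The
  transform itself diverges because of the pole at \<open>u = 0\<close>; only the moments of order at least 1 exist.
\<close>
definition exp_kernel :: "real \<Rightarrow> real \<Rightarrow> real \<Rightarrow> real" where
  "exp_kernel A a u = exp (- (a / A * u)) / (1 - exp (- (u / A))) * indicator {0<..} u"

lemma exp_kernel_sums:
  assumes A: "A > 0" and u: "u > 0"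
  shows "(\<lambda>k. exp (- ((a + real k) / A * u))) sums exp_kernel A a u"
proof -
  have "(\<lambda>k. exp (- (a / A * u)) * exp (- (u / A)) ^ k) sums (exp (- (a / A * u)) * (1 / (1 - exp (- (u / A)))))"
    using A u by (intro sums_mult geometric_sums) simp
  moreover have "exp (- (a / A * u)) * exp (- (u / A)) ^ k = exp (- ((a + real k) / A * u))" for k
    using A by (simp add: exp_of_nat_mult[symmetric] exp_add[symmetric] field_simps)
  ultimately show ?thesis using u by (simp add: exp_kernel_def)
qed

lemma exp_kernel_nonneg: "A > 0 \<Longrightarrow> exp_kernel A a u \<ge> 0"
  by (auto simp: exp_kernel_def indicator_def)

lemma exp_kernel_meas [measurable]: "exp_kernel A a \<in> borel_measurable borel"
  unfolding exp_kernel_def[abs_def] by measurable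

text \<open>
  The geometric series of the kernel is integrated term by term; this reproduces the series of the
  Polygamma function at \<open>Ax + a\<close>.
\<close>
lemma laplace_exp_kernel:
  fixes x :: real
  assumes A: "A > 0" and a: "a \<ge> 0" and x: "x > 0" and n: "n \<ge> 1"
  shows "integrable lborel (\<lambda>u. u ^ n * exp (- (x * u)) * exp_kernel A a u)"
    and "(\<integral>u. u ^ n * exp (- (x * u)) * exp_kernel A a u \<partial>lborel) = (-1) ^ Suc n * A ^ Suc n * Polygamma n (A * x + a)"
proof -
  define y where "y = (\<lambda>k. x + (a + real k) / A)"
  have y: "y k > 0" for k using A a x by (simp add: y_def add_pos_nonneg)
  define g where "g = (\<lambda>k u. u ^ n * exp (- (y k * u)) * indicator {0<..} u)"
  have g: "integrable lborel (g k)" "(\<integral>u. g k u \<partial>lborel) = fact n / y k ^ Suc n" for k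
    unfolding g_def using laplace_power[OF y] by auto
  have gn: "norm (g k u) = g k u" for k u by (simp add: g_def indicator_def)
  have gsums: "(\<lambda>k. g k u) sums (u ^ n * exp (- (x * u)) * exp_kernel A a u)" for u
  proof (cases "u > 0")
    case True
    have "g k u = u ^ n * exp (- (x * u)) * exp (- ((a + real k) / A * u))" for k
      using True by (simp add: g_def y_def exp_add[symmetric] mult.assoc distrib_right)
    thus ?thesis using sums_mult[OF exp_kernel_sums[OF A True, of a]] by simp
  qed (simp add: g_def exp_kernel_def)
  have pos: "A * x + a > 0" using A a x by (simp add: add_pos_nonneg)
  have I: "(\<lambda>k. fact n / y k ^ Suc n) sums ((-1) ^ Suc n * A ^ Suc n * Polygamma n (A * x + a))"
  proof -
    have "(\<lambda>k. fact n * A ^ Suc n * inverse ((A * x + a + of_nat k) ^ Suc n)) sums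
        (fact n * A ^ Suc n * ((-1) ^ Suc n * Polygamma n (A * x + a) / fact n))"
      using pos n by (intro sums_mult Polygamma_LIMSEQ) auto
    moreover have "fact n * A ^ Suc n * inverse ((A * x + a + of_nat k) ^ Suc n) = fact n / y k ^ Suc n" for k
    proof -
      have "A * x + a + of_nat k = A * y k" using A by (simp add: y_def field_simps)
      thus ?thesis using A y[of k] by (simp only: power_mult_distrib) (simp add: field_simps)
    qed
    ultimately show ?thesis by (simp add: mult_ac)
  qed
  have gabs: "AE u in lborel. summable (\<lambda>k. norm (g k u))"
    unfolding gn using gsums sums_summable by blast
  have gsum: "summable (\<lambda>k. \<integral>u. norm (g k u) \<partial>lborel)"
    unfolding gn g(2) using I by (rule sums_summable)
  have gs: "(\<lambda>u. \<Sum>k. g k u) = (\<lambda>u. u ^ n * exp (- (x * u)) * exp_kernel A a u)"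
    using gsums by (auto simp: sums_iff)
  show "integrable lborel (\<lambda>u. u ^ n * exp (- (x * u)) * exp_kernel A a u)"
    using integrable_suminf[OF g(1) gabs gsum] unfolding gs .
  show "(\<integral>u. u ^ n * exp (- (x * u)) * exp_kernel A a u \<partial>lborel) = (-1) ^ Suc n * A ^ Suc n * Polygamma n (A * x + a)"
    using sums_unique2[OF sums_integral[OF g(1) gabs gsum] I[folded g(2)]] unfolding gs .
qed

text \<open>
  By the mean value theorem, \<open>ln x\<close>, which is the increment of \<open>ln_Gamma\<close> from \<open>x\<close> to \<open>x + 1\<close>, is a value of the
  increasing function Digamma between these points.
\<close>
lemma Digamma_ln_bounds:
  fixes x :: real
  assumes x: "x > 0"
  shows "Digamma x \<le> ln x" "ln x - 1 / x \<le> Digamma x"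
proof -
  have D: "(ln_Gamma has_real_derivative Digamma z) (at z)" if "x \<le> z" for z
    using that x by (auto intro!: derivative_eq_intros)
  obtain z where z: "x < z" "z < x + 1" "ln_Gamma (x + 1) - ln_Gamma x = (x + 1 - x) * Digamma z"
    using MVT2[of x "x + 1" ln_Gamma Digamma, OF _ D] by auto
  have "ln_Gamma (x + 1) = ln_Gamma x + ln x"
    using x Gamma_real_pos[OF x] by (simp add: ln_Gamma_real_pos Gamma_plus1 ln_mult_pos nonpos_Ints_def)
  hence "Digamma z = ln x" using z(3) by simp
  moreover have "Digamma x \<le> Digamma z" "Digamma z \<le> Digamma (x + 1)"
    using Polygamma_real_mono[of x z 0] Polygamma_real_mono[of z "x + 1" 0] x z by auto
  moreover have "Digamma (x + 1) = Digamma x + 1 / x" using x by (simp add: Digamma_plus1)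
  ultimately show "Digamma x \<le> ln x" "ln x - 1 / x \<le> Digamma x" by linarith+
qed

lemma Digamma_affine_asymp:
  fixes A a :: real
  assumes A: "A > 0" and a: "a \<ge> 0"
  shows "((\<lambda>x. A * Digamma (A * x + a) - A * ln x) \<longlongrightarrow> A * ln A) at_top"
proof -
  have ev: "\<forall>\<^sub>F x in at_top. A * x + a > 0"
    using eventually_gt_at_top[of 0] by eventually_elim (use A a in \<open>simp add: add_pos_nonneg\<close>)
  have "((\<lambda>x. Digamma (A * x + a) - ln x) \<longlongrightarrow> ln A) at_top"
  proof (rule tendsto_sandwich)
    show "\<forall>\<^sub>F x in at_top. ln (A * x + a) - 1 / (A * x + a) - ln x \<le> Digamma (A * x + a) - ln x"
      using ev by eventually_elim (use Digamma_ln_bounds(2) in force)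
    show "\<forall>\<^sub>F x in at_top. Digamma (A * x + a) - ln x \<le> ln (A * x + a) - ln x"
      using ev by eventually_elim (use Digamma_ln_bounds(1) in force)
    show "((\<lambda>x. ln (A * x + a) - 1 / (A * x + a) - ln x) \<longlongrightarrow> ln A) at_top"
      using A by real_asymp
    show "((\<lambda>x. ln (A * x + a) - ln x) \<longlongrightarrow> ln A) at_top"
      using A by real_asymp
  qed
  from tendsto_mult[OF tendsto_const[of A] this] show ?thesis by (simp add: right_diff_distrib)
qed

locale gamma_ratio_params =
  fixes p q :: nat and A a B b :: "nat \<Rightarrow> real"
  assumes p1: "p \<ge> 1"
    and A_pos: "\<And>i. i \<in> {1..p} \<Longrightarrow> A i > 0" and B_pos: "\<And>j. j \<in> {1..q} \<Longrightarrow> B j > 0"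
    and a_nonneg: "\<And>i. i \<in> {1..p} \<Longrightarrow> a i \<ge> 0" and b_nonneg: "\<And>j. j \<in> {1..q} \<Longrightarrow> b j \<ge> 0"
begin

abbreviation "W \<equiv> gamma_ratio p q A a B b :: real \<Rightarrow> real"
abbreviation "\<rho> \<equiv> gamma_ratio_rho p q A B"
abbreviation "\<mu> \<equiv> gamma_ratio_mu p q a b"

lemma W_eq: "W x = (\<Prod>i=1..p. Gamma (A i * x + a i)) / (\<Prod>j=1..q. Gamma (B j * x + b j))"
  by (simp add: gamma_ratio_def of_real_eq_id)

lemma arg_pos:
  assumes "x > 0"
  shows "i \<in> {1..p} \<Longrightarrow> A i * x + a i > 0" "j \<in> {1..q} \<Longrightarrow> B j * x + b j > 0"
  using assms A_pos[of i] a_nonneg[of i] B_pos[of j] b_nonneg[of j] by (auto intro!: add_pos_nonneg)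

lemma W_pos: "x > 0 \<Longrightarrow> W x > 0"
  unfolding W_eq using arg_pos by (intro divide_pos_pos prod_pos Gamma_real_pos ballI) auto

lemma rho_pos: "\<rho> > 0"
  unfolding gamma_ratio_rho_def using A_pos B_pos by (intro mult_pos_pos prod_pos) force+

lemma ln_rho: "ln \<rho> = (\<Sum>i=1..p. A i * ln (A i)) - (\<Sum>j=1..q. B j * ln (B j))"
proof -
  have "ln \<rho> = ln (\<Prod>i=1..p. A i powr A i) + ln (\<Prod>j=1..q. B j powr (- B j))"
    unfolding gamma_ratio_rho_def using A_pos B_pos by (intro ln_mult_pos prod_pos) force+
  also have "ln (\<Prod>i=1..p. A i powr A i) = (\<Sum>i=1..p. ln (A i powr A i))"
    using A_pos by (intro ln_prod) force+
  also have "ln (\<Prod>j=1..q. B j powr (- B j)) = (\<Sum>j=1..q. ln (B j powr (- B j)))"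
    using B_pos by (intro ln_prod) force+
  also have "(\<Sum>i=1..p. ln (A i powr A i)) = (\<Sum>i=1..p. A i * ln (A i))"
    using A_pos by (intro sum.cong) (auto simp: ln_powr)
  also have "(\<Sum>j=1..q. ln (B j powr (- B j))) = - (\<Sum>j=1..q. B j * ln (B j))"
    unfolding sum_negf[symmetric] using B_pos by (intro sum.cong) (auto simp: ln_powr)
  finally show ?thesis by simp
qed

text \<open>
  \<open>g n\<close> is \<open>(-1)^n\<close> times the \<open>n\<close>-th derivative of \<open>-(ln W)'\<close>; complete monotonicity of
  \<open>-(ln W)'\<close> means that all of these are nonnegative.
\<close>
definition g :: "nat \<Rightarrow> real \<Rightarrow> real" where
  "g n x = (-1) ^ n * ((\<Sum>j=1..q. B j ^ Suc n * Polygamma n (B j * x + b j))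
                     - (\<Sum>i=1..p. A i ^ Suc n * Polygamma n (A i * x + a i)))"

lemma pos_not_nonpos_Int: "(z::real) > 0 \<Longrightarrow> z \<notin> \<int>\<^sub>\<le>\<^sub>0"
  by (auto simp: nonpos_Ints_def)

lemma g_deriv:
  assumes x: "x > 0"
  shows "(g n has_real_derivative - g (Suc n) x) (at x)"
proof -
  have *: "((\<lambda>x. A ^ Suc n * Polygamma n (A * x + a)) has_real_derivative
           A ^ Suc (Suc n) * Polygamma (Suc n) (A * x + a)) (at x)" if "A * x + a > 0" for A a
    using pos_not_nonpos_Int[OF that] by (auto intro!: derivative_eq_intros simp: mult_ac)
  have "(g n has_real_derivative
      (-1) ^ n * ((\<Sum>j=1..q. B j ^ Suc (Suc n) * Polygamma (Suc n) (B j * x + b j))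
                 - (\<Sum>i=1..p. A i ^ Suc (Suc n) * Polygamma (Suc n) (A i * x + a i)))) (at x)"
    unfolding g_def[abs_def] using arg_pos[OF x] by (intro DERIV_cmult DERIV_diff DERIV_sum *)
  thus ?thesis by (simp add: g_def[of "Suc n"])
qed

lemma ln_W_deriv:
  assumes x: "x > 0"
  shows "((\<lambda>x. ln (W x)) has_real_derivative - g 0 x) (at x)"
proof -
  have D: "((\<lambda>x. (\<Sum>i=1..p. ln_Gamma (A i * x + a i)) - (\<Sum>j=1..q. ln_Gamma (B j * x + b j)))
          has_real_derivative - g 0 x) (at x)"
  proof -
    have *: "((\<lambda>x. ln_Gamma (A * x + a)) has_real_derivative A ^ Suc 0 * Digamma (A * x + a)) (at x)"
      if "A * x + a > 0" for A a :: real
      using that by (auto intro!: derivative_eq_intros)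
    have "((\<lambda>x. (\<Sum>i=1..p. ln_Gamma (A i * x + a i)) - (\<Sum>j=1..q. ln_Gamma (B j * x + b j)))
        has_real_derivative (\<Sum>i=1..p. A i ^ Suc 0 * Digamma (A i * x + a i))
           - (\<Sum>j=1..q. B j ^ Suc 0 * Digamma (B j * x + b j))) (at x)"
      using arg_pos[OF x] by (intro DERIV_diff DERIV_sum *)
    thus ?thesis by (simp add: g_def)
  qed
  have E: "(\<Sum>i=1..p. ln_Gamma (A i * y + a i)) - (\<Sum>j=1..q. ln_Gamma (B j * y + b j)) = ln (W y)"
    if "y \<in> {0<..}" for y
  proof -
    have y: "y > 0" using that by simp
    have "ln (W y) = ln (\<Prod>i=1..p. Gamma (A i * y + a i)) - ln (\<Prod>j=1..q. Gamma (B j * y + b j))"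
      unfolding W_eq using arg_pos[OF y] by (intro ln_divide_pos prod_pos) auto
    also have "ln (\<Prod>i=1..p. Gamma (A i * y + a i)) = (\<Sum>i=1..p. ln (Gamma (A i * y + a i)))"
      using Gamma_real_pos[OF arg_pos(1)[OF y]] by (intro ln_prod) (auto simp: less_imp_neq[THEN not_sym])
    also have "ln (\<Prod>j=1..q. Gamma (B j * y + b j)) = (\<Sum>j=1..q. ln (Gamma (B j * y + b j)))"
      using Gamma_real_pos[OF arg_pos(2)[OF y]] by (intro ln_prod) (auto simp: less_imp_neq[THEN not_sym])
    finally show ?thesis using arg_pos[OF y] by (simp add: ln_Gamma_real_pos)
  qed
  show ?thesis
    by (rule has_field_derivative_transform_within_open[OF D _ _ E, of "{0<..}"]) (use x in auto)
qed

text \<open>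
  The logarithmic terms balance exactly when \<open>\<Sum>B = \<Sum>A\<close>; the constant terms add up to \<open>-ln \<rho>\<close>.
\<close>
lemma g0_asymp:
  "((\<lambda>x. g 0 x - ((\<Sum>j=1..q. B j) - (\<Sum>i=1..p. A i)) * ln x) \<longlongrightarrow> - ln \<rho>) at_top"
proof -
  have "((\<lambda>x. (\<Sum>j=1..q. B j * Digamma (B j * x + b j) - B j * ln x)
            - (\<Sum>i=1..p. A i * Digamma (A i * x + a i) - A i * ln x)) \<longlongrightarrow>
        (\<Sum>j=1..q. B j * ln (B j)) - (\<Sum>i=1..p. A i * ln (A i))) at_top"
    using A_pos B_pos a_nonneg b_nonneg
    by (intro tendsto_diff tendsto_sum Digamma_affine_asymp) auto
  moreover have "(\<Sum>j=1..q. B j * Digamma (B j * x + b j) - B j * ln x)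
            - (\<Sum>i=1..p. A i * Digamma (A i * x + a i) - A i * ln x)
      = g 0 x - ((\<Sum>j=1..q. B j) - (\<Sum>i=1..p. A i)) * ln x" for x
    by (simp add: g_def sum_subtractf sum_distrib_right left_diff_distrib)
  ultimately show ?thesis by (simp add: ln_rho)
qed

definition P :: "real \<Rightarrow> real" where
  "P u = (\<Sum>i=1..p. exp_kernel (A i) (a i) u) - (\<Sum>j=1..q. exp_kernel (B j) (b j) u)"

lemma P_meas [measurable]: "P \<in> borel_measurable borel"
  unfolding P_def[abs_def] by measurable

text \<open>
  The order 0 is excluded because the individual kernels have a pole at \<open>u = 0\<close>; \<open>g0_eq\<close> supplies it
  when the poles cancel.
\<close>
lemma g_eq_moment:
  assumes x: "x > 0" and n: "n \<ge> 1"
  shows "integrable lborel (\<lambda>u. u ^ n * exp (- (x * u)) * P u)"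
    and "(\<integral>u. u ^ n * exp (- (x * u)) * P u \<partial>lborel) = g n x"
proof -
  have eq: "u ^ n * exp (- (x * u)) * P u =
      (\<Sum>i=1..p. u ^ n * exp (- (x * u)) * exp_kernel (A i) (a i) u)
      - (\<Sum>j=1..q. u ^ n * exp (- (x * u)) * exp_kernel (B j) (b j) u)" for u
    by (simp add: P_def right_diff_distrib sum_distrib_left)
  have i1: "integrable lborel (\<lambda>u. \<Sum>i=1..p. u ^ n * exp (- (x * u)) * exp_kernel (A i) (a i) u)"
    using A_pos a_nonneg x n by (intro Bochner_Integration.integrable_sum laplace_exp_kernel) auto
  have i2: "integrable lborel (\<lambda>u. \<Sum>j=1..q. u ^ n * exp (- (x * u)) * exp_kernel (B j) (b j) u)"
    using B_pos b_nonneg x n by (intro Bochner_Integration.integrable_sum laplace_exp_kernel) auto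
  show "integrable lborel (\<lambda>u. u ^ n * exp (- (x * u)) * P u)"
    unfolding eq by (intro Bochner_Integration.integrable_diff i1 i2)
  have "(\<integral>u. u ^ n * exp (- (x * u)) * P u \<partial>lborel) =
      (\<Sum>i=1..p. \<integral>u. u ^ n * exp (- (x * u)) * exp_kernel (A i) (a i) u \<partial>lborel)
    - (\<Sum>j=1..q. \<integral>u. u ^ n * exp (- (x * u)) * exp_kernel (B j) (b j) u \<partial>lborel)"
    unfolding eq Bochner_Integration.integral_diff[OF i1 i2]
    using A_pos a_nonneg B_pos b_nonneg x n
    by (subst (1 2) Bochner_Integration.integral_sum) (auto intro!: laplace_exp_kernel)
  also have "\<dots> = (\<Sum>i=1..p. (-1) ^ Suc n * A i ^ Suc n * Polygamma n (A i * x + a i))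
       - (\<Sum>j=1..q. (-1) ^ Suc n * B j ^ Suc n * Polygamma n (B j * x + b j))"
    using A_pos a_nonneg B_pos b_nonneg x n
    by (intro arg_cong2[of _ _ _ _ "(-)"] sum.cong laplace_exp_kernel) auto
  also have "\<dots> = g n x"
    by (simp add: g_def right_diff_distrib sum_distrib_left sum_negf mult.assoc)
  finally show "(\<integral>u. u ^ n * exp (- (x * u)) * P u \<partial>lborel) = g n x" .
qed

end

section \<open>Behaviour of the density at the origin\<close>

text \<open>
  The entire function \<open>(1 - exp(-v))/v\<close>. It has no zeros on the real line, so its reciprocal serves to continue
  \<open>u\<close> times the kernels analytically across 0.
\<close>
definition exp_quotient :: "complex \<Rightarrow> complex" where
  "exp_quotient v = (if v = 0 then 1 else (1 - exp (- v)) / v)"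

lemma exp_quotient_holomorphic: "exp_quotient holomorphic_on UNIV"
proof -
  have d: "deriv (\<lambda>v::complex. 1 - exp (- v)) 0 = 1"
    by (rule DERIV_imp_deriv) (auto intro!: derivative_eq_intros)
  have hol: "(\<lambda>z. if z = 0 then deriv (\<lambda>v. 1 - exp (- v)) 0
          else ((1 - exp (- z)) - (1 - exp (- 0))) / (z - 0)) holomorphic_on (UNIV :: complex set)"
    by (intro pole_lemma_open holomorphic_intros) auto
  have eq: "(\<lambda>z. if z = 0 then deriv (\<lambda>v. 1 - exp (- v)) 0
          else ((1 - exp (- z)) - (1 - exp (- 0))) / (z - 0)) = exp_quotient"
    unfolding fun_eq_iff exp_quotient_def d by simp
  show ?thesis using hol unfolding eq .
qed

lemma exp_quotient_of_real_nonzero: "exp_quotient (of_real u) \<noteq> 0"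
proof (cases "u = 0")
  case False
  have "exp (- complex_of_real u) = of_real (exp (- u))" by (simp add: exp_of_real[symmetric])
  moreover have "exp (- u) \<noteq> 1" using False by simp
  ultimately show ?thesis using False unfolding exp_quotient_def by (simp add: exp_of_real)
qed (simp add: exp_quotient_def)

lemma exp_kernel_asymp:
  assumes A: "A > 0"
  shows "((\<lambda>u. exp_kernel A a u - A / u) \<longlongrightarrow> 1 / 2 - a) (at_right 0)"
proof -
  have "((\<lambda>u. exp (- (a / A * u)) / (1 - exp (- (u / A))) - A / u) \<longlongrightarrow> 1 / 2 - a) (at_right 0)"
  proof -
    have "((\<lambda>v. exp (- (a * v)) / (1 - exp (- v)) - 1 / v) \<longlongrightarrow> 1 / 2 - a) (at_right (0::real))"
      by real_asymp
    moreover have "filterlim (\<lambda>u. u / A) (at_right 0) (at_right 0)"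
      using A by real_asymp
    ultimately have "((\<lambda>u. exp (- (a * (u / A))) / (1 - exp (- (u / A))) - 1 / (u / A)) \<longlongrightarrow> 1 / 2 - a) (at_right 0)"
      by (rule filterlim_compose)
    thus ?thesis by simp
  qed
  thus ?thesis
    by (rule Lim_transform_eventually)
       (use eventually_at_right_less[of 0] in eventually_elim, simp add: exp_kernel_def)
qed

text \<open>
  \<open>\<Sum>B = \<Sum>A\<close> is what makes the poles of the kernels at \<open>u = 0\<close> cancel in \<open>P\<close>.
\<close>
locale balanced_gamma_ratio = gamma_ratio_params +
  assumes balanced: "(\<Sum>j=1..q. B j) = (\<Sum>i=1..p. A i)" and mu_pos: "\<mu> > 0"
begin

text \<open>
  Each kernel is \<open>A/u + (1/2 - a) + o(1)\<close>, and the constant terms add up to \<open>\<mu>\<close>.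
\<close>
lemma P_at_0: "(P \<longlongrightarrow> \<mu>) (at_right 0)"
proof -
  have "((\<lambda>u. (\<Sum>i=1..p. exp_kernel (A i) (a i) u - A i / u) - (\<Sum>j=1..q. exp_kernel (B j) (b j) u - B j / u))
     \<longlongrightarrow> (\<Sum>i=1..p. 1 / 2 - a i) - (\<Sum>j=1..q. 1 / 2 - b j)) (at_right 0)"
    using A_pos B_pos by (intro tendsto_diff tendsto_sum exp_kernel_asymp) auto
  moreover have "(\<Sum>i=1..p. 1 / 2 - a i) - (\<Sum>j=1..q. 1 / 2 - b j) = \<mu>"
    by (simp add: gamma_ratio_mu_def sum_subtractf diff_divide_distrib)
  moreover have "(\<Sum>i=1..p. exp_kernel (A i) (a i) u - A i / u) - (\<Sum>j=1..q. exp_kernel (B j) (b j) u - B j / u) = P u" for u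
    using balanced by (simp add: P_def sum_subtractf sum_divide_distrib[symmetric])
  ultimately show ?thesis by simp
qed

text \<open>
  The analytic continuation of \<open>u P(u)\<close>. Dividing by \<open>z\<close> and removing the singularity gives the continuation \<open>Pc\<close> of \<open>P\<close>;
  doing the same with \<open>Pc(z) - \<mu> exp(-z)\<close> gives \<open>Qc\<close>.
\<close>
definition \<Theta> :: "complex \<Rightarrow> complex" where
  "\<Theta> z = (\<Sum>i=1..p. of_real (A i) * exp (- (of_real (a i / A i) * z)) / exp_quotient (z / of_real (A i)))
       - (\<Sum>j=1..q. of_real (B j) * exp (- (of_real (b j / B j) * z)) / exp_quotient (z / of_real (B j)))"

text \<open>
  An open neighbourhood of the real line on which the denominators of \<open>\<Theta>\<close> have no zeros.
\<close>
definition S :: "complex set" where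
  "S = (\<Inter>i\<in>{1..p}. {z. exp_quotient (z / of_real (A i)) \<noteq> 0}) \<inter> (\<Inter>j\<in>{1..q}. {z. exp_quotient (z / of_real (B j)) \<noteq> 0})"

lemma open_S: "open S"
proof -
  have *: "open {z. exp_quotient (z / of_real r) \<noteq> 0}" if "r > 0" for r :: real
  proof -
    have "continuous_on UNIV (\<lambda>z. exp_quotient (z / of_real r))"
      using that by (intro continuous_on_compose2[OF holomorphic_on_imp_continuous_on[OF exp_quotient_holomorphic]]
          continuous_intros) auto
    hence "open ((\<lambda>z. exp_quotient (z / of_real r)) -` (- {0}))"
      by (intro open_vimage) auto
    thus ?thesis by (simp add: vimage_def)
  qed
  show ?thesis unfolding S_def
    using A_pos B_pos by (intro open_Int open_INT ballI *) auto
qed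

lemma of_real_in_S: "of_real u \<in> S"
  unfolding S_def using exp_quotient_of_real_nonzero[of "u / r" for r] by auto

lemma \<Theta>_holomorphic: "\<Theta> holomorphic_on S"
proof -
  have *: "(\<lambda>z. exp_quotient (z / of_real r)) holomorphic_on X" if "r > 0" for r :: real and X
  proof -
    have "(\<lambda>z. z / of_real r) holomorphic_on X" using that by (intro holomorphic_intros) auto
    from holomorphic_on_compose_gen[OF this exp_quotient_holomorphic] show ?thesis by (simp add: o_def)
  qed
  show ?thesis unfolding \<Theta>_def[abs_def] using A_pos B_pos
    by (intro holomorphic_intros *) (auto simp: S_def)
qed

lemma \<Theta>_0: "\<Theta> 0 = 0"
proof -
  have eq: "\<Theta> 0 = of_real ((\<Sum>i=1..p. A i) - (\<Sum>j=1..q. B j))" by (simp add: \<Theta>_def exp_quotient_def)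
  show ?thesis unfolding eq balanced by simp
qed

lemma \<Theta>_of_real: "u > 0 \<Longrightarrow> \<Theta> (of_real u) = of_real (u * P u)"
proof -
  assume u: "u > 0"
  have *: "of_real A * exp (- (of_real (a / A) * of_real u)) / exp_quotient (of_real u / of_real A) = of_real (u * exp_kernel A a u)"
    if "A > 0" for A a :: real
  proof -
    have "exp_quotient (of_real u / of_real A) = of_real ((1 - exp (- (u / A))) / (u / A))"
      using u that by (simp add: exp_quotient_def exp_of_real[symmetric])
    moreover have "exp (- (of_real (a / A) * of_real u)) = complex_of_real (exp (- (a / A * u)))"
      by (simp add: exp_of_real[symmetric])
    ultimately show ?thesis using u that by (simp add: exp_kernel_def)
  qed
  show ?thesis unfolding \<Theta>_def P_def using A_pos B_pos
    by (simp add: * right_diff_distrib sum_distrib_left del: of_real_divide)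
qed

definition Pc :: "complex \<Rightarrow> complex" where
  "Pc = (\<lambda>z. if z = 0 then deriv \<Theta> 0 else (\<Theta> z - \<Theta> 0) / (z - 0))"

lemma Pc_holomorphic: "Pc holomorphic_on S"
  unfolding Pc_def by (intro pole_lemma_open \<Theta>_holomorphic open_S)

lemma Pc_of_real: "u > 0 \<Longrightarrow> Pc (of_real u) = of_real (P u)"
  by (simp add: Pc_def \<Theta>_0 \<Theta>_of_real)

lemma Pc_0: "Pc 0 = of_real \<mu>"
proof -
  have "isCont Pc 0"
    using holomorphic_on_imp_continuous_on[OF Pc_holomorphic] open_S of_real_in_S[of 0]
    by (simp add: continuous_on_eq_continuous_at)
  hence "(Pc \<longlongrightarrow> Pc 0) (nhds (of_real 0))"
    by (simp add: continuous_at tendsto_at_iff_tendsto_nhds)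
  moreover have "filterlim complex_of_real (nhds (of_real 0)) (at_right 0)"
    by (intro tendsto_intros)
  ultimately have "((\<lambda>u. Pc (of_real u)) \<longlongrightarrow> Pc 0) (at_right (0::real))"
    by (rule filterlim_compose)
  moreover have "((\<lambda>u. Pc (of_real u)) \<longlongrightarrow> of_real \<mu>) (at_right (0::real))"
  proof (rule Lim_transform_eventually)
    show "((\<lambda>u. complex_of_real (P u)) \<longlongrightarrow> of_real \<mu>) (at_right 0)"
      by (intro tendsto_of_real P_at_0)
    show "\<forall>\<^sub>F u in at_right 0. complex_of_real (P u) = Pc (of_real u)"
      using eventually_at_right_less[of "0::real"] by eventually_elim (simp add: Pc_of_real)
  qed
  ultimately show ?thesis using tendsto_unique trivial_limit_at_right_real by blast
qed

definition Qc :: "complex \<Rightarrow> complex" where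
  "Qc = (\<lambda>z. if z = 0 then deriv (\<lambda>z. Pc z - of_real \<mu> * exp (- z)) 0
        else ((Pc z - of_real \<mu> * exp (- z)) - (Pc 0 - of_real \<mu> * exp (- 0))) / (z - 0))"

lemma Qc_holomorphic: "Qc holomorphic_on S"
  unfolding Qc_def by (intro pole_lemma_open holomorphic_intros Pc_holomorphic open_S)

definition Q :: "real \<Rightarrow> real" where
  "Q u = (if u < 0 then 0 else Re (Qc (of_real u)))"

lemma Q_eq: "u > 0 \<Longrightarrow> u * Q u = P u - \<mu> * exp (- u)"
proof -
  assume u: "u > 0"
  have "Qc (of_real u) = of_real ((P u - \<mu> * exp (- u)) / u)"
    using u by (simp add: Qc_def Pc_of_real Pc_0 exp_of_real[symmetric])
  thus ?thesis using u by (simp add: Q_def)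
qed

text \<open>
  On \<open>[0, \<infinity>)\<close> the function \<open>Q\<close> is the real part of a holomorphic function, so its derivative is bounded on the compact interval.
\<close>
lemma Q_lip: "\<exists>L\<ge>0. \<forall>x\<in>{0..T}. \<forall>y\<in>{0..T}. \<bar>Q x - Q y\<bar> \<le> L * \<bar>x - y\<bar>"
proof -
  let ?X = "complex_of_real ` {0..T}"
  have X: "?X \<subseteq> S" using of_real_in_S by auto
  have "compact (deriv Qc ` ?X)"
    using X Qc_holomorphic open_S
    by (intro compact_continuous_image holomorphic_on_imp_continuous_on
        holomorphic_on_subset[OF holomorphic_deriv]) (auto intro!: compact_continuous_image continuous_intros)
  then obtain L where L: "\<And>z. z \<in> ?X \<Longrightarrow> norm (deriv Qc z) \<le> L"
    using compact_imp_bounded bounded_iff by (metis (no_types, lifting) image_eqI)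
  have cvx: "convex ?X"
    by (intro convex_linear_image) (auto intro: bounded_linear.linear bounded_linear_of_real)
  have "\<bar>Q x - Q y\<bar> \<le> \<bar>L\<bar> * \<bar>x - y\<bar>" if xy: "x \<in> {0..T}" "y \<in> {0..T}" for x y
  proof -
    have "norm (Qc (of_real x) - Qc (of_real y)) \<le> L * norm (complex_of_real x - of_real y)"
    proof (rule field_differentiable_bound[OF cvx])
      fix z assume z: "z \<in> ?X"
      show "(Qc has_field_derivative deriv Qc z) (at z within ?X)"
        using holomorphic_derivI[OF Qc_holomorphic open_S] z X by (meson has_field_derivative_at_within subsetD)
    qed (use L xy in auto)
    also have "\<dots> \<le> \<bar>L\<bar> * \<bar>x - y\<bar>"
      by (simp add: norm_of_real of_real_diff[symmetric] mult_right_mono del: of_real_diff)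
    finally have "norm (Qc (of_real x) - Qc (of_real y)) \<le> \<bar>L\<bar> * \<bar>x - y\<bar>" .
    moreover have "\<bar>Q x - Q y\<bar> \<le> norm (Qc (of_real x) - Qc (of_real y))"
      using xy abs_Re_le_cmod[of "Qc (of_real x) - Qc (of_real y)"] by (simp add: Q_def)
    ultimately show ?thesis by linarith
  qed
  thus ?thesis by (intro exI[of _ "\<bar>L\<bar>"]) auto
qed

text \<open>
  Near 0 this is the Lipschitz bound; for \<open>x \<ge> 1\<close> the kernels are at most \<open>1/(1 - exp(-1/A))\<close>, since the
  parameters \<open>a\<close> and \<open>b\<close> are nonnegative.
\<close>
lemma Q_bounded: "\<exists>M. \<forall>x. \<bar>Q x\<bar> \<le> M"
proof -
  obtain L where L: "L \<ge> 0" "\<And>x. x \<in> {0..1} \<Longrightarrow> \<bar>Q x - Q 0\<bar> \<le> L * \<bar>x - 0\<bar>"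
    using Q_lip[of 1] by fastforce
  define K where "K = (\<Sum>i=1..p. 1 / (1 - exp (- (1 / A i)))) + (\<Sum>j=1..q. 1 / (1 - exp (- (1 / B j)))) + \<mu>"
  have ker: "exp_kernel A a u \<le> 1 / (1 - exp (- (1 / A)))" if "A > 0" "a \<ge> 0" "u \<ge> 1" for A a u :: real
  proof -
    have "exp (- (a / A * u)) / (1 - exp (- (u / A))) \<le> 1 / (1 - exp (- (1 / A)))"
      using that by (intro frac_le) (auto simp: divide_right_mono)
    thus ?thesis using that by (simp add: exp_kernel_def)
  qed
  have "\<bar>Q x\<bar> \<le> max (\<bar>Q 0\<bar> + L) K" for x
  proof -
    consider "x < 0" | "0 \<le> x" "x \<le> 1" | "x > 1" by linarith
    thus ?thesis
    proof cases
      case 1 thus ?thesis using L by (simp add: Q_def le_max_iff_disj)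
    next
      case 2
      have "\<bar>Q x - Q 0\<bar> \<le> L * \<bar>x - 0\<bar>" using 2 by (intro L) auto
      also have "\<dots> \<le> L" using 2 L by (simp add: mult_left_le)
      finally have "\<bar>Q x\<bar> \<le> \<bar>Q 0\<bar> + L" by linarith
      thus ?thesis by simp
    next
      case 3
      have "\<bar>Q x\<bar> \<le> \<bar>x * Q x\<bar>"
        using 3 mult_right_mono[of 1 x "\<bar>Q x\<bar>"] by (simp add: abs_mult)
      also have "\<dots> \<le> \<bar>P x\<bar> + \<mu> * exp (- x)"
        using 3 mu_pos by (subst Q_eq) (auto intro: order_trans[OF abs_triangle_ineq4])
      also have "\<mu> * exp (- x) \<le> \<mu>" using 3 mu_pos by simp
      also have "\<bar>P x\<bar> \<le> (\<Sum>i=1..p. exp_kernel (A i) (a i) x) + (\<Sum>j=1..q. exp_kernel (B j) (b j) x)"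
      proof -
        have "(\<Sum>i=1..p. exp_kernel (A i) (a i) x) \<ge> 0" "(\<Sum>j=1..q. exp_kernel (B j) (b j) x) \<ge> 0"
          using A_pos B_pos by (auto intro!: sum_nonneg exp_kernel_nonneg)
        thus ?thesis unfolding P_def by linarith
      qed
      also have "\<dots> \<le> (\<Sum>i=1..p. 1 / (1 - exp (- (1 / A i)))) + (\<Sum>j=1..q. 1 / (1 - exp (- (1 / B j))))"
        using 3 A_pos B_pos a_nonneg b_nonneg by (intro add_mono sum_mono ker) auto
      finally show ?thesis unfolding K_def by (simp add: le_max_iff_disj)
    qed
  qed
  thus ?thesis by blast
qed

lemma Q_meas [measurable]: "Q \<in> borel_measurable borel"
proof -
  have "(\<lambda>u. if u \<le> 0 then (if u = 0 then Q 0 else 0) else (P u - \<mu> * exp (- u)) / u) \<in> borel_measurable borel"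
    by measurable
  also have "(\<lambda>u. if u \<le> 0 then (if u = 0 then Q 0 else 0) else (P u - \<mu> * exp (- u)) / u) = Q"
    using Q_eq by (auto simp: fun_eq_iff field_simps Q_def)
  finally show ?thesis .
qed

end

section \<open>The Gamma ratio as a Laplace transform\<close>

text \<open>
  The density of the Gamma distribution up to its normalizing factor \<open>1/\<Gamma>(m)\<close>.
\<close>
definition gamma_density :: "real \<Rightarrow> real \<Rightarrow> real" where
  "gamma_density m t = t powr (m - 1) * exp (- t) * indicator {0<..} t"

lemma gamma_density_laplace:
  assumes m: "m > 0" and x: "x \<ge> 0"
  shows "integrable lborel (\<lambda>t. exp (- (x * t)) * gamma_density m t)"
    and "(\<integral>t. exp (- (x * t)) * gamma_density m t \<partial>lborel) = Gamma m * (x + 1) powr (- m)"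
proof -
  have meas: "gamma_density m \<in> borel_measurable lborel"
    unfolding gamma_density_def[abs_def] by measurable
  have "(\<integral>\<^sup>+t. ennreal (gamma_density m t) \<partial>lborel) = ennreal (Gamma m)"
    unfolding Gamma_conv_nn_integral_real[OF m]
    by (intro nn_integral_cong) (auto simp: gamma_density_def indicator_def exp_minus field_simps)
  hence "has_bochner_integral lborel (gamma_density m) (Gamma m)"
    using meas m by (intro has_bochner_integral_nn_integral)
      (auto simp: gamma_density_def indicator_def intro!: less_imp_le[OF Gamma_real_pos])
  hence I: "integrable lborel (gamma_density m)" "(\<integral>t. gamma_density m t \<partial>lborel) = Gamma m"
    by (auto simp: has_bochner_integral_iff)
  define y where "y = x + 1"
  have y: "y > 0" using x by (simp add: y_def)
  have eq: "exp (- (x * t)) * gamma_density m t = gamma_density m (0 + y * t) * y powr (1 - m)" for t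
  proof (cases "t > 0")
    case True
    have "exp (- (x * t)) * exp (- t) = exp (- (y * t))"
      by (simp add: y_def exp_add[symmetric] distrib_right)
    moreover have "(y * t) powr (m - 1) * y powr (1 - m) = t powr (m - 1)"
    proof -
      have 1: "(y * t) powr (m - 1) = y powr (m - 1) * t powr (m - 1)"
        using y True by (simp add: powr_mult)
      have 2: "y powr (m - 1) * y powr (1 - m) = 1"
        using y by (simp add: powr_add[symmetric])
      have "(y * t) powr (m - 1) * y powr (1 - m) = (y powr (m - 1) * y powr (1 - m)) * t powr (m - 1)"
        unfolding 1 by (simp only: mult_ac)
      thus ?thesis unfolding 2 by simp
    qed
    moreover have "exp (- (x * t)) * (t powr (m - 1) * exp (- t)) = t powr (m - 1) * (exp (- (x * t)) * exp (- t))"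
      by (simp only: mult_ac)
    ultimately have "exp (- (x * t)) * (t powr (m - 1) * exp (- t))
        = (y * t) powr (m - 1) * y powr (1 - m) * exp (- (y * t))" by simp
    thus ?thesis using True y by (simp add: gamma_density_def mult_ac)
  qed (use y in \<open>simp add: gamma_density_def zero_less_mult_iff\<close>)
  show "integrable lborel (\<lambda>t. exp (- (x * t)) * gamma_density m t)"
    unfolding eq using y by (intro integrable_mult_left lborel_integrable_real_affine I) auto
  have "Gamma m = \<bar>y\<bar> *\<^sub>R (\<integral>t. gamma_density m (0 + y * t) \<partial>lborel)"
    unfolding I(2)[symmetric] using y by (intro lborel_integral_real_affine) auto
  hence "(\<integral>t. gamma_density m (0 + y * t) \<partial>lborel) = Gamma m / y"
    using y by (simp add: field_simps)
  hence "(\<integral>t. exp (- (x * t)) * gamma_density m t \<partial>lborel) = Gamma m / y * y powr (1 - m)"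
    unfolding eq by simp
  also have "y powr (1 - m) = y powr (- m) * y"
    using y powr_add[of y "- m" 1] by (simp add: algebra_simps)
  finally show "(\<integral>t. exp (- (x * t)) * gamma_density m t \<partial>lborel) = Gamma m * (x + 1) powr (- m)"
    using y by (simp add: y_def)
qed

lemma differentiable_imp_lipschitz_at:
  fixes f :: "real \<Rightarrow> real"
  assumes "(f has_real_derivative D) (at t)"
  shows "\<exists>d>0. \<exists>K. \<forall>v. \<bar>v - t\<bar> < d \<longrightarrow> \<bar>f v - f t\<bar> \<le> K * \<bar>v - t\<bar>"
proof -
  have "((\<lambda>v. (f v - f t) / (v - t)) \<longlongrightarrow> D) (at t)"
    using assms by (simp add: has_field_derivative_iff)
  hence "\<forall>\<^sub>F v in at t. dist ((f v - f t) / (v - t)) D < 1"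
    by (rule tendstoD) simp
  then obtain d where d: "d > 0" "\<And>v. v \<noteq> t \<Longrightarrow> dist v t < d \<Longrightarrow> dist ((f v - f t) / (v - t)) D < 1"
    by (auto simp: eventually_at)
  have "\<bar>f v - f t\<bar> \<le> (\<bar>D\<bar> + 1) * \<bar>v - t\<bar>" if "\<bar>v - t\<bar> < d" for v
  proof (cases "v = t")
    case False
    have "\<bar>(f v - f t) / (v - t)\<bar> \<le> \<bar>D\<bar> + 1"
      using d(2)[OF False] that unfolding dist_real_def by linarith
    thus ?thesis using False by (simp add: abs_divide divide_simps)
  qed simp
  thus ?thesis using d(1) by blast
qed

context balanced_gamma_ratio
begin

definition M :: real where "M = (SOME M. \<forall>x. \<bar>Q x\<bar> \<le> M)"

sublocale convolution_exponential Q "gamma_density \<mu>" M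
proof
  show "\<bar>Q x\<bar> \<le> M" for x
    using someI_ex[OF Q_bounded] by (simp add: M_def)
  show "integrable lborel (gamma_density \<mu>)"
    using gamma_density_laplace(1)[OF mu_pos, of 0] by simp
  show "\<exists>d>0. \<exists>K. \<forall>v. \<bar>v - t\<bar> < d \<longrightarrow> \<bar>gamma_density \<mu> v - gamma_density \<mu> t\<bar> \<le> K * \<bar>v - t\<bar>"
    if t: "t > 0" for t
  proof (rule differentiable_imp_lipschitz_at)
    have "((\<lambda>t. t powr (\<mu> - 1) * exp (- t)) has_real_derivative
       ((\<mu> - 1) * t powr (\<mu> - 1 - 1) * exp (- t) - t powr (\<mu> - 1) * exp (- t))) (at t)"
      using t by (auto intro!: derivative_eq_intros)
    thus "(gamma_density \<mu> has_real_derivative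
       ((\<mu> - 1) * t powr (\<mu> - 1 - 1) * exp (- t) - t powr (\<mu> - 1) * exp (- t))) (at t)"
      by (rule has_field_derivative_transform_within_open[where S = "{0<..}"])
         (use t in \<open>auto simp: gamma_density_def\<close>)
  qed
qed (use Q_lip Q_meas in \<open>auto simp: Q_def gamma_density_def\<close>)

lemma P_eq: "P u = u * Q u + \<mu> * (exp (- u) * indicator {0<..} u)"
proof (cases "u > 0")
  case False
  hence "exp_kernel A a u = 0" for A a by (simp add: exp_kernel_def)
  thus ?thesis using False by (cases "u = 0") (auto simp: P_def Q_def)
qed (simp add: Q_eq)

lemma laplace_P:
  assumes x: "x > 0"
  shows "integrable lborel (\<lambda>u. exp (- (x * u)) * P u)"
    and "(\<integral>u. exp (- (x * u)) * P u \<partial>lborel) = (\<integral>u. u ^ 1 * exp (- (x * u)) * Q u \<partial>lborel) + \<mu> / (x + 1)"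
proof -
  have eq: "exp (- (x * u)) * P u = u ^ 1 * exp (- (x * u)) * Q u + \<mu> * (u ^ 0 * exp (- ((x + 1) * u)) * indicator {0<..} u)" for u
  proof -
    have "exp (- ((x + 1) * u)) = exp (- (x * u)) * exp (- u)"
      by (simp add: exp_add[symmetric] distrib_right)
    thus ?thesis by (simp add: P_eq distrib_left mult_ac)
  qed
  have i1: "integrable lborel (\<lambda>u. u ^ 1 * exp (- (x * u)) * Q u)"
    using laplace_moment_integrable[of Q, OF Q_supp Q_laplace_int x] .
  have i2: "integrable lborel (\<lambda>u. \<mu> * (u ^ 0 * exp (- ((x + 1) * u)) * indicator {0<..} u))"
    using x by (intro integrable_mult_right laplace_power) auto
  show "integrable lborel (\<lambda>u. exp (- (x * u)) * P u)"
    unfolding eq by (intro Bochner_Integration.integrable_add i1 i2)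
  show "(\<integral>u. exp (- (x * u)) * P u \<partial>lborel) = (\<integral>u. u ^ 1 * exp (- (x * u)) * Q u \<partial>lborel) + \<mu> / (x + 1)"
    unfolding eq Bochner_Integration.integral_add[OF i1 i2]
    using laplace_power(2)[of "x + 1" 0] x by simp
qed

lemma P_supp: "u < 0 \<Longrightarrow> P u = 0"
  by (simp add: P_eq Q_def)

lemma laplace_P_tendsto_0: "((\<lambda>x. \<integral>u. exp (- (x * u)) * P u \<partial>lborel) \<longlongrightarrow> 0) at_top"
proof -
  have "((\<lambda>x. \<integral>u. exp (- (x * u)) * P u \<partial>lborel) \<longlongrightarrow> (\<integral>u. 0 \<partial>(lborel :: real measure))) at_top"
  proof (rule integral_dominated_convergence_at_top[where w = "\<lambda>u. \<bar>exp (- (1 * u)) * P u\<bar>"])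
    show "\<forall>\<^sub>F x in at_top. AE u in lborel. norm (exp (- (x * u)) * P u) \<le> \<bar>exp (- (1 * u)) * P u\<bar>"
      using eventually_ge_at_top[of 1]
    proof eventually_elim
      case (elim x)
      show ?case
      proof (intro AE_I2)
        fix u :: real
        show "norm (exp (- (x * u)) * P u) \<le> \<bar>exp (- (1 * u)) * P u\<bar>"
          using elim P_supp[of u] mult_right_mono[of 1 x u]
          by (cases "u < 0") (auto simp: abs_mult intro!: mult_right_mono)
      qed
    qed
    show "AE u in lborel. ((\<lambda>x. exp (- (x * u)) * P u) \<longlongrightarrow> 0) at_top"
    proof (intro AE_I2)
      fix u :: real
      show "((\<lambda>x. exp (- (x * u)) * P u) \<longlongrightarrow> 0) at_top"
      proof (cases "u > 0")
        case True
        have "((\<lambda>x. exp (- (x * u))) \<longlongrightarrow> 0) at_top" using True by real_asymp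
        from tendsto_mult[OF this tendsto_const[of "P u"]] show ?thesis by simp
      next
        case False
        hence "P u = 0" by (cases "u = 0") (auto simp: P_eq Q_def)
        thus ?thesis by simp
      qed
    qed
    show "integrable lborel (\<lambda>u. \<bar>exp (- (1 * u)) * P u\<bar>)"
      using laplace_P(1)[of 1] by (intro integrable_abs) simp
  qed measurable
  thus ?thesis by simp
qed

text \<open>
  Both sides have the derivative \<open>-g 1\<close>, so they differ by a constant, which is determined by the limits at infinity.
\<close>
lemma g0_eq:
  assumes x: "x > 0"
  shows "g 0 x = - ln \<rho> + (\<integral>u. exp (- (x * u)) * P u \<partial>lborel)"
proof -
  let ?N = "\<lambda>x. \<integral>u. exp (- (x * u)) * P u \<partial>lborel"
  have D: "((\<lambda>x. g 0 x - ?N x) has_real_derivative 0) (at y)" if "y > 0" for y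
  proof -
    have "((\<lambda>x. \<integral>u. u ^ 0 * exp (- (x * u)) * P u \<partial>lborel) has_real_derivative
             - (\<integral>u. u ^ Suc 0 * exp (- (y * u)) * P u \<partial>lborel)) (at y)"
      using laplace_moment_has_derivative[of P, OF P_supp laplace_P(1) that] .
    hence "(?N has_real_derivative - g 1 y) (at y)"
      using g_eq_moment(2)[OF that, of 1] by simp
    from DERIV_diff[OF g_deriv[OF that, of 0] this] show ?thesis by simp
  qed
  have "\<exists>c. \<forall>y\<in>{0<..}. g 0 y - ?N y = c"
    by (rule has_field_derivative_zero_constant)
       (use D in \<open>auto intro: has_field_derivative_at_within\<close>)
  then obtain c where c: "\<And>y. y > 0 \<Longrightarrow> g 0 y - ?N y = c" by auto
  have "((\<lambda>y. g 0 y - ?N y) \<longlongrightarrow> - ln \<rho> - 0) at_top"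
    using g0_asymp balanced by (intro tendsto_diff laplace_P_tendsto_0) simp
  moreover have "((\<lambda>y. g 0 y - ?N y) \<longlongrightarrow> c) at_top"
    by (rule tendsto_eventually) (use eventually_gt_at_top[of 0] in eventually_elim, rule c)
  ultimately have "c = - ln \<rho>"
    using tendsto_unique[of "at_top :: real filter"] by fastforce
  thus ?thesis using c[OF x] by simp
qed

text \<open>
  The logarithms of both sides have the same derivative, by the formula for \<open>g 0\<close> and the decomposition
  \<open>P(u) = u Q(u) + \<mu> exp(-u)\<close>: the factor \<open>u\<close> is the one produced by differentiating the transform of
  \<open>Q\<close>, and \<open>\<mu>/(x + 1)\<close> is the transform of \<open>\<mu> exp(-u)\<close>.
\<close>
lemma W_factorization:
  obtains C where "\<And>x. x > 0 \<Longrightarrow> W x = C * exp (x * ln \<rho>) * (x + 1) powr (- \<mu>) * exp (\<integral>u. exp (- (x * u)) * Q u \<partial>lborel)"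
proof -
  let ?R = "\<lambda>x. \<integral>u. exp (- (x * u)) * Q u \<partial>lborel"
  let ?V = "\<lambda>x. ln (W x) - x * ln \<rho> + \<mu> * ln (x + 1) - ?R x"
  have D: "(?V has_real_derivative 0) (at x)" if x: "x > 0" for x
  proof -
    have "((\<lambda>x. \<integral>u. u ^ 0 * exp (- (x * u)) * Q u \<partial>lborel) has_real_derivative
             - (\<integral>u. u ^ Suc 0 * exp (- (x * u)) * Q u \<partial>lborel)) (at x)"
      using laplace_moment_has_derivative[of Q, OF Q_supp Q_laplace_int x] .
    hence R: "(?R has_real_derivative - (\<integral>u. u ^ 1 * exp (- (x * u)) * Q u \<partial>lborel)) (at x)"
      by simp
    have "(?V has_real_derivative (- g 0 x - ln \<rho> + \<mu> / (x + 1) - - (\<integral>u. u ^ 1 * exp (- (x * u)) * Q u \<partial>lborel))) (at x)"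
    proof (intro DERIV_diff DERIV_add R ln_W_deriv x)
      show "((\<lambda>x. x * ln \<rho>) has_real_derivative ln \<rho>) (at x)" by (auto intro!: derivative_eq_intros)
      show "((\<lambda>x. \<mu> * ln (x + 1)) has_real_derivative \<mu> / (x + 1)) (at x)"
        using x by (auto intro!: derivative_eq_intros)
    qed
    thus ?thesis using g0_eq[OF x] laplace_P(2)[OF x] by simp
  qed
  have "\<exists>c. \<forall>x\<in>{0<..}. ?V x = c"
    by (rule has_field_derivative_zero_constant)
       (use D in \<open>auto intro: has_field_derivative_at_within\<close>)
  then obtain c where c: "\<And>x. x > 0 \<Longrightarrow> ?V x = c" by auto
  show ?thesis
  proof (rule that[of "exp c"])
    fix x :: real assume x: "x > 0"
    have "ln (W x) = c + x * ln \<rho> - \<mu> * ln (x + 1) + ?R x" using c[OF x] by simp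
    hence "exp (ln (W x)) = exp c * exp (x * ln \<rho>) * exp (- \<mu> * ln (x + 1)) * exp (?R x)"
      by (simp only: exp_add[symmetric]) simp
    thus "W x = exp c * exp (x * ln \<rho>) * (x + 1) powr (- \<mu>) * exp (?R x)"
      using x W_pos[OF x] by (simp add: powr_def)
  qed
qed

text \<open>
  \<open>f\<close> is a multiple of \<open>h\<close>, shifted by \<open>-ln \<rho>\<close> to account for the factor \<open>\<rho>^x\<close>.
\<close>
lemma W_laplace:
  obtains f where "\<And>t. t \<le> - ln \<rho> \<Longrightarrow> f t = 0"
    and "\<And>x. x > 0 \<Longrightarrow> integrable lborel (\<lambda>t. exp (- (x * t)) * f t)"
    and "\<And>x. x > 0 \<Longrightarrow> (\<integral>t. exp (- (x * t)) * f t \<partial>lborel) = W x"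
    and "\<And>t. t > - ln \<rho> \<Longrightarrow> \<exists>d>0. \<exists>K. \<forall>v. \<bar>v - t\<bar> < d \<longrightarrow> \<bar>f v - f t\<bar> \<le> K * \<bar>v - t\<bar>"
proof -
  obtain C where C: "\<And>x. x > 0 \<Longrightarrow> W x = C * exp (x * ln \<rho>) * (x + 1) powr (- \<mu>) * exp (\<integral>u. exp (- (x * u)) * Q u \<partial>lborel)"
    using W_factorization by blast
  define t0 where "t0 = - ln \<rho>"
  define D where "D = C / Gamma \<mu>"
  define f where "f = (\<lambda>t. if t \<le> t0 then 0 else D * h (t - t0))"
  have shift: "integrable lborel (\<lambda>t. exp (- (x * t)) * (D * h (t - t0)))"
       "(\<integral>t. exp (- (x * t)) * (D * h (t - t0)) \<partial>lborel) = W x" if x: "x > 0" for x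
  proof -
    let ?F = "\<lambda>v. D * exp (- (x * t0)) * (exp (- (x * v)) * h v)"
    have eq: "exp (- (x * t)) * (D * h (t - t0)) = ?F (- t0 + 1 * t)" for t
    proof -
      have "exp (- (x * t)) = exp (- (x * t0)) * exp (- (x * (t - t0)))"
        by (simp add: exp_add[symmetric] right_diff_distrib)
      thus ?thesis by simp
    qed
    have F: "integrable lborel ?F" using h_laplace(1)[OF x] by simp
    show "integrable lborel (\<lambda>t. exp (- (x * t)) * (D * h (t - t0)))"
      unfolding eq by (rule lborel_integrable_real_affine[OF F]) simp
    have "(\<integral>t. exp (- (x * t)) * (D * h (t - t0)) \<partial>lborel) = (\<integral>v. ?F v \<partial>lborel)"
      unfolding eq by (subst lborel_integral_real_affine[of 1 ?F "- t0"]) simp_all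
    also have "\<dots> = D * exp (- (x * t0)) * (Gamma \<mu> * (x + 1) powr (- \<mu>) * exp (\<integral>u. exp (- (x * u)) * Q u \<partial>lborel))"
      using h_laplace(2)[OF x] gamma_density_laplace(2)[OF mu_pos, of x] x by simp
    also have "\<dots> = W x"
      using C[OF x] Gamma_real_pos[OF mu_pos] by (simp add: D_def t0_def)
    finally show "(\<integral>t. exp (- (x * t)) * (D * h (t - t0)) \<partial>lborel) = W x" .
  qed
  \<comment> \<open>The two functions may differ at \<open>t0\<close>, where \<open>f\<close> is set to 0; a point is a null set.\<close>
  have f_eq: "f t = D * h (t - t0)" if "t \<notin> {t0}" for t
    using that h_supp[of "t - t0"] by (auto simp: f_def)
  show ?thesis
  proof (rule that[of f])
    show "f t = 0" if "t \<le> - ln \<rho>" for t using that by (simp add: f_def t0_def)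
    show "integrable lborel (\<lambda>t. exp (- (x * t)) * f t)" if "x > 0" for x
      using shift(1)[OF that]
      by (subst integrable_discrete_difference[where X = "{t0}" and g = "\<lambda>t. exp (- (x * t)) * (D * h (t - t0))"])
         (auto simp: f_eq)
    show "(\<integral>t. exp (- (x * t)) * f t \<partial>lborel) = W x" if "x > 0" for x
      unfolding shift(2)[OF that, symmetric]
      by (rule integral_discrete_difference[where X = "{t0}"]) (auto simp: f_eq)
    show "\<exists>d>0. \<exists>K. \<forall>v. \<bar>v - t\<bar> < d \<longrightarrow> \<bar>f v - f t\<bar> \<le> K * \<bar>v - t\<bar>" if t: "t > - ln \<rho>" for t
    proof -
      have pos: "t - t0 > 0" using t by (simp add: t0_def)
      from h_lipschitz[OF this] obtain d K where d: "d > 0"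
        "\<And>v. \<bar>v - (t - t0)\<bar> < d \<Longrightarrow> \<bar>h v - h (t - t0)\<bar> \<le> K * \<bar>v - (t - t0)\<bar>" by blast
      have "\<bar>f v - f t\<bar> \<le> (\<bar>D\<bar> * K) * \<bar>v - t\<bar>" if v: "\<bar>v - t\<bar> < min d (t - t0)" for v
      proof -
        have "f v - f t = D * (h (v - t0) - h (t - t0))"
          using v pos by (simp add: f_def right_diff_distrib) linarith
        moreover have "\<bar>h (v - t0) - h (t - t0)\<bar> \<le> K * \<bar>v - t\<bar>"
          using d(2)[of "v - t0"] v by simp
        ultimately show ?thesis by (simp add: abs_mult mult.assoc mult_left_mono)
      qed
      thus ?thesis using d(1) pos by (intro exI[of _ "min d (t - t0)"]) auto
    qed
  qed
qed

end

section \<open>The H-function\<close>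

context gamma_ratio_params
begin

abbreviation "Wc \<equiv> gamma_ratio p q A a B b :: complex \<Rightarrow> complex"
abbreviation "\<gamma> \<equiv> fox_H_abscissa p A a"

lemma abscissa_le_0: "\<gamma> \<le> 0"
proof -
  have "(MIN k\<in>{1..p}. a k / A k) \<ge> 0"
    using p1 A_pos a_nonneg by (subst Min_ge_iff) (auto intro!: divide_nonneg_pos)
  thus ?thesis by (simp add: fox_H_abscissa_def)
qed

lemma Wc_of_real: "Wc (of_real x) = of_real (W x)"
  unfolding gamma_ratio_def
  by (simp add: Gamma_complex_of_real[symmetric] del: of_real_add of_real_mult)
     (simp add: of_real_eq_id)

text \<open>
  To the right of \<open>\<gamma>\<close> the arguments in the numerator have positive real part, and the reciprocals of the
  denominators are entire.
\<close>
lemma Wc_holomorphic: "Wc holomorphic_on {s. Re s > \<gamma>}"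
proof -
  have eq: "Wc s = (\<Prod>i=1..p. Gamma (of_real (A i) * s + of_real (a i))) * (\<Prod>j=1..q. rGamma (of_real (B j) * s + of_real (b j)))" for s
    unfolding gamma_ratio_def by (simp add: Gamma_def prod_inversef[symmetric] divide_inverse)
  have pos: "of_real (A i) * s + of_real (a i) \<notin> \<int>\<^sub>\<le>\<^sub>0" if "Re s > \<gamma>" "i \<in> {1..p}" for s :: complex and i
  proof -
    have "(MIN k\<in>{1..p}. a k / A k) \<le> a i / A i"
      using that by (intro Min_le) auto
    hence "- (a i / A i) < Re s" using that by (simp add: fox_H_abscissa_def)
    hence "0 < A i * Re s + a i" using A_pos[OF that(2)] by (simp add: field_simps)
    thus ?thesis by (auto elim!: nonpos_Ints_cases simp: complex_eq_iff)
  qed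
  show ?thesis unfolding eq[abs_def]
    using pos by (intro holomorphic_intros) auto
qed

lemma fox_H_truncated_exp:
  "fox_H_truncated p q A a B b c (exp (- t)) R =
     1 / (2 * of_real pi * \<i>) * contour_integral (linepath (Complex c (- R)) (Complex c R)) (\<lambda>s. Wc s * exp (s * of_real t))"
proof -
  have "of_real (exp (- t)) powr (- s) = exp (s * of_real t)" for s :: complex
  proof -
    have "Ln (of_real (exp (- t))) = of_real (- t)"
      by (subst Ln_of_real) auto
    thus ?thesis by (simp add: powr_def)
  qed
  thus ?thesis by (simp add: fox_H_truncated_def)
qed

end

context balanced_gamma_ratio
begin

text \<open>
  The function \<open>f\<close> with Laplace transform \<open>W\<close> is nonnegative because the alternating derivatives of \<open>W\<close> are; hence Landau's
  theorem applies, and inversion on the line \<open>Re s = c\<close> recovers \<open>f(t)\<close> as the limit defining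
  \<open>H(exp(-t))\<close>.
\<close>
theorem laplace_representation_of_alternating:
  assumes rho_le: "\<rho> \<le> 1" and g_nonneg: "\<And>n x. x > 0 \<Longrightarrow> g n x \<ge> 0"
  shows "fox_H_laplace_representation p q A a B b"
proof -
  obtain f where f0: "\<And>t. t \<le> - ln \<rho> \<Longrightarrow> f t = 0"
    and f_int: "\<And>x. x > 0 \<Longrightarrow> integrable lborel (\<lambda>t. exp (- (x * t)) * f t)"
    and f_lap: "\<And>x. x > 0 \<Longrightarrow> (\<integral>t. exp (- (x * t)) * f t \<partial>lborel) = W x"
    and f_lip: "\<And>t. t > - ln \<rho> \<Longrightarrow> \<exists>d>0. \<exists>K. \<forall>v. \<bar>v - t\<bar> < d \<longrightarrow> \<bar>f v - f t\<bar> \<le> K * \<bar>v - t\<bar>"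
    using W_laplace by blast
  \<comment> \<open>\<open>\<rho> \<le> 1\<close> puts the support of \<open>f\<close> into the half-line, where the powers \<open>v ^ n\<close> are nonnegative.\<close>
  have t0: "- ln \<rho> \<ge> 0" using rho_le rho_pos by simp
  have supp: "f v = 0" if "v < 0" for v using that t0 f0[of v] by linarith
  define w where "w = (\<lambda>n x. \<integral>v. v ^ n * exp (- (x * v)) * f v \<partial>lborel)"
  have w_deriv: "(w n has_real_derivative - w (Suc n) x) (at x)" if "x > 0" for n x
    using laplace_moment_has_derivative[of f, OF supp f_int that] unfolding w_def .
  have w0: "w 0 x = W x" if "x > 0" for x using f_lap[OF that] by (simp add: w_def)
  have w1: "w 1 x = w 0 x * g 0 x" if x: "x > 0" for x
  proof -
    have "((\<lambda>y. exp (ln (W y))) has_real_derivative exp (ln (W x)) * - g 0 x) (at x)"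
      by (intro DERIV_fun_exp ln_W_deriv x)
    hence "(w 0 has_real_derivative exp (ln (W x)) * - g 0 x) (at x)"
      by (rule has_field_derivative_transform_within_open[where S = "{0<..}"]) (use x W_pos w0 in auto)
    from DERIV_unique[OF this w_deriv[OF x, of 0]] show ?thesis using W_pos[OF x] w0[OF x] by simp
  qed
  have mom: "w n x \<ge> 0" if "x > 0" for n x
    by (rule alternating_derivatives_nonneg[OF w_deriv g_deriv w1 _ g_nonneg that])
       (use w0 W_pos in \<open>auto intro: less_imp_le\<close>)
  have f_nonneg: "f t \<ge> 0" for t
  proof (cases "t \<le> - ln \<rho>")
    case False
    have "isCont f t"
    proof -
      obtain d K where d: "d > 0" "\<And>v. \<bar>v - t\<bar> < d \<Longrightarrow> \<bar>f v - f t\<bar> \<le> K * \<bar>v - t\<bar>"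
        using f_lip[of t] False by auto
      have "((\<lambda>v. f v - f t) \<longlongrightarrow> 0) (at t)"
      proof (rule Lim_null_comparison)
        show "\<forall>\<^sub>F v in at t. norm (f v - f t) \<le> K * \<bar>v - t\<bar>"
          unfolding eventually_at using d by (auto simp: dist_real_def)
        show "((\<lambda>v. K * \<bar>v - t\<bar>) \<longlongrightarrow> 0) (at t)" by (auto intro!: tendsto_eq_intros)
      qed
      thus ?thesis by (simp add: isCont_def LIM_zero_iff)
    qed
    thus ?thesis
      using nonneg_of_laplace_moments_nonneg[of f, OF supp f_int mom[unfolded w_def]] False t0 by simp
  qed (simp add: f0)
  have Wc_lap: "Wc (of_real x) = of_real (\<integral>v. exp (- (x * v)) * f v \<partial>lborel)" if "x > 0" for x
    using f_lap[OF that] by (simp add: Wc_of_real)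
  have landau_int: "integrable lborel (\<lambda>v. exp (- (s * of_real v)) * complex_of_real (f v))"
    and landau_eq: "Wc s = (\<integral>v. exp (- (s * of_real v)) * of_real (f v) \<partial>lborel)" if "Re s > \<gamma>" for s
    using landau_laplace[of f Wc \<gamma> s, OF f_nonneg supp f_int Wc_holomorphic abscissa_le_0 Wc_lap that] by blast+
  have lim: "(fox_H_truncated p q A a B b c (exp (- t)) \<longlongrightarrow> of_real (f t)) at_top"
    if c: "c > \<gamma>" and t: "t > - ln \<rho>" for c t
  proof -
    obtain d K where d: "d > 0" "\<And>v. \<bar>v - t\<bar> < d \<Longrightarrow> \<bar>f v - f t\<bar> \<le> K * \<bar>v - t\<bar>"
      using f_lip[OF t] by auto
    have "integrable lborel (\<lambda>v. norm (exp (- (of_real c * of_real v)) * complex_of_real (f v)))"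
      using landau_int[of "of_real c"] c by (intro integrable_norm) simp
    hence int: "integrable lborel (\<lambda>v. exp (- (c * v)) * f v)"
      using f_nonneg by (simp add: norm_mult)
    show ?thesis unfolding fox_H_truncated_exp
      by (rule bromwich_inversion[OF int _ d]) (use landau_eq c in simp)
  qed
  have H: "fox_H p q A a B b c (exp (- t)) = of_real (f t)" if "c > \<gamma>" "t > - ln \<rho>" for c t
    unfolding fox_H_def using lim[OF that] by (intro tendsto_Lim) auto
  have lnrho: "ln (1 / \<rho>) = - ln \<rho>" using rho_pos by (simp add: ln_div)
  show ?thesis
    unfolding fox_H_laplace_representation_def lnrho
  proof (intro allI impI conjI)
    fix c t assume "c > \<gamma>" "t > - ln \<rho>"
    thus "(fox_H_truncated p q A a B b c (exp (- t)) \<longlongrightarrow> fox_H p q A a B b c (exp (- t))) at_top"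
      and "fox_H p q A a B b c (exp (- t)) \<in> \<real>\<^sub>\<ge>\<^sub>0"
      using lim H f_nonneg by auto
  next
    fix c x :: real assume c: "c > \<gamma>" and x: "x > 0"
    have "((\<lambda>t. exp (- (x * t)) * f t) has_integral W x) UNIV"
      using has_integral_integral_lborel[OF f_int[OF x]] f_lap[OF x] by simp
    hence "((\<lambda>t. complex_of_real (exp (- (x * t)) * f t)) has_integral of_real (W x)) UNIV"
      by (rule has_integral_of_real)
    hence "((\<lambda>t. if t \<in> {- ln \<rho><..} then complex_of_real (exp (- (x * t)) * f t) else 0) has_integral of_real (W x)) UNIV"
      by (rule has_integral_eq[rotated]) (auto simp: f0)
    hence "((\<lambda>t. complex_of_real (exp (- (x * t)) * f t)) has_integral of_real (W x)) {- ln \<rho><..}"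
      by (simp only: has_integral_restrict_UNIV)
    thus "((\<lambda>t. of_real (exp (- t * x)) * fox_H p q A a B b c (exp (- t))) has_integral of_real (W x)) {- ln \<rho><..}"
      by (rule has_integral_eq[rotated]) (use H[OF c] in \<open>auto simp: mult.commute\<close>)
  qed
qed

text \<open>
  For \<open>n \<ge> 1\<close> the alternating derivatives are moments of \<open>P\<close>; for \<open>n = 0\<close> there is the additional constant
  \<open>-ln \<rho>\<close>, which is nonnegative as \<open>\<rho> \<le> 1\<close>.
\<close>
theorem laplace_representation_of_P_nonneg:
  assumes "\<rho> \<le> 1" and P_nonneg: "\<And>u. u > 0 \<Longrightarrow> P u \<ge> 0"
  shows "fox_H_laplace_representation p q A a B b"
proof (rule laplace_representation_of_alternating[OF assms(1)])
  have P0: "P u \<ge> 0" for u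
    using P_nonneg[of u] P_supp[of u] by (cases "u = 0") (auto simp: P_eq[of 0] not_less_iff_gr_or_eq intro: linorder_cases[of u 0])
  have sgn: "u ^ n * exp (- (x * u)) * P u \<ge> 0" for u n and x :: real
    using P0[of u] P_supp[of u] by (cases "u < 0") auto
  fix n and x :: real assume x: "x > 0"
  show "g n x \<ge> 0"
  proof (cases "n = 0")
    case True
    have "(\<integral>u. exp (- (x * u)) * P u \<partial>lborel) \<ge> 0"
      using P0 by (intro Bochner_Integration.integral_nonneg) simp
    moreover have "- ln \<rho> \<ge> 0" using assms(1) rho_pos by simp
    ultimately show ?thesis unfolding True g0_eq[OF x] by linarith
  next
    case False
    thus ?thesis using g_eq_moment(2)[OF x, of n, symmetric] sgn
      by (auto intro!: Bochner_Integration.integral_nonneg)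
  qed
qed

end

context gamma_ratio_params
begin

text \<open>
  \<open>g 0\<close> stays bounded, being nonnegative and decreasing. Dividing \<open>g 0 x - \<delta> ln x \<rightarrow> -ln \<rho>\<close> by \<open>ln x\<close> therefore gives
  \<open>\<delta> = 0\<close>, and then \<open>-ln \<rho>\<close> is a limit of nonnegative numbers.
\<close>
theorem laplace_representation_of_log_cm:
  assumes mu: "\<mu> > 0" and lcm: "log_completely_monotonic W"
  shows "fox_H_laplace_representation p q A a B b"
proof -
  define G where "G = (\<lambda>x. - deriv (\<lambda>y. ln (W y)) x)"
  have cm: "completely_monotonic G"
    using lcm by (simp add: log_completely_monotonic_def G_def)
  have G_eq: "G x = g 0 x" if "x > 0" for x
    using DERIV_imp_deriv[OF ln_W_deriv[OF that]] by (simp add: G_def)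
  have dG: "(deriv ^^ n) G x = (-1) ^ n * g n x" if "x > 0" for n x
    using that
  proof (induction n arbitrary: x)
    case (Suc n)
    have "((\<lambda>x. (-1) ^ n * g n x) has_real_derivative (-1) ^ n * - g (Suc n) x) (at x)"
      by (intro DERIV_cmult g_deriv Suc.prems)
    hence "((deriv ^^ n) G has_real_derivative (-1) ^ n * - g (Suc n) x) (at x)"
      by (rule has_field_derivative_transform_within_open[where S = "{0<..}"]) (use Suc in auto)
    thus ?case by (simp add: DERIV_imp_deriv)
  qed (simp add: G_eq)
  have g_nonneg: "g n x \<ge> 0" if x: "x > 0" for n x
  proof (cases "n = 0")
    case True
    have "G x \<ge> 0" using cm x unfolding completely_monotonic_def by blast
    thus ?thesis using True G_eq[OF x] by simp
  next
    case False
    have "(-1) ^ n * (deriv ^^ n) G x \<ge> 0" using cm x False by (simp add: completely_monotonic_def)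
    also have "(-1) ^ n * (deriv ^^ n) G x = ((-1) ^ n * (-1) ^ n) * g n x"
      unfolding dG[OF x] by (simp only: mult.assoc)
    finally show ?thesis by (simp add: power_mult_distrib[symmetric])
  qed
  have g_mono: "g 0 y \<le> g 0 x" if "0 < x" "x \<le> y" for x y
  proof (rule DERIV_nonpos_imp_nonincreasing[of x y "g 0"])
    fix z assume "x \<le> z" "z \<le> y"
    hence "z > 0" using that by simp
    thus "\<exists>D. (g 0 has_real_derivative D) (at z) \<and> D \<le> 0"
      using g_deriv[of z 0] g_nonneg[of z "Suc 0"] by (intro exI[of _ "- g (Suc 0) z"]) simp
  qed (use that in simp)
  define \<delta> where "\<delta> = (\<Sum>j=1..q. B j) - (\<Sum>i=1..p. A i)"
  have lim: "((\<lambda>x. g 0 x - \<delta> * ln x) \<longlongrightarrow> - ln \<rho>) at_top"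
    using g0_asymp by (simp add: \<delta>_def)
  have bd: "\<forall>\<^sub>F x in at_top. 0 \<le> g 0 x \<and> g 0 x \<le> g 0 1"
    using eventually_ge_at_top[of 1] by eventually_elim (use g_nonneg g_mono[of 1] in auto)
  have "\<delta> = 0"
  proof (rule ccontr)
    assume \<delta>: "\<delta> \<noteq> 0"
    have "((\<lambda>x. (g 0 x - (g 0 x - \<delta> * ln x)) / ln x) \<longlongrightarrow> 0 - 0) at_top"
      unfolding diff_divide_distrib
    proof (intro tendsto_diff)
      show "((\<lambda>x. g 0 x / ln x) \<longlongrightarrow> 0) at_top"
      proof (rule Lim_null_comparison)
        show "\<forall>\<^sub>F x in at_top. norm (g 0 x / ln x) \<le> g 0 1 / ln x"
          using bd eventually_gt_at_top[of 1] by eventually_elim (auto simp: divide_right_mono)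
        have "((\<lambda>x. g 0 1 * (1 / ln x)) \<longlongrightarrow> g 0 1 * 0) at_top"
          by (intro tendsto_mult tendsto_const) real_asymp
        thus "((\<lambda>x. g 0 1 / ln x) \<longlongrightarrow> 0) at_top" by simp
      qed
      have "((\<lambda>x. (g 0 x - \<delta> * ln x) * (1 / ln x)) \<longlongrightarrow> - ln \<rho> * 0) at_top"
        by (intro tendsto_mult lim) real_asymp
      thus "((\<lambda>x. g 0 x / ln x - \<delta> * ln x / ln x) \<longlongrightarrow> 0) at_top" by (simp add: diff_divide_distrib)
    qed
    moreover have "((\<lambda>x. (g 0 x - (g 0 x - \<delta> * ln x)) / ln x) \<longlongrightarrow> \<delta>) at_top"
      by (rule tendsto_eventually) (use eventually_gt_at_top[of 1] in eventually_elim, simp)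
    ultimately have "\<delta> = 0" using tendsto_unique[of "at_top :: real filter"] by fastforce
    thus False using \<delta> by simp
  qed
  interpret balanced_gamma_ratio p q A a B b
    by unfold_locales (use \<open>\<delta> = 0\<close> mu in \<open>auto simp: \<delta>_def\<close>)
  have "0 \<le> - ln \<rho>"
  proof (rule tendsto_lowerbound)
    show "(g 0 \<longlongrightarrow> - ln \<rho>) at_top" using lim \<open>\<delta> = 0\<close> by simp
    show "\<forall>\<^sub>F x in at_top. 0 \<le> g 0 x" using bd by (auto elim: eventually_mono)
  qed simp
  hence "\<rho> \<le> 1" using rho_pos by simp
  thus ?thesis using laplace_representation_of_alternating g_nonneg by blast
qed

end

section \<open>Sufficient conditions for a nonnegative density\<close>

text \<open>
  This and the next bound rest on \<open>1 - exp(-v) \<le> v \<le> exp v - 1\<close>. Replacing the upper denominator by \<open>exp v - 1\<close>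
  is what shifts \<open>b\<close> to \<open>b - 1\<close> in the conditions (a) and (b).
\<close>
lemma exp_kernel_lower:
  assumes A: "A > 0" and u: "u > 0"
  shows "exp (- (a / A * u)) * A / u \<le> exp_kernel A a u"
proof -
  have "1 - exp (- (u / A)) \<le> u / A" using exp_ge_add_one_self[of "- (u / A)"] by simp
  moreover have "1 - exp (- (u / A)) > 0" using A u by simp
  ultimately have "exp (- (a / A * u)) / (u / A) \<le> exp (- (a / A * u)) / (1 - exp (- (u / A)))"
    using A u by (intro divide_left_mono) auto
  thus ?thesis using A u by (simp add: exp_kernel_def)
qed

lemma exp_kernel_upper:
  assumes B: "B > 0" and u: "u > 0"
  shows "exp_kernel B b u \<le> exp (- ((b - 1) / B * u)) * B / u"
proof -
  have "u / B \<le> exp (u / B) - 1" using exp_ge_add_one_self[of "u / B"] by linarith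
  hence "exp (- ((b - 1) / B * u)) / (exp (u / B) - 1) \<le> exp (- ((b - 1) / B * u)) / (u / B)"
    using B u by (intro divide_left_mono) auto
  moreover have "exp (- ((b - 1) / B * u)) / (exp (u / B) - 1) = exp_kernel B b u"
  proof -
    have "exp (- (b / B * u)) * exp (u / B) = exp (- ((b - 1) / B * u))"
      unfolding exp_add[symmetric] by (simp add: diff_divide_distrib left_diff_distrib)
    moreover have "(1 - exp (- (u / B))) * exp (u / B) = exp (u / B) - 1"
      by (simp add: left_diff_distrib exp_add[symmetric])
    ultimately have "exp (- ((b - 1) / B * u)) / (exp (u / B) - 1)
        = (exp (- (b / B * u)) * exp (u / B)) / ((1 - exp (- (u / B))) * exp (u / B))" by simp
    thus ?thesis using u by (simp add: exp_kernel_def)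
  qed
  ultimately show ?thesis by simp
qed

text \<open>
  Summation by parts: inductively, the weighted sum up to \<open>k\<close> is at least \<open>w\<^sub>k\<close> times the plain sum up to \<open>k\<close>.
\<close>
lemma abel_sum_nonneg:
  fixes w d :: "nat \<Rightarrow> real"
  assumes w: "\<And>i. i \<in> {1..p} \<Longrightarrow> w i \<ge> 0" and mono: "\<And>i. i \<in> {1..<p} \<Longrightarrow> w (Suc i) \<le> w i"
    and D: "\<And>k. k \<in> {1..p} \<Longrightarrow> (\<Sum>i=1..k. d i) \<ge> 0"
  shows "(\<Sum>i=1..p. w i * d i) \<ge> 0"
proof (cases "p = 0")
  case False
  have "k \<le> p \<Longrightarrow> w k * (\<Sum>i=1..k. d i) \<le> (\<Sum>i=1..k. w i * d i)" if "k \<ge> 1" for k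
    using that
  proof (induction k rule: dec_induct)
    case (step k)
    have "w (Suc k) * (\<Sum>i=1..k. d i) \<le> w k * (\<Sum>i=1..k. d i)"
      using step mono D by (intro mult_right_mono) auto
    thus ?case using step by (simp add: distrib_left)
  qed simp
  from this[of p] False show ?thesis
    using mult_nonneg_nonneg[OF w[of p] D[of p]] by simp
qed simp

text \<open>
  A weak majorization inequality for the convex decreasing function \<open>exp(-u \<cdot>)\<close>. Bounding it below by its tangents at the
  points \<open>y\<^sub>i\<close> leaves a sum of the differences \<open>y\<^sub>i - x\<^sub>i\<close> with weights that decrease as the \<open>y\<^sub>i\<close> increase.
\<close>
lemma sum_exp_supermajorization:
  fixes x y :: "nat \<Rightarrow> real"
  assumes u: "u > 0" and y: "mono_on {1..p} y"
    and le: "\<And>k. k \<in> {1..p} \<Longrightarrow> (\<Sum>i=1..k. x i) \<le> (\<Sum>i=1..k. y i)"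
  shows "(\<Sum>i=1..p. exp (- (u * y i))) \<le> (\<Sum>i=1..p. exp (- (u * x i)))"
proof -
  have "0 \<le> (\<Sum>i=1..p. exp (- (u * y i)) * (u * (y i - x i)))"
  proof (rule abel_sum_nonneg)
    show "exp (- (u * y (Suc i))) \<le> exp (- (u * y i))" if "i \<in> {1..<p}" for i
      using that u y by (auto simp: mono_on_def)
    show "0 \<le> (\<Sum>i=1..k. u * (y i - x i))" if "k \<in> {1..p}" for k
      using le[OF that] u by (simp add: sum_distrib_left[symmetric] sum_subtractf)
  qed simp
  also have "\<dots> \<le> (\<Sum>i=1..p. exp (- (u * x i)) - exp (- (u * y i)))"
  proof (rule sum_mono)
    fix i
    have "exp (- (u * y i)) * (1 + u * (y i - x i)) \<le> exp (- (u * y i)) * exp (u * (y i - x i))"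
      by (intro mult_left_mono exp_ge_add_one_self) simp
    also have "\<dots> = exp (- (u * x i))" unfolding exp_add[symmetric] by (simp add: right_diff_distrib)
    finally show "exp (- (u * y i)) * (u * (y i - x i)) \<le> exp (- (u * x i)) - exp (- (u * y i))"
      by (simp add: distrib_left)
  qed
  finally show ?thesis by (simp add: sum_subtractf)
qed

context balanced_gamma_ratio
begin

text \<open>
  With \<open>m\<close> the maximum of the \<open>a\<^sub>i/A\<^sub>i\<close>, both sums are separated by \<open>exp(-m u)/u\<close> times the common value
  \<open>\<Sum>A = \<Sum>B\<close>.
\<close>
lemma P_nonneg_a:
  assumes "(MAX i\<in>{1..p}. a i / A i) \<le> (MIN j\<in>{1..q}. (b j - 1) / B j)" and u: "u > 0"
  shows "P u \<ge> 0"
proof -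
  define m where "m = (MAX i\<in>{1..p}. a i / A i)"
  have am: "a i / A i \<le> m" if "i \<in> {1..p}" for i
    unfolding m_def using that by (intro Max_ge) auto
  have mb: "m \<le> (b j - 1) / B j" if "j \<in> {1..q}" for j
    using assms(1) unfolding m_def by (rule order_trans) (use that in \<open>intro Min_le; auto\<close>)
  have "(\<Sum>j=1..q. exp_kernel (B j) (b j) u) \<le> (\<Sum>j=1..q. exp (- (m * u)) * B j / u)"
  proof (rule sum_mono)
    fix j assume j: "j \<in> {1..q}"
    have "exp_kernel (B j) (b j) u \<le> exp (- ((b j - 1) / B j * u)) * B j / u"
      by (rule exp_kernel_upper[OF B_pos[OF j] u])
    also have "\<dots> \<le> exp (- (m * u)) * B j / u"
      using mb[OF j] u B_pos[OF j]
      by (intro divide_right_mono mult_right_mono) (auto simp del: times_divide_eq_left)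
    finally show "exp_kernel (B j) (b j) u \<le> exp (- (m * u)) * B j / u" .
  qed
  also have "\<dots> = (\<Sum>i=1..p. exp (- (m * u)) * A i / u)"
    using balanced by (simp only: sum_divide_distrib[symmetric] sum_distrib_left[symmetric])
  also have "\<dots> \<le> (\<Sum>i=1..p. exp_kernel (A i) (a i) u)"
  proof (rule sum_mono)
    fix i assume i: "i \<in> {1..p}"
    have "exp (- (m * u)) * A i / u \<le> exp (- (a i / A i * u)) * A i / u"
      using am[OF i] u A_pos[OF i]
      by (intro divide_right_mono mult_right_mono) (auto simp del: times_divide_eq_left)
    also have "\<dots> \<le> exp_kernel (A i) (a i) u"
      by (rule exp_kernel_lower[OF A_pos[OF i] u])
    finally show "exp (- (m * u)) * A i / u \<le> exp_kernel (A i) (a i) u" .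
  qed
  finally show ?thesis by (simp add: P_def)
qed

text \<open>
  The kernel bounds leave \<open>(A\<^sub>i - B\<^sub>i) exp(-\<beta>\<^sub>i u)/u\<close> with \<open>\<beta>\<^sub>i = (b\<^sub>i - 1)/B\<^sub>i\<close>. For \<open>i < p\<close> the coefficient is nonnegative and
  \<open>\<beta>\<^sub>i \<le> \<beta>\<^sub>p\<close>, so every \<open>\<beta>\<^sub>i\<close> may be replaced by \<open>\<beta>\<^sub>p\<close>; then the coefficients sum to 0.
\<close>
lemma P_nonneg_b:
  assumes pq: "p = q" and AB: "\<And>i. i \<in> {1..p-1} \<Longrightarrow> A i \<ge> B i"
    and bp: "p = 1 \<or> (MAX k\<in>{1..p-1}. b k / B k) \<le> (b p - 1) / B p"
    and ab: "\<And>i. i \<in> {1..p} \<Longrightarrow> a i / A i \<le> (b i - 1) / B i" and u: "u > 0"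
  shows "P u \<ge> 0"
proof -
  define \<beta> where "\<beta> = (\<lambda>i. (b i - 1) / B i)"
  have term_le: "(A i - B i) * exp (- (\<beta> p * u)) / u \<le> exp_kernel (A i) (a i) u - exp_kernel (B i) (b i) u"
    if i: "i \<in> {1..p}" for i
  proof -
    have iq: "i \<in> {1..q}" using i pq by simp
    have "(A i - B i) * exp (- (\<beta> p * u)) \<le> (A i - B i) * exp (- (\<beta> i * u))"
    proof (cases "i = p")
      case False
      hence i': "i \<in> {1..p-1}" and "p \<noteq> 1" using i by auto
      have "\<beta> i \<le> b i / B i" using B_pos[OF iq] by (simp add: \<beta>_def divide_right_mono)
      also have "\<dots> \<le> (MAX k\<in>{1..p-1}. b k / B k)" using i' by (intro Max_ge) auto
      also have "\<dots> \<le> \<beta> p" using bp \<open>p \<noteq> 1\<close> by (simp add: \<beta>_def)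
      finally show ?thesis using AB[OF i'] u by (intro mult_left_mono) auto
    qed simp
    hence "(A i - B i) * exp (- (\<beta> p * u)) / u \<le> exp (- (\<beta> i * u)) * A i / u - exp (- (\<beta> i * u)) * B i / u"
      using u by (simp add: diff_divide_distrib[symmetric] divide_right_mono left_diff_distrib mult.commute)
    also have "exp (- (\<beta> i * u)) * A i / u \<le> exp (- (a i / A i * u)) * A i / u"
      using ab[OF i] u A_pos[OF i]
      by (intro divide_right_mono mult_right_mono) (auto simp: \<beta>_def simp del: times_divide_eq_left)
    also have "\<dots> \<le> exp_kernel (A i) (a i) u" by (rule exp_kernel_lower[OF A_pos[OF i] u])
    finally have "(A i - B i) * exp (- (\<beta> p * u)) / u \<le> exp_kernel (A i) (a i) u - exp (- (\<beta> i * u)) * B i / u"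
      by simp
    moreover have "exp_kernel (B i) (b i) u \<le> exp (- (\<beta> i * u)) * B i / u"
      unfolding \<beta>_def by (rule exp_kernel_upper[OF B_pos[OF iq] u])
    ultimately show ?thesis by linarith
  qed
  have "0 = (\<Sum>i=1..p. (A i - B i) * exp (- (\<beta> p * u)) / u)"
    using balanced pq by (simp add: sum_divide_distrib[symmetric] sum_distrib_right[symmetric] sum_subtractf)
  also have "\<dots> \<le> (\<Sum>i=1..p. exp_kernel (A i) (a i) u - exp_kernel (B i) (b i) u)"
    by (intro sum_mono term_le)
  also have "\<dots> = P u"
  proof -
    have "(\<Sum>i=1..p. exp_kernel (B i) (b i) u) = (\<Sum>j=1..q. exp_kernel (B j) (b j) u)"
      using pq by simp
    thus ?thesis by (simp only: P_def sum_subtractf)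
  qed
  finally show ?thesis .
qed

text \<open>
  In the geometric expansions, the exponents \<open>(a\<^sub>i + n)/A\<^sub>i\<close> and \<open>(b\<^sub>i + n)/B\<^sub>i\<close> satisfy the
  hypotheses of the majorization inequality for each fixed \<open>n\<close>, being combinations of the two given pairs of
  sequences with coefficients 1 and \<open>n\<close>.
\<close>
lemma P_nonneg_c:
  assumes pq: "p = q" and mono_b: "mono_on {1..p} (\<lambda>i. b i / B i)" and mono_B: "mono_on {1..p} (\<lambda>i. 1 / B i)"
    and le: "\<And>k. k \<in> {1..p} \<Longrightarrow> (\<Sum>i=1..k. a i / A i) \<le> (\<Sum>i=1..k. b i / B i)"
      "\<And>k. k \<in> {1..p} \<Longrightarrow> (\<Sum>i=1..k. 1 / A i) \<le> (\<Sum>i=1..k. 1 / B i)"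
    and u: "u > 0"
  shows "P u \<ge> 0"
proof -
  have sA: "(\<lambda>n. \<Sum>i=1..p. exp (- ((a i + real n) / A i * u))) sums (\<Sum>i=1..p. exp_kernel (A i) (a i) u)"
    by (intro sums_sum exp_kernel_sums A_pos u)
  have sB: "(\<lambda>n. \<Sum>j=1..q. exp (- ((b j + real n) / B j * u))) sums (\<Sum>j=1..q. exp_kernel (B j) (b j) u)"
    by (intro sums_sum exp_kernel_sums B_pos u)
  have "(\<Sum>j=1..q. exp_kernel (B j) (b j) u) \<le> (\<Sum>i=1..p. exp_kernel (A i) (a i) u)"
  proof (rule sums_le[OF _ sB sA])
    fix n
    have split: "(c + real n) / C = c / C + real n * (1 / C)" for c C :: real
      by (simp add: add_divide_distrib)
    have "(\<Sum>i=1..p. exp (- (u * ((b i + real n) / B i)))) \<le> (\<Sum>i=1..p. exp (- (u * ((a i + real n) / A i))))"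
    proof (rule sum_exp_supermajorization[OF u])
      show "mono_on {1..p} (\<lambda>i. (b i + real n) / B i)"
        unfolding split
        by (intro mono_onI add_mono mult_left_mono mono_onD[OF mono_b] mono_onD[OF mono_B]) auto
      show "(\<Sum>i=1..k. (a i + real n) / A i) \<le> (\<Sum>i=1..k. (b i + real n) / B i)" if "k \<in> {1..p}" for k
        unfolding split sum.distrib sum_distrib_left[symmetric]
        using le[OF that] by (intro add_mono mult_left_mono) auto
    qed
    thus "(\<Sum>j=1..q. exp (- ((b j + real n) / B j * u))) \<le> (\<Sum>i=1..p. exp (- ((a i + real n) / A i * u)))"
      using pq by (simp add: mult.commute)
  qed
  thus ?thesis by (simp add: P_def)
qed

end

theorem theorem7:
  fixes p q :: nat and A a B b :: "nat \<Rightarrow> real"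
  assumes "p \<ge> 1" and "q \<ge> 1"
    and "\<forall>i\<in>{1..p}. A i > 0" and "\<forall>j\<in>{1..q}. B j > 0"
    and "\<forall>i\<in>{1..p}. a i \<ge> 0" and "\<forall>j\<in>{1..q}. b j \<ge> 0"
  shows
    "(gamma_ratio_mu p q a b > 0 \<and>
        log_completely_monotonic (gamma_ratio p q A a B b)
      \<longrightarrow> fox_H_laplace_representation p q A a B b)
     \<and>
     (gamma_ratio_mu p q a b > 0 \<and>
        (\<Sum>j=1..q. B j) = (\<Sum>i=1..p. A i) \<and>
        gamma_ratio_rho p q A B \<le> 1 \<and>
        ((MAX i\<in>{1..p}. a i / A i) \<le> (MIN j\<in>{1..q}. (b j - 1) / B j)
         \<or>
         (p = q \<and>
          (\<forall>i\<in>{1..p-1}. A i \<ge> B i) \<and>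
          (p = 1 \<or> (MAX k\<in>{1..p-1}. b k / B k) \<le> (b p - 1) / B p) \<and>
          (\<forall>i\<in>{1..p}. a i / A i \<le> (b i - 1) / B i))
         \<or>
         (p = q \<and>
          0 \<le> a 1 / A 1 \<and> mono_on {1..p} (\<lambda>i. a i / A i) \<and>
          0 \<le> b 1 / B 1 \<and> mono_on {1..p} (\<lambda>i. b i / B i) \<and>
          0 < 1 / A 1 \<and> mono_on {1..p} (\<lambda>i. 1 / A i) \<and>
          0 < 1 / B 1 \<and> mono_on {1..p} (\<lambda>i. 1 / B i) \<and>
          (\<forall>k\<in>{1..p}. (\<Sum>i=1..k. a i / A i) \<le> (\<Sum>i=1..k. b i / B i) \<and>
                       (\<Sum>i=1..k. 1 / A i) \<le> (\<Sum>i=1..k. 1 / B i))))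
      \<longrightarrow> fox_H_laplace_representation p q A a B b)"
proof (intro conjI impI; elim conjE)
  interpret gamma_ratio_params p q A a B b
    by unfold_locales (use assms in auto)
  show "fox_H_laplace_representation p q A a B b"
    if "gamma_ratio_mu p q a b > 0" "log_completely_monotonic (gamma_ratio p q A a B b)"
    using that by (rule laplace_representation_of_log_cm)
  assume mu: "gamma_ratio_mu p q a b > 0" and bal: "(\<Sum>j=1..q. B j) = (\<Sum>i=1..p. A i)"
    and rho: "gamma_ratio_rho p q A B \<le> 1"
  interpret balanced_gamma_ratio p q A a B b
    by unfold_locales (use mu bal in auto)
  assume "(MAX i\<in>{1..p}. a i / A i) \<le> (MIN j\<in>{1..q}. (b j - 1) / B j)
         \<or>
         (p = q \<and>
          (\<forall>i\<in>{1..p-1}. A i \<ge> B i) \<and>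
          (p = 1 \<or> (MAX k\<in>{1..p-1}. b k / B k) \<le> (b p - 1) / B p) \<and>
          (\<forall>i\<in>{1..p}. a i / A i \<le> (b i - 1) / B i))
         \<or>
         (p = q \<and>
          0 \<le> a 1 / A 1 \<and> mono_on {1..p} (\<lambda>i. a i / A i) \<and>
          0 \<le> b 1 / B 1 \<and> mono_on {1..p} (\<lambda>i. b i / B i) \<and>
          0 < 1 / A 1 \<and> mono_on {1..p} (\<lambda>i. 1 / A i) \<and>
          0 < 1 / B 1 \<and> mono_on {1..p} (\<lambda>i. 1 / B i) \<and>
          (\<forall>k\<in>{1..p}. (\<Sum>i=1..k. a i / A i) \<le> (\<Sum>i=1..k. b i / B i) \<and>
                       (\<Sum>i=1..k. 1 / A i) \<le> (\<Sum>i=1..k. 1 / B i)))"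
  hence "P u \<ge> 0" if "u > 0" for u
  proof (elim disjE, goal_cases)
    case 1
    thus ?case using that by (rule P_nonneg_a)
  next
    case 2
    show ?case by (rule P_nonneg_b) (use 2 that in auto)
  next
    case 3
    show ?case by (rule P_nonneg_c) (use 3 that in auto)
  qed
  thus "fox_H_laplace_representation p q A a B b"
    using laplace_representation_of_P_nonneg rho by blast
qed

end
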